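(* Let $(M,g)$ be a compact Lorentzian manifold with a null Killing field $V$. Assume that the distribution $V^\perp$ is integrable. Then the foliation tangent to $V^\perp$ is totally geodesic, and every geodesic of $M$ tangent to it is complete.
   Context: A null Killing field is a Killing vector field $V$ that is nowhere zero and satisfies $g(V,V)=0$ everywhere. $V^\perp$ denotes the codimension $1$ distribution $g$-orthogonal to $V$. A foliation is totally geodesic if every geodesic of $(M,g)$ tangent to a leaf at one point stays locally in that leaf. A geodesic is complete if its maximal affinely parametrized extension is defined on all of $\mathbb{R}$. *)

theory Defs
  imports "HOL-Analysis.Analysis"
begin

section \<open>Smooth manifolds\<close>

text \<open>The recursion is meant for open \<open>S\<close>; \<open>C\<^sup>k\<close> is expressed by directional derivatives in
  all fixed directions.\<close>

primrec Ck_on :: "nat \<Rightarrow> 'a::euclidean_space set \<Rightarrow> ('a \<Rightarrow> 'b::real_normed_vector) \<Rightarrow> bool" where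
  "Ck_on 0 S f \<longleftrightarrow> continuous_on S f"
| "Ck_on (Suc k) S f \<longleftrightarrow> (\<forall>x\<in>S. f differentiable (at x)) \<and>
     (\<forall>v. Ck_on k S (\<lambda>x. frechet_derivative f (at x) v))"

definition smooth_on :: "'a::euclidean_space set \<Rightarrow> ('a \<Rightarrow> 'b::real_normed_vector) \<Rightarrow> bool" where
  "smooth_on S f \<longleftrightarrow> (\<forall>k. Ck_on k S f)"

text \<open>A chart is a pair of its domain and its coordinate map; the values of the map outside the
  domain carry no meaning.\<close>

type_synonym ('m, 'e) chart = "'m set \<times> ('m \<Rightarrow> 'e)"

abbreviation cdom :: "('m, 'e) chart \<Rightarrow> 'm set" where "cdom c \<equiv> fst c"

abbreviation cmap :: "('m, 'e) chart \<Rightarrow> 'm \<Rightarrow> 'e" where "cmap c \<equiv> snd c"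

definition cimage :: "('m, 'e) chart \<Rightarrow> 'e set" where
  "cimage c = cmap c ` cdom c"

definition cinv :: "('m, 'e) chart \<Rightarrow> 'e \<Rightarrow> 'm" where
  "cinv c = inv_into (cdom c) (cmap c)"

definition is_chart :: "('m::topological_space, 'e::euclidean_space) chart \<Rightarrow> bool" where
  "is_chart c \<longleftrightarrow> open (cdom c) \<and> open (cimage c) \<and>
     homeomorphism (cdom c) (cimage c) (cmap c) (cinv c)"

definition transition :: "('m, 'e) chart \<Rightarrow> ('m, 'e) chart \<Rightarrow> 'e \<Rightarrow> 'e" where
  "transition c d = cmap d \<circ> cinv c"

definition compatible ::
    "('m::topological_space, 'e::euclidean_space) chart \<Rightarrow> ('m, 'e) chart \<Rightarrow> bool" where
  "compatible c d \<longleftrightarrow>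
     smooth_on (cmap c ` (cdom c \<inter> cdom d)) (transition c d) \<and>
     smooth_on (cmap d ` (cdom c \<inter> cdom d)) (transition d c)"

text \<open>The manifold is the whole type \<open>'m\<close>, modelled on the Euclidean space \<open>'e\<close>, hence without
  boundary; the smooth structure is given by a maximal atlas.\<close>

definition smooth_structure ::
    "('m::{t2_space, second_countable_topology}, 'e::euclidean_space) chart set \<Rightarrow> bool" where
  "smooth_structure A \<longleftrightarrow>
     (\<forall>c\<in>A. is_chart c) \<and> (\<Union>c\<in>A. cdom c) = UNIV \<and>
     (\<forall>c\<in>A. \<forall>d\<in>A. compatible c d) \<and>
     (\<forall>c. is_chart c \<and> (\<forall>d\<in>A. compatible c d) \<longrightarrow> c \<in> A)"


section \<open>Tangent vectors and vector fields\<close>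

text \<open>A tangent vector at \<open>p\<close> assigns to every chart around \<open>p\<close> a coordinate vector, such that the
  coordinate vectors are related by the derivatives of the transition maps. The value \<open>0\<close> at
  all other charts makes the representation unique.\<close>

type_synonym ('m, 'e) tvec = "('m, 'e) chart \<Rightarrow> 'e"

definition tangent_space ::
    "('m, 'e::euclidean_space) chart set \<Rightarrow> 'm \<Rightarrow> ('m, 'e) tvec set" where
  "tangent_space A p = {\<xi>.
     (\<forall>c. \<not> (c \<in> A \<and> p \<in> cdom c) \<longrightarrow> \<xi> c = 0) \<and>
     (\<forall>c\<in>A. \<forall>d\<in>A. p \<in> cdom c \<inter> cdom d \<longrightarrow>
        \<xi> d = frechet_derivative (transition c d) (at (cmap c p)) (\<xi> c))}"

text \<open>The tangent vector at \<open>p\<close> whose coordinate vector in the chart \<open>c\<close> is \<open>u\<close>.\<close>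

definition tvec_of ::
    "('m, 'e::euclidean_space) chart set \<Rightarrow> ('m, 'e) chart \<Rightarrow> 'm \<Rightarrow> 'e \<Rightarrow> ('m, 'e) tvec" where
  "tvec_of A c p u = (\<lambda>d. if d \<in> A \<and> p \<in> cdom d
     then frechet_derivative (transition c d) (at (cmap c p)) u else 0)"

definition velocity ::
    "('m, 'e::euclidean_space) chart set \<Rightarrow> (real \<Rightarrow> 'm) \<Rightarrow> real \<Rightarrow> ('m, 'e) tvec" where
  "velocity A \<gamma> t = (\<lambda>c. if c \<in> A \<and> \<gamma> t \<in> cdom c
     then vector_derivative (cmap c \<circ> \<gamma>) (at t) else 0)"

definition vf_coord :: "('m \<Rightarrow> ('m, 'e) tvec) \<Rightarrow> ('m, 'e) chart \<Rightarrow> 'e \<Rightarrow> 'e" where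
  "vf_coord V c x = V (cinv c x) c"

definition smooth_vector_field ::
    "('m, 'e::euclidean_space) chart set \<Rightarrow> ('m \<Rightarrow> ('m, 'e) tvec) \<Rightarrow> bool" where
  "smooth_vector_field A V \<longleftrightarrow>
     (\<forall>p. V p \<in> tangent_space A p) \<and> (\<forall>c\<in>A. smooth_on (cimage c) (vf_coord V c))"


section \<open>Lorentzian metrics\<close>

text \<open>Only the values of \<open>g p\<close> on the tangent space at \<open>p\<close> carry meaning.\<close>

type_synonym ('m, 'e) metric = "'m \<Rightarrow> ('m, 'e) tvec \<Rightarrow> ('m, 'e) tvec \<Rightarrow> real"

definition metric_coord ::
    "('m, 'e::euclidean_space) chart set \<Rightarrow> ('m, 'e) metric \<Rightarrow> ('m, 'e) chart \<Rightarrow>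
      'e \<Rightarrow> 'e \<Rightarrow> 'e \<Rightarrow> real" where
  "metric_coord A g c x u w =
     g (cinv c x) (tvec_of A c (cinv c x) u) (tvec_of A c (cinv c x) w)"

text \<open>Signature \<open>(-, +, \<dots>, +)\<close>, expressed by an orthonormal frame indexed by \<open>Basis\<close>. The frame
  \<open>e\<close> is a basis, since its Gram matrix is invertible.\<close>

definition lorentzian_form :: "('e::euclidean_space \<Rightarrow> 'e \<Rightarrow> real) \<Rightarrow> bool" where
  "lorentzian_form B \<longleftrightarrow> bilinear B \<and> (\<forall>u w. B u w = B w u) \<and>
     (\<exists>e :: 'e \<Rightarrow> 'e. \<exists>b0\<in>Basis. \<forall>i\<in>Basis. \<forall>j\<in>Basis.
        B (e i) (e j) = (if i \<noteq> j then 0 else if i = b0 then -1 else 1))"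

definition lorentzian_metric ::
    "('m, 'e::euclidean_space) chart set \<Rightarrow> ('m, 'e) metric \<Rightarrow> bool" where
  "lorentzian_metric A g \<longleftrightarrow> DIM('e) \<ge> 2 \<and>
     (\<forall>c\<in>A. (\<forall>x\<in>cimage c. lorentzian_form (metric_coord A g c x)) \<and>
            (\<forall>u w. smooth_on (cimage c) (\<lambda>x. metric_coord A g c x u w)))"


section \<open>Null Killing fields\<close>

text \<open>Coordinate expression of the Lie derivative \<open>L\<^sub>V g\<close>, that is
  \<open>V\<^sup>k \<partial>\<^sub>k g\<^sub>i\<^sub>j + g\<^sub>k\<^sub>j \<partial>\<^sub>i V\<^sup>k + g\<^sub>i\<^sub>k \<partial>\<^sub>j V\<^sup>k\<close> contracted with \<open>u\<close> and \<open>w\<close>.\<close>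

definition lie_metric ::
    "('m, 'e::euclidean_space) chart set \<Rightarrow> ('m, 'e) metric \<Rightarrow> ('m \<Rightarrow> ('m, 'e) tvec) \<Rightarrow>
      ('m, 'e) chart \<Rightarrow> 'e \<Rightarrow> 'e \<Rightarrow> 'e \<Rightarrow> real" where
  "lie_metric A g V c x u w =
     frechet_derivative (\<lambda>y. metric_coord A g c y u w) (at x) (vf_coord V c x)
     + metric_coord A g c x (frechet_derivative (vf_coord V c) (at x) u) w
     + metric_coord A g c x u (frechet_derivative (vf_coord V c) (at x) w)"

definition killing_field ::
    "('m, 'e::euclidean_space) chart set \<Rightarrow> ('m, 'e) metric \<Rightarrow> ('m \<Rightarrow> ('m, 'e) tvec) \<Rightarrow> bool" where
  "killing_field A g V \<longleftrightarrow> smooth_vector_field A V \<and>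
     (\<forall>c\<in>A. \<forall>x\<in>cimage c. \<forall>u w. lie_metric A g V c x u w = 0)"

definition null_killing_field ::
    "('m, 'e::euclidean_space) chart set \<Rightarrow> ('m, 'e) metric \<Rightarrow> ('m \<Rightarrow> ('m, 'e) tvec) \<Rightarrow> bool" where
  "null_killing_field A g V \<longleftrightarrow> killing_field A g V \<and>
     (\<forall>p. V p \<noteq> (\<lambda>_. 0)) \<and> (\<forall>p. g p (V p) (V p) = 0)"

definition orth ::
    "('m, 'e::euclidean_space) chart set \<Rightarrow> ('m, 'e) metric \<Rightarrow> ('m \<Rightarrow> ('m, 'e) tvec) \<Rightarrow>
      'm \<Rightarrow> ('m, 'e) tvec set" where
  "orth A g V p = {\<xi> \<in> tangent_space A p. g p (V p) \<xi> = 0}"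


section \<open>Codimension one foliations\<close>

text \<open>A chart onto an open box is foliated for the distribution \<open>D\<close> if \<open>D\<close> is tangent to the
  slices on which the coordinate in direction \<open>b\<close> is constant. These slices are the plaques;
  they are connected because the image is a box.\<close>

definition foliated_chart ::
    "('m, 'e::euclidean_space) chart set \<Rightarrow> ('m \<Rightarrow> ('m, 'e) tvec set) \<Rightarrow>
      ('m, 'e) chart \<Rightarrow> 'e \<Rightarrow> bool" where
  "foliated_chart A D c b \<longleftrightarrow> c \<in> A \<and> b \<in> Basis \<and> (\<exists>l r. cimage c = box l r) \<and>
     (\<forall>p\<in>cdom c. D p = {\<xi> \<in> tangent_space A p. \<xi> c \<bullet> b = 0})"

text \<open>Integrability means that \<open>D\<close> is the tangent distribution of a foliation, the latter being
  given by a foliated atlas.\<close>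

definition integrable_distribution ::
    "('m, 'e::euclidean_space) chart set \<Rightarrow> ('m \<Rightarrow> ('m, 'e) tvec set) \<Rightarrow> bool" where
  "integrable_distribution A D \<longleftrightarrow> (\<forall>p. \<exists>c b. foliated_chart A D c b \<and> p \<in> cdom c)"

definition same_plaque ::
    "('m, 'e::euclidean_space) chart set \<Rightarrow> ('m \<Rightarrow> ('m, 'e) tvec set) \<Rightarrow> 'm \<Rightarrow> 'm \<Rightarrow> bool" where
  "same_plaque A D p q \<longleftrightarrow> (\<exists>c b. foliated_chart A D c b \<and> p \<in> cdom c \<and> q \<in> cdom c \<and>
     cmap c p \<bullet> b = cmap c q \<bullet> b)"

text \<open>The leaf through \<open>p\<close> consists of the points reachable from \<open>p\<close> by a finite chain of
  plaques.\<close>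

definition leaf ::
    "('m, 'e::euclidean_space) chart set \<Rightarrow> ('m \<Rightarrow> ('m, 'e) tvec set) \<Rightarrow> 'm \<Rightarrow> 'm set" where
  "leaf A D p = {q. (same_plaque A D)\<^sup>*\<^sup>* p q}"


section \<open>Geodesics\<close>

text \<open>The vector \<open>\<Gamma>(u,v)\<close> with components \<open>\<Gamma>\<^sup>k\<^sub>i\<^sub>j u\<^sup>i v\<^sup>j\<close>, where the \<open>\<Gamma>\<^sup>k\<^sub>i\<^sub>j\<close> are the Christoffel
  symbols of the Levi-Civita connection. It exists uniquely since the metric is nondegenerate.\<close>

definition christoffel ::
    "('m, 'e::euclidean_space) chart set \<Rightarrow> ('m, 'e) metric \<Rightarrow> ('m, 'e) chart \<Rightarrow>
      'e \<Rightarrow> 'e \<Rightarrow> 'e \<Rightarrow> 'e" where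
  "christoffel A g c x u v = (THE z. \<forall>w. metric_coord A g c x z w =
     (frechet_derivative (\<lambda>y. metric_coord A g c y v w) (at x) u
      + frechet_derivative (\<lambda>y. metric_coord A g c y u w) (at x) v
      - frechet_derivative (\<lambda>y. metric_coord A g c y u v) (at x) w) / 2)"

text \<open>Geodesics are affinely parametrized and defined on a nonempty open interval; constant curves
  are included. Outside \<open>I\<close> the values of \<open>\<gamma>\<close> carry no meaning.\<close>

definition geodesic ::
    "('m::topological_space, 'e::euclidean_space) chart set \<Rightarrow> ('m, 'e) metric \<Rightarrow>
      (real \<Rightarrow> 'm) \<Rightarrow> real set \<Rightarrow> bool" where
  "geodesic A g \<gamma> I \<longleftrightarrow> open I \<and> is_interval I \<and> I \<noteq> {} \<and> continuous_on I \<gamma> \<and>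
     (\<forall>c\<in>A. \<forall>t\<in>I. \<gamma> t \<in> cdom c \<longrightarrow>
        (cmap c \<circ> \<gamma>) differentiable (at t) \<and>
        ((\<lambda>s. vector_derivative (cmap c \<circ> \<gamma>) (at s)) has_vector_derivative
           - christoffel A g c (cmap c (\<gamma> t)) (velocity A \<gamma> t c) (velocity A \<gamma> t c)) (at t))"

definition geodesic_extension ::
    "('m::topological_space, 'e::euclidean_space) chart set \<Rightarrow> ('m, 'e) metric \<Rightarrow>
      (real \<Rightarrow> 'm) \<Rightarrow> real set \<Rightarrow> (real \<Rightarrow> 'm) \<Rightarrow> real set \<Rightarrow> bool" where
  "geodesic_extension A g \<gamma> I \<sigma> J \<longleftrightarrow> geodesic A g \<sigma> J \<and> I \<subseteq> J \<and> (\<forall>t\<in>I. \<sigma> t = \<gamma> t)"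

definition maximal_extension ::
    "('m::topological_space, 'e::euclidean_space) chart set \<Rightarrow> ('m, 'e) metric \<Rightarrow>
      (real \<Rightarrow> 'm) \<Rightarrow> real set \<Rightarrow> (real \<Rightarrow> 'm) \<Rightarrow> real set \<Rightarrow> bool" where
  "maximal_extension A g \<gamma> I \<sigma> J \<longleftrightarrow> geodesic_extension A g \<gamma> I \<sigma> J \<and>
     (\<forall>\<tau> K. geodesic_extension A g \<sigma> J \<tau> K \<longrightarrow> K = J)"

definition complete_geodesic ::
    "('m::topological_space, 'e::euclidean_space) chart set \<Rightarrow> ('m, 'e) metric \<Rightarrow>
      (real \<Rightarrow> 'm) \<Rightarrow> real set \<Rightarrow> bool" where
  "complete_geodesic A g \<gamma> I \<longleftrightarrow> (\<exists>\<sigma>. maximal_extension A g \<gamma> I \<sigma> UNIV)"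

text \<open>The tangent space at \<open>p\<close> of the leaf through \<open>p\<close> is \<open>D p\<close>.\<close>

definition totally_geodesic ::
    "('m::topological_space, 'e::euclidean_space) chart set \<Rightarrow> ('m, 'e) metric \<Rightarrow>
      ('m \<Rightarrow> ('m, 'e) tvec set) \<Rightarrow> bool" where
  "totally_geodesic A g D \<longleftrightarrow>
     (\<forall>\<gamma> I. \<forall>t0\<in>I. geodesic A g \<gamma> I \<and> velocity A \<gamma> t0 \<in> D (\<gamma> t0) \<longrightarrow>
        (\<exists>\<epsilon>>0. \<forall>t\<in>I. \<bar>t - t0\<bar> < \<epsilon> \<longrightarrow> \<gamma> t \<in> leaf A D (\<gamma> t0)))"

end

theory Submission
  imports Defs
begin

text \<open>Let \<open>\<gamma>\<close> be a geodesic with velocity \<open>v\<close>. Since \<open>V\<close> is a Killing field, \<open>g(V, v)\<close> is constant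
  along \<open>\<gamma>\<close> (Clairaut, \<open>geodesic_conserved\<close>). So a geodesic that is tangent to \<open>V\<^sup>\<bottom>\<close> at one instant is
  tangent to it forever, and in a foliated chart the transverse coordinate of such a geodesic has
  derivative zero: it stays in its plaque, and the foliation is totally geodesic.

  For completeness, the point is that the velocity cannot blow up in finite time. On \<open>V\<^sup>\<bottom>\<close> the metric is
  positive semidefinite with kernel spanned by \<open>V\<close>. Choose a covector \<open>l\<close> with \<open>l(V) > 0\<close> on a small
  coordinate ball and write \<open>v = a V + y\<close> with \<open>l(y) = 0\<close>. The energy \<open>g(v, v) = g(y, y)\<close> is constant,
  which bounds \<open>y\<close> (\<open>transverse_bound\<close>), so only the coefficient \<open>a\<close> matters. The geodesic equation
  makes \<open>a'\<close> a quadratic polynomial in \<open>a\<close>; its leading coefficient is \<open>- l(\<nabla>\<^sub>V V) / l(V)\<close>. As \<open>V\<close> is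
  Killing of constant length, \<open>\<nabla>\<^sub>V V = 0\<close>, and therefore \<open>\<bar>a'\<bar> \<le> C (1 + \<bar>a\<bar>)\<close>
  (\<open>coefficient_growth\<close>).

  This estimate has to be made global, because a fast geodesic changes the coordinate ball arbitrarily
  often. By compactness finitely many balls suffice, and on an overlap two of the coefficients differ by
  a bounded amount, since their difference only sees the bounded vector \<open>y\<close>. Averaging the local
  coefficients with differentiable cut-off functions as weights gives one function \<open>m\<close> on the whole
  domain of \<open>\<gamma>\<close>; the derivatives of the weights enter only multiplied by the bounded differences
  \<open>a - m\<close>, so again \<open>\<bar>m'\<bar> \<le> C (1 + \<bar>m\<bar>)\<close> (\<open>weighted_mean_growth\<close>). Hence \<open>m\<close>, and with it the velocity, is
  bounded on bounded intervals (\<open>velocity_bound\<close>).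

  Finally, suppose that a maximal geodesic ends at a finite time \<open>b\<close>. The manifold is compact, so the
  geodesic accumulates somewhere; having bounded velocity it converges there, and its velocity
  converges because the acceleration is bounded. Solving the geodesic equation from these limits and
  joining the two pieces extends the geodesic beyond \<open>b\<close>, a contradiction. That the joined curve
  satisfies the geodesic equation in all charts rests on the transformation law of the Christoffel
  symbols (\<open>christoffel_transform\<close>).\<close>

section \<open>Families of linear maps\<close>

lemma linear_expand:
  fixes L :: "'e::euclidean_space \<Rightarrow> 'b::real_vector"
  assumes "linear L"
  shows "L u = (\<Sum>j\<in>Basis. (u \<bullet> j) *\<^sub>R L j)"
proof -
  have "L u = L (\<Sum>j\<in>Basis. (u \<bullet> j) *\<^sub>R j)"
    by (simp add: euclidean_representation)
  then show ?thesis
    by (simp add: linear_sum[OF assms] linear_scale[OF assms])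
qed

lemma bilinear_linear_left: "bilinear B \<Longrightarrow> linear (\<lambda>u. B u w)"
  and bilinear_linear_right: "bilinear B \<Longrightarrow> linear (B u)"
  by (auto simp: bilinear_def)

text \<open>Smoothness of a metric or of a Jacobian is given for fixed arguments only. Expanding the moving
  argument in a basis reduces the joint derivative to these partial ones.\<close>

lemma linear_family_has_derivative:
  fixes M :: "'a::real_normed_vector \<Rightarrow> 'e::euclidean_space \<Rightarrow> 'b::real_normed_vector"
  assumes "open Z" "z0 \<in> Z" and lin: "\<And>z. z \<in> Z \<Longrightarrow> linear (M z)"
    and M': "\<And>j. j \<in> Basis \<Longrightarrow> ((\<lambda>z. M z j) has_derivative M' j) (at z0)"
    and w: "(w has_derivative w') (at z0)"
  shows "((\<lambda>z. M z (w z)) has_derivative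
    (\<lambda>h. (\<Sum>j\<in>Basis. (w z0 \<bullet> j) *\<^sub>R M' j h) + M z0 (w' h))) (at z0)"
proof -
  have "((\<lambda>z. \<Sum>j\<in>Basis. (w z \<bullet> j) *\<^sub>R M z j) has_derivative
      (\<lambda>h. \<Sum>j\<in>Basis. (w z0 \<bullet> j) *\<^sub>R M' j h + (w' h \<bullet> j) *\<^sub>R M z0 j)) (at z0)"
    by (intro has_derivative_sum has_derivative_scaleR has_derivative_inner_left w M')
  moreover have "(\<Sum>j\<in>Basis. (w z0 \<bullet> j) *\<^sub>R M' j h + (w' h \<bullet> j) *\<^sub>R M z0 j)
      = (\<Sum>j\<in>Basis. (w z0 \<bullet> j) *\<^sub>R M' j h) + M z0 (w' h)" for h
    by (simp add: sum.distrib linear_expand[OF lin[OF \<open>z0 \<in> Z\<close>], of "w' h"])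
  ultimately have "((\<lambda>z. \<Sum>j\<in>Basis. (w z \<bullet> j) *\<^sub>R M z j) has_derivative
      (\<lambda>h. (\<Sum>j\<in>Basis. (w z0 \<bullet> j) *\<^sub>R M' j h) + M z0 (w' h))) (at z0)"
    by simp
  then show ?thesis
    by (rule has_derivative_transform_within_open[OF _ assms(1,2)])
      (simp add: linear_expand[OF lin, symmetric])
qed

lemma linear_family_continuous_on:
  fixes L :: "'a::topological_space \<Rightarrow> 'e::euclidean_space \<Rightarrow> 'b::real_normed_vector"
  assumes lin: "\<And>s. s \<in> S \<Longrightarrow> linear (L s)"
    and "\<And>j. j \<in> Basis \<Longrightarrow> continuous_on S (\<lambda>s. L s j)" and "continuous_on S u"
  shows "continuous_on S (\<lambda>s. L s (u s))"
proof -
  have "continuous_on S (\<lambda>s. \<Sum>j\<in>Basis. (u s \<bullet> j) *\<^sub>R L s j)"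
    by (intro continuous_intros assms)
  then show ?thesis
    by (rule continuous_on_eq) (simp add: linear_expand[OF lin, symmetric])
qed

lemma bilinear_family_continuous_on:
  fixes B :: "'a::topological_space \<Rightarrow> 'e::euclidean_space \<Rightarrow> 'f::euclidean_space \<Rightarrow> 'b::real_normed_vector"
  assumes bil: "\<And>s. s \<in> S \<Longrightarrow> bilinear (B s)"
    and "\<And>i j. i \<in> Basis \<Longrightarrow> j \<in> Basis \<Longrightarrow> continuous_on S (\<lambda>s. B s i j)"
    and "continuous_on S u" "continuous_on S w"
  shows "continuous_on S (\<lambda>s. B s (u s) (w s))"
  by (rule linear_family_continuous_on[where L="\<lambda>s. B s (u s)"],
      rule bilinear_linear_right, erule bil,
      rule linear_family_continuous_on[where L="\<lambda>s u. B s u _"],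
      rule bilinear_linear_left, erule bil) (use assms in auto)

text \<open>Compactness bounds the finitely many values on basis vectors, and linearity does the rest; so
  all coordinate tensors have uniformly bounded operator norms over compact sets.\<close>

lemma linear_family_bound:
  fixes L :: "'a::topological_space \<Rightarrow> 'e::euclidean_space \<Rightarrow> 'b::real_normed_vector"
  assumes "compact K" and lin: "\<And>x. x \<in> K \<Longrightarrow> linear (L x)"
    and cont: "\<And>j. j \<in> Basis \<Longrightarrow> continuous_on K (\<lambda>x. L x j)"
  shows "\<exists>C\<ge>0. \<forall>x\<in>K. \<forall>u. norm (L x u) \<le> C * norm u"
proof -
  have "\<exists>c\<ge>0. \<forall>x\<in>K. norm (L x j) \<le> c" if "j \<in> Basis" for j
  proof -
    have "bounded ((\<lambda>x. L x j) ` K)"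
      by (intro compact_imp_bounded compact_continuous_image cont that \<open>compact K\<close>)
    then obtain c where "\<forall>x\<in>K. norm (L x j) \<le> c"
      by (auto simp: bounded_iff)
    then show ?thesis
      by (intro exI[of _ "max c 0"]) (auto simp: le_max_iff_disj)
  qed
  then obtain c where c: "\<And>j. j \<in> Basis \<Longrightarrow> c j \<ge> 0"
      "\<And>j x. j \<in> Basis \<Longrightarrow> x \<in> K \<Longrightarrow> norm (L x j) \<le> c j"
    by metis
  show ?thesis
  proof (intro exI[of _ "\<Sum>j\<in>Basis. c j"] conjI ballI allI)
    show "(\<Sum>j\<in>Basis. c j) \<ge> 0"
      by (intro sum_nonneg c)
    fix x u assume x: "x \<in> K"
    have "norm (L x u) = norm (\<Sum>j\<in>Basis. (u \<bullet> j) *\<^sub>R L x j)"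
      by (simp add: linear_expand[OF lin[OF x], symmetric])
    also have "\<dots> \<le> (\<Sum>j\<in>Basis. \<bar>u \<bullet> j\<bar> * norm (L x j))"
      by (rule order_trans[OF norm_sum]) simp
    also have "\<dots> \<le> (\<Sum>j\<in>Basis. norm u * c j)"
      by (intro sum_mono mult_mono) (use c x Basis_le_norm in auto)
    finally show "norm (L x u) \<le> (\<Sum>j\<in>Basis. c j) * norm u"
      by (simp add: sum_distrib_left[symmetric] mult.commute)
  qed
qed

lemma bilinear_family_bound:
  fixes B :: "'a::topological_space \<Rightarrow> 'e::euclidean_space \<Rightarrow> 'f::euclidean_space \<Rightarrow> 'b::real_normed_vector"
  assumes "compact K" and bil: "\<And>x. x \<in> K \<Longrightarrow> bilinear (B x)"
    and cont: "\<And>i j. i \<in> Basis \<Longrightarrow> j \<in> Basis \<Longrightarrow> continuous_on K (\<lambda>x. B x i j)"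
  shows "\<exists>C\<ge>0. \<forall>x\<in>K. \<forall>u w. norm (B x u w) \<le> C * norm u * norm w"
proof -
  have "\<exists>c\<ge>0. \<forall>x\<in>K. \<forall>u. norm (B x u j) \<le> c * norm u" if "j \<in> Basis" for j
    by (rule linear_family_bound[OF \<open>compact K\<close>])
      (use bil cont that in \<open>auto intro: bilinear_linear_left\<close>)
  then obtain c where c: "\<And>j. j \<in> Basis \<Longrightarrow> c j \<ge> 0"
      "\<And>j x u. j \<in> Basis \<Longrightarrow> x \<in> K \<Longrightarrow> norm (B x u j) \<le> c j * norm u"
    by metis
  show ?thesis
  proof (intro exI[of _ "\<Sum>j\<in>Basis. c j"] conjI ballI allI)
    show "(\<Sum>j\<in>Basis. c j) \<ge> 0"
      by (intro sum_nonneg c)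
    fix x u w assume x: "x \<in> K"
    have "norm (B x u w) = norm (\<Sum>j\<in>Basis. (w \<bullet> j) *\<^sub>R B x u j)"
      by (simp add: linear_expand[OF bilinear_linear_right[OF bil[OF x]], symmetric])
    also have "\<dots> \<le> (\<Sum>j\<in>Basis. \<bar>w \<bullet> j\<bar> * norm (B x u j))"
      by (rule order_trans[OF norm_sum]) simp
    also have "\<dots> \<le> (\<Sum>j\<in>Basis. norm w * (c j * norm u))"
      by (intro sum_mono mult_mono) (use c x Basis_le_norm in auto)
    finally show "norm (B x u w) \<le> (\<Sum>j\<in>Basis. c j) * norm u * norm w"
      by (simp add: sum_distrib_left[symmetric] sum_distrib_right[symmetric] mult_ac)
  qed
qed

section \<open>Smooth maps\<close>

lemma smooth_on_continuous: "smooth_on S f \<Longrightarrow> continuous_on S f"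
  unfolding smooth_on_def by (metis Ck_on.simps(1))

lemma smooth_on_differentiable: "smooth_on S f \<Longrightarrow> x \<in> S \<Longrightarrow> f differentiable (at x)"
  unfolding smooth_on_def by (metis Ck_on.simps(2))

lemma smooth_on_has_derivative:
  "smooth_on S f \<Longrightarrow> x \<in> S \<Longrightarrow> (f has_derivative frechet_derivative f (at x)) (at x)"
  using smooth_on_differentiable frechet_derivative_works by blast

lemma smooth_on_deriv: "smooth_on S f \<Longrightarrow> smooth_on S (\<lambda>x. frechet_derivative f (at x) v)"
  unfolding smooth_on_def using Ck_on.simps(2) by metis

lemma smooth_on_deriv_continuous:
  "smooth_on S f \<Longrightarrow> continuous_on S (\<lambda>x. frechet_derivative f (at x) v)"
  by (intro smooth_on_continuous smooth_on_deriv)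

lemma smooth_on_deriv_linear:
  "smooth_on S f \<Longrightarrow> x \<in> S \<Longrightarrow> linear (frechet_derivative f (at x))"
  by (intro linear_frechet_derivative smooth_on_differentiable)

lemma has_vector_derivative_compose:
  assumes "(f has_derivative f') (at (x t))" "(x has_vector_derivative x') (at t)"
  shows "((\<lambda>s. f (x s)) has_vector_derivative f' x') (at t)"
proof -
  have "((\<lambda>s. f (x s)) has_derivative (\<lambda>h. f' (h *\<^sub>R x'))) (at t)"
    using has_derivative_compose[OF assms(2)[unfolded has_vector_derivative_def] assms(1)] .
  moreover have "f' (h *\<^sub>R x') = h *\<^sub>R f' x'" for h
    using linear_scale[OF has_derivative_linear[OF assms(1)]] .
  ultimately show ?thesis
    by (simp add: has_vector_derivative_def)
qed

lemma linear_family_deriv_linear: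
  fixes L :: "'a::euclidean_space \<Rightarrow> 'e::real_vector \<Rightarrow> 'b::real_normed_vector"
  assumes "open U" "x \<in> U" and lin: "\<And>y. y \<in> U \<Longrightarrow> linear (L y)"
    and sm: "\<And>u. smooth_on U (\<lambda>y. L y u)"
  shows "linear (\<lambda>u. frechet_derivative (\<lambda>y. L y u) (at x) v)"
proof (rule linearI)
  fix a b
  have "((\<lambda>y. L y a + L y b) has_derivative (\<lambda>v. frechet_derivative (\<lambda>y. L y a) (at x) v
      + frechet_derivative (\<lambda>y. L y b) (at x) v)) (at x)"
    by (intro has_derivative_add smooth_on_has_derivative[OF sm] assms)
  then have "((\<lambda>y. L y (a + b)) has_derivative (\<lambda>v. frechet_derivative (\<lambda>y. L y a) (at x) v
      + frechet_derivative (\<lambda>y. L y b) (at x) v)) (at x)"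
    by (rule has_derivative_transform_within_open[OF _ assms(1,2)]) (simp add: linear_add[OF lin])
  from fun_cong[OF frechet_derivative_at[OF this], of v]
  show "frechet_derivative (\<lambda>y. L y (a + b)) (at x) v =
      frechet_derivative (\<lambda>y. L y a) (at x) v + frechet_derivative (\<lambda>y. L y b) (at x) v"
    by (rule sym)
next
  fix r a
  have "((\<lambda>y. r *\<^sub>R L y a) has_derivative (\<lambda>v. r *\<^sub>R frechet_derivative (\<lambda>y. L y a) (at x) v)) (at x)"
    by (intro has_derivative_scaleR_right smooth_on_has_derivative[OF sm] assms)
  then have "((\<lambda>y. L y (r *\<^sub>R a)) has_derivative (\<lambda>v. r *\<^sub>R frechet_derivative (\<lambda>y. L y a) (at x) v)) (at x)"
    by (rule has_derivative_transform_within_open[OF _ assms(1,2)]) (simp add: linear_scale[OF lin])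
  from fun_cong[OF frechet_derivative_at[OF this], of v]
  show "frechet_derivative (\<lambda>y. L y (r *\<^sub>R a)) (at x) v =
      r *\<^sub>R frechet_derivative (\<lambda>y. L y a) (at x) v"
    by (rule sym)
qed

lemma linear_family_vector_derivative:
  fixes L :: "'a::euclidean_space \<Rightarrow> 'e::euclidean_space \<Rightarrow> 'b::real_normed_vector"
  assumes "open U" "x t \<in> U" and lin: "\<And>y. y \<in> U \<Longrightarrow> linear (L y)"
    and sm: "\<And>u. smooth_on U (\<lambda>y. L y u)"
    and x: "(x has_vector_derivative x') (at t)" and u: "(u has_vector_derivative u') (at t)"
  shows "((\<lambda>s. L (x s) (u s)) has_vector_derivative
    frechet_derivative (\<lambda>y. L y (u t)) (at (x t)) x' + L (x t) u') (at t)"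
proof -
  have lin': "linear (\<lambda>u. frechet_derivative (\<lambda>y. L y u) (at (x t)) x')"
    by (rule linear_family_deriv_linear[OF assms(1,2) lin sm])
  have "isCont x t"
    using x has_vector_derivative_continuous by blast
  then obtain Z where Z: "open Z" "t \<in> Z" "\<And>z. z \<in> Z \<Longrightarrow> x z \<in> U"
    using assms(1,2) unfolding continuous_at_open by metis
  have M': "((\<lambda>s. L (x s) j) has_derivative
      (\<lambda>h. h *\<^sub>R frechet_derivative (\<lambda>y. L y j) (at (x t)) x')) (at t)" for j
    using has_vector_derivative_compose[OF smooth_on_has_derivative[OF sm assms(2)] x]
    unfolding has_vector_derivative_def .
  have "((\<lambda>s. L (x s) (u s)) has_derivative (\<lambda>h. (\<Sum>j\<in>Basis. (u t \<bullet> j) *\<^sub>R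
      (h *\<^sub>R frechet_derivative (\<lambda>y. L y j) (at (x t)) x')) + L (x t) (h *\<^sub>R u'))) (at t)"
    by (rule linear_family_has_derivative[OF Z(1,2)])
      (use Z lin M' u in \<open>auto simp: has_vector_derivative_def\<close>)
  moreover have "(\<Sum>j\<in>Basis. (u t \<bullet> j) *\<^sub>R (h *\<^sub>R frechet_derivative (\<lambda>y. L y j) (at (x t)) x'))
      + L (x t) (h *\<^sub>R u') = h *\<^sub>R (frechet_derivative (\<lambda>y. L y (u t)) (at (x t)) x' + L (x t) u')" for h
  proof -
    have "(\<Sum>j\<in>Basis. (u t \<bullet> j) *\<^sub>R (h *\<^sub>R frechet_derivative (\<lambda>y. L y j) (at (x t)) x'))
      = h *\<^sub>R (\<Sum>j\<in>Basis. (u t \<bullet> j) *\<^sub>R frechet_derivative (\<lambda>y. L y j) (at (x t)) x')"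
      unfolding scaleR_sum_right by (intro sum.cong refl scaleR_left_commute)
    also have "\<dots> = h *\<^sub>R frechet_derivative (\<lambda>y. L y (u t)) (at (x t)) x'"
      using linear_expand[OF lin', of "u t"] by metis
    finally show ?thesis
      using linear_scale[OF lin[OF assms(2)]] by (simp only: scaleR_add_right)
  qed
  ultimately show ?thesis
    by (simp add: has_vector_derivative_def)
qed

section \<open>Lorentzian forms\<close>

text \<open>The map that sends coordinates to combinations of the orthonormal frame is injective, because pairing
  with the frame recovers the coordinates up to sign. Computations with Lorentzian forms thus become
  computations with the Euclidean inner product corrected in the timelike direction \<open>b0\<close>.\<close>

lemma lorentzian_form_standard:
  fixes B :: "'e::euclidean_space \<Rightarrow> 'e \<Rightarrow> real"
  assumes "lorentzian_form B"
  obtains T :: "'e \<Rightarrow> 'e" and b0 where "linear T" "surj T" "b0 \<in> Basis"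
    "\<And>u w. B (T u) (T w) = u \<bullet> w - 2 * (u \<bullet> b0) * (w \<bullet> b0)"
proof -
  obtain e :: "'e \<Rightarrow> 'e" and b0 where bil: "bilinear B" and b0: "b0 \<in> Basis"
    and e: "\<And>i j. i \<in> Basis \<Longrightarrow> j \<in> Basis \<Longrightarrow> B (e i) (e j) = (if i \<noteq> j then 0 else if i = b0 then -1 else 1)"
    using assms unfolding lorentzian_form_def by blast
  define T :: "'e \<Rightarrow> 'e" where "T u = (\<Sum>i\<in>Basis. (u \<bullet> i) *\<^sub>R e i)" for u
  have lin: "linear T"
    unfolding T_def by (rule linearI) (simp_all add: inner_add_left scaleR_add_left sum.distrib scaleR_sum_right)
  have Bej: "B (T u) (e j) = (u \<bullet> j) * (if j = b0 then -1 else 1)" if "j \<in> Basis" for u j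
  proof -
    have "B (T u) (e j) = (\<Sum>i\<in>Basis. (u \<bullet> i) * B (e i) (e j))"
      unfolding T_def by (simp add: linear_sum[OF bilinear_linear_left[OF bil]] linear_scale[OF bilinear_linear_left[OF bil]])
    also have "\<dots> = (\<Sum>i\<in>Basis. if i = j then (u \<bullet> j) * (if j = b0 then -1 else 1) else 0)"
      by (intro sum.cong) (auto simp: e that)
    finally show ?thesis using that by simp
  qed
  have BT: "B (T u) (T w) = u \<bullet> w - 2 * (u \<bullet> b0) * (w \<bullet> b0)" for u w
  proof -
    have "B (T u) (T w) = (\<Sum>j\<in>Basis. (w \<bullet> j) * B (T u) (e j))"
      unfolding T_def[of w] by (simp add: linear_sum[OF bilinear_linear_right[OF bil]] linear_scale[OF bilinear_linear_right[OF bil]])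
    also have "\<dots> = (\<Sum>j\<in>Basis. (u \<bullet> j) * (w \<bullet> j) - (if j = b0 then 2 * (u \<bullet> b0) * (w \<bullet> b0) else 0))"
      by (intro sum.cong) (auto simp: Bej)
    finally show ?thesis
      using b0 by (simp add: sum_subtractf euclidean_inner[symmetric])
  qed
  have "inj T"
  proof (rule linear_injective_0[THEN iffD2, OF lin, rule_format])
    fix u assume "T u = 0"
    then have "u \<bullet> j = 0" if "j \<in> Basis" for j
      using Bej[OF that, of u] linear_0[OF bilinear_linear_left[OF bil]] by (auto split: if_splits)
    then show "u = 0" by (simp add: euclidean_eq_iff[of u])
  qed
  then show thesis
    using that[OF lin _ b0 BT] linear_injective_imp_surjective[OF lin] by blast
qed

lemma lorentzian_form_nondegenerate:
  fixes B :: "'e::euclidean_space \<Rightarrow> 'e \<Rightarrow> real"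
  assumes "lorentzian_form B" and "\<And>w. B z w = 0"
  shows "z = 0"
proof -
  obtain T :: "'e \<Rightarrow> 'e" and b0 where T: "linear T" "surj T" "b0 \<in> Basis"
    "\<And>u w. B (T u) (T w) = u \<bullet> w - 2 * (u \<bullet> b0) * (w \<bullet> b0)"
    by (rule lorentzian_form_standard[OF assms(1)]) blast
  obtain u where u: "z = T u" using T(2) by blast
  have "u \<bullet> j = 0" if "j \<in> Basis" for j
    using assms(2)[of "T j"] assms(2)[of "T b0"] that T(3,4) unfolding u
    by (auto simp: inner_Basis split: if_splits)
  then have "u = 0" by (simp add: euclidean_eq_iff[of u])
  then show ?thesis using u linear_0[OF T(1)] by simp
qed

text \<open>By nondegeneracy the map \<open>z \<mapsto> B z\<close> into the dual space is injective, hence bijective for dimension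
  reasons. This gives meaning to the definite description by which Christoffel vectors are
  defined.\<close>

lemma lorentzian_form_represents:
  fixes B :: "'e::euclidean_space \<Rightarrow> 'e \<Rightarrow> real"
  assumes "lorentzian_form B" and f: "linear f"
  shows "\<exists>!z. \<forall>w. B z w = f w"
proof -
  have bil: "bilinear B" using assms(1) by (simp add: lorentzian_form_def)
  define T where "T z = (\<Sum>j\<in>Basis. B z j *\<^sub>R j)" for z
  have Tj: "T z \<bullet> j = B z j" if "j \<in> Basis" for z j
    unfolding T_def using that by simp
  have lin: "linear T"
    unfolding T_def by (rule linearI)
      (simp_all add: linear_add[OF bilinear_linear_left[OF bil]] linear_scale[OF bilinear_linear_left[OF bil]]
        scaleR_add_left sum.distrib scaleR_sum_right)
  have ext: "(\<forall>w. B z w = h w) \<longleftrightarrow> (\<forall>j\<in>Basis. B z j = h j)" if "linear h" for z h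
    by (metis (mono_tags, lifting) bil bilinear_linear_right that linear_expand sum.cong)
  have "inj T"
  proof (rule linear_injective_0[THEN iffD2, OF lin, rule_format])
    fix z assume "T z = 0"
    then have "\<forall>w. B z w = 0"
      using Tj[of _ z] ext[of "\<lambda>_. 0" z] by (simp add: linear_iff)
    then show "z = 0" using lorentzian_form_nondegenerate[OF assms(1)] by blast
  qed
  then obtain z where "T z = (\<Sum>j\<in>Basis. f j *\<^sub>R j)"
    using linear_injective_imp_surjective[OF lin] by (metis surj_def)
  then have "\<forall>w. B z w = f w"
    unfolding ext[OF f] using Tj[of _ z] by (metis inner_sum_left_Basis)
  moreover have "z' = z''" if "\<forall>w. B z' w = f w" "\<forall>w. B z'' w = f w" for z' z''
  proof -
    have "B (z' - z'') w = 0" for w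
      using that linear_diff[OF bilinear_linear_left[OF bil]] by simp
    then show ?thesis using lorentzian_form_nondegenerate[OF assms(1)] by (metis eq_iff_diff_eq_0)
  qed
  ultimately show ?thesis by metis
qed

text \<open>A null vector \<open>w\<close> has a nonzero timelike coordinate, so a multiple of \<open>w\<close> can be subtracted from \<open>v\<close> to
  make its timelike coordinate vanish. This changes neither \<open>B v v\<close> nor \<open>B w v\<close>, and on vectors without
  timelike coordinate the form is the Euclidean one. In other words, \<open>B\<close> is positive on
  \<open>w\<^sup>\<bottom> / w\<close>.\<close>

lemma lorentzian_form_null_orthogonal:
  fixes B :: "'e::euclidean_space \<Rightarrow> 'e \<Rightarrow> real"
  assumes "lorentzian_form B" and "w \<noteq> 0" "B w w = 0" "B w v = 0" "B v v \<le> 0"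
  shows "\<exists>k. v = k *\<^sub>R w"
proof -
  obtain T :: "'e \<Rightarrow> 'e" and b0 where T: "linear T" "surj T" "b0 \<in> Basis"
    "\<And>u w. B (T u) (T w) = u \<bullet> w - 2 * (u \<bullet> b0) * (w \<bullet> b0)"
    by (rule lorentzian_form_standard[OF assms(1)]) blast
  obtain u y where u: "w = T u" and y: "v = T y" using T(2) by blast
  have "u \<noteq> 0" using assms(2) u linear_0[OF T(1)] by auto
  then have u0: "u \<bullet> b0 \<noteq> 0"
    using assms(3) unfolding u T(4) by auto
  define k where "k = (y \<bullet> b0) / (u \<bullet> b0)"
  define z where "z = y - k *\<^sub>R u"
  have z0: "z \<bullet> b0 = 0"
    using u0 by (simp add: z_def k_def inner_diff_left)
  have "z \<bullet> z = z \<bullet> z - 2 * (z \<bullet> b0) * (z \<bullet> b0)" by (simp add: z0)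
  also have "\<dots> = (y \<bullet> y - 2 * (y \<bullet> b0) * (y \<bullet> b0)) - 2 * k * (u \<bullet> y - 2 * (u \<bullet> b0) * (y \<bullet> b0))
     + k * k * (u \<bullet> u - 2 * (u \<bullet> b0) * (u \<bullet> b0))"
    unfolding z_def by (simp add: inner_diff_left inner_diff_right inner_commute algebra_simps)
  also have "\<dots> \<le> 0"
    using assms(3-5) unfolding u y T(4) by simp
  finally have "z = 0" by (metis inner_gt_zero_iff not_less)
  then have "v = k *\<^sub>R w"
    unfolding u y z_def by (simp add: linear_scale[OF T(1)])
  then show ?thesis by blast
qed

section \<open>The Levi-Civita connection in coordinates\<close>

text \<open>The Christoffel vector of a family of forms on an open set, detached from manifolds and charts
  so that the local estimates can be proved in Euclidean space.\<close>

definition levi_civita :: "('e::euclidean_space \<Rightarrow> 'e \<Rightarrow> 'e \<Rightarrow> real) \<Rightarrow> 'e \<Rightarrow> 'e \<Rightarrow> 'e \<Rightarrow> 'e" where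
  "levi_civita G x u v = (THE z. \<forall>w. G x z w =
     (frechet_derivative (\<lambda>y. G y v w) (at x) u + frechet_derivative (\<lambda>y. G y u w) (at x) v
      - frechet_derivative (\<lambda>y. G y u v) (at x) w) / 2)"

lemma christoffel_eq_levi_civita: "christoffel A g c = levi_civita (metric_coord A g c)"
  by (intro ext) (simp add: christoffel_def levi_civita_def)

locale lorentzian_patch =
  fixes U :: "'e::euclidean_space set" and G :: "'e \<Rightarrow> 'e \<Rightarrow> 'e \<Rightarrow> real"
  assumes open_U: "open U"
    and form: "x \<in> U \<Longrightarrow> lorentzian_form (G x)"
    and smooth: "smooth_on U (\<lambda>x. G x u w)"
begin

abbreviation dG :: "'e \<Rightarrow> 'e \<Rightarrow> 'e \<Rightarrow> 'e \<Rightarrow> real" where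
  "dG x v u w \<equiv> frechet_derivative (\<lambda>y. G y u w) (at x) v"

abbreviation \<Gamma> :: "'e \<Rightarrow> 'e \<Rightarrow> 'e \<Rightarrow> 'e" where "\<Gamma> \<equiv> levi_civita G"

lemma bilinear_G: "x \<in> U \<Longrightarrow> bilinear (G x)"
  and sym_G: "x \<in> U \<Longrightarrow> G x u w = G x w u"
  using form unfolding lorentzian_form_def by blast+

lemmas linear_G1 = bilinear_linear_left[OF bilinear_G]
lemmas linear_G2 = bilinear_linear_right[OF bilinear_G]

lemma linear_dG: "x \<in> U \<Longrightarrow> linear (\<lambda>v. dG x v u w)"
  by (rule smooth_on_deriv_linear[OF smooth])

lemma linear_dG1: "x \<in> U \<Longrightarrow> linear (\<lambda>u. dG x v u w)"
  by (rule linear_family_deriv_linear[OF open_U _ linear_G1 smooth])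

lemma linear_dG2: "x \<in> U \<Longrightarrow> linear (\<lambda>w. dG x v u w)"
  by (rule linear_family_deriv_linear[OF open_U _ linear_G2 smooth])

lemma sym_dG: assumes "x \<in> U" shows "dG x v u w = dG x v w u"
proof -
  have "((\<lambda>y. G y w u) has_derivative frechet_derivative (\<lambda>y. G y u w) (at x)) (at x)"
    by (rule has_derivative_transform_within_open[OF smooth_on_has_derivative[OF smooth assms] open_U assms])
      (rule sym_G)
  from frechet_derivative_at[OF this] show ?thesis by simp
qed

lemma linear_koszul: 
  assumes "x \<in> U" shows "linear (\<lambda>w. (dG x u v w + dG x v u w - dG x w u v) / 2)"
  using linear_dG2[OF assms, of u v] linear_dG2[OF assms, of v u] linear_dG[OF assms, of u v]
  by (simp add: linear_iff) (simp add: field_simps)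

lemma levi_civita_koszul:
  assumes "x \<in> U"
  shows "G x (\<Gamma> x u v) w = (dG x u v w + dG x v u w - dG x w u v) / 2"
  using theI'[OF lorentzian_form_represents[OF form[OF assms] linear_koszul[OF assms, of v u]]]
  unfolding levi_civita_def by blast

lemma G_cancel:
  assumes "x \<in> U" and "\<And>w. G x y w = G x z w" shows "y = z"
proof -
  have "G x (y - z) w = 0" for w
    using assms(2)[of w] linear_diff[OF linear_G1[OF assms(1)]] by simp
  then show ?thesis
    using lorentzian_form_nondegenerate[OF form[OF assms(1)]] by (metis eq_iff_diff_eq_0)
qed

lemma sym_levi_civita: "x \<in> U \<Longrightarrow> \<Gamma> x u v = \<Gamma> x v u"
  by (rule G_cancel) (auto simp: levi_civita_koszul sym_dG[of x u v])

lemma linear_levi_civita: 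
  assumes "x \<in> U" shows "linear (\<Gamma> x u)"
proof (rule linearI; rule G_cancel[OF assms])
  fix a b w
  show "G x (\<Gamma> x u (a + b)) w = G x (\<Gamma> x u a + \<Gamma> x u b) w"
    by (simp add: levi_civita_koszul[OF assms] linear_add[OF linear_G1[OF assms]]
        linear_add[OF linear_dG[OF assms]] linear_add[OF linear_dG1[OF assms]] linear_add[OF linear_dG2[OF assms]])
      (simp add: field_simps)
next
  fix r a w
  show "G x (\<Gamma> x u (r *\<^sub>R a)) w = G x (r *\<^sub>R \<Gamma> x u a) w"
    by (simp add: levi_civita_koszul[OF assms] linear_scale[OF linear_G1[OF assms]]
        linear_scale[OF linear_dG[OF assms]] linear_scale[OF linear_dG1[OF assms]] linear_scale[OF linear_dG2[OF assms]])
      (simp add: algebra_simps)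
qed

lemma bilinear_levi_civita: "x \<in> U \<Longrightarrow> bilinear (\<Gamma> x)"
  unfolding bilinear_def using linear_levi_civita sym_levi_civita by simp

lemma metric_vector_derivative:
  assumes "x t \<in> U" and x: "(x has_vector_derivative x') (at t)"
    and u: "(u has_vector_derivative u') (at t)" and w: "(w has_vector_derivative w') (at t)"
  shows "((\<lambda>s. G (x s) (u s) (w s)) has_vector_derivative
    dG (x t) x' (u t) (w t) + G (x t) u' (w t) + G (x t) (u t) w') (at t)"
proof -
  have "isCont x t"
    using x has_vector_derivative_continuous by blast
  then obtain Z where Z: "open Z" "t \<in> Z" "\<And>z. z \<in> Z \<Longrightarrow> x z \<in> U"
    using assms(1) open_U unfolding continuous_at_open by metis
  define D where "D = (\<lambda>w. dG (x t) x' (u t) w + G (x t) u' w)"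
  have D: "linear D"
    unfolding D_def by (intro linear_compose_add linear_dG2 linear_G2 assms)
  have M': "((\<lambda>s. G (x s) (u s) j) has_derivative (\<lambda>h. h *\<^sub>R D j)) (at t)" for j
    using linear_family_vector_derivative[OF open_U assms(1) linear_G1 smooth x u]
    unfolding has_vector_derivative_def D_def .
  have "((\<lambda>s. G (x s) (u s) (w s)) has_derivative (\<lambda>h. (\<Sum>j\<in>Basis. (w t \<bullet> j) *\<^sub>R (h *\<^sub>R D j)) +
      G (x t) (u t) (h *\<^sub>R w'))) (at t)"
    by (rule linear_family_has_derivative[OF Z(1,2)])
      (use Z linear_G2 M' w in \<open>auto simp: has_vector_derivative_def\<close>)
  moreover have "(\<Sum>j\<in>Basis. (w t \<bullet> j) *\<^sub>R (h *\<^sub>R D j)) + G (x t) (u t) (h *\<^sub>R w') =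
      h *\<^sub>R (D (w t) + G (x t) (u t) w')" for h
  proof -
    have "(\<Sum>j\<in>Basis. (w t \<bullet> j) *\<^sub>R (h *\<^sub>R D j)) = h *\<^sub>R (\<Sum>j\<in>Basis. (w t \<bullet> j) *\<^sub>R D j)"
      unfolding scaleR_sum_right by (intro sum.cong refl scaleR_left_commute)
    also have "\<dots> = h *\<^sub>R D (w t)"
      using linear_expand[OF D, of "w t"] by metis
    finally show ?thesis
      using linear_scale[OF linear_G2[OF assms(1)]] by (simp only: scaleR_add_right)
  qed
  ultimately show ?thesis
    by (simp add: has_vector_derivative_def D_def)
qed

text \<open>By the Koszul formula each of the two acceleration terms contributes minus one half of the derivative
  of the metric along the velocity, so that the three terms of the product rule cancel.\<close>

lemma energy_derivative:
  assumes "x t \<in> U" "(x has_vector_derivative v t) (at t)"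
    "(v has_vector_derivative - \<Gamma> (x t) (v t) (v t)) (at t)"
  shows "((\<lambda>s. G (x s) (v s) (v s)) has_vector_derivative 0) (at t)"
proof -
  define a where "a = \<Gamma> (x t) (v t) (v t)"
  have 0: "G (x t) a (v t) = dG (x t) (v t) (v t) (v t) / 2"
    unfolding a_def levi_civita_koszul[OF assms(1)] by simp
  have 1: "G (x t) (- a) (v t) = - G (x t) a (v t)"
    by (rule linear_neg[OF linear_G1[OF assms(1)]])
  have 2: "G (x t) (v t) (- a) = G (x t) (- a) (v t)"
    by (rule sym_G[OF assms(1)])
  show ?thesis
    using metric_vector_derivative[OF assms(1,2,3,3)] unfolding a_def[symmetric] 2 1 0 by simp
qed

lemma continuous_on_metric:
  assumes "K \<subseteq> U" and "continuous_on (K \<times> S) u" "continuous_on (K \<times> S) w"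
  shows "continuous_on (K \<times> S) (\<lambda>p. G (fst p) (u p) (w p))"
proof (rule bilinear_family_continuous_on[OF _ _ assms(2,3)])
  show "continuous_on (K \<times> S) (\<lambda>p. G (fst p) i j)" for i j
    by (rule continuous_on_compose2[OF smooth_on_continuous[OF smooth]])
      (use assms(1) in \<open>auto intro!: continuous_intros\<close>)
qed (use assms(1) bilinear_G in auto)

text \<open>The sum on the right is continuous and positive on the compact product of \<open>K\<close> with the unit sphere.
  The bound transfers estimates from \<open>G x (\<Gamma> x u v) i\<close>, which consists of derivatives of the metric, to
  \<open>\<Gamma>\<close> itself.\<close>

lemma nondegeneracy_bound:
  assumes "compact K" "K \<subseteq> U"
  shows "\<exists>C\<ge>0. \<forall>x\<in>K. \<forall>z. norm z \<le> C * (\<Sum>i\<in>Basis. \<bar>G x z i\<bar>)"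
proof (cases "K = {}")
  case False
  define f where "f = (\<lambda>p. \<Sum>i\<in>Basis. \<bar>G (fst p) (snd p) i\<bar>)"
  have "continuous_on (K \<times> sphere 0 1) f"
    unfolding f_def by (intro continuous_intros continuous_on_metric assms)
  moreover have "compact (K \<times> sphere (0::'e) 1)" "K \<times> sphere (0::'e) 1 \<noteq> {}"
    using assms(1) False by (auto intro: compact_Times)
  ultimately obtain p where p: "p \<in> K \<times> sphere 0 1" and min: "\<And>q. q \<in> K \<times> sphere 0 1 \<Longrightarrow> f p \<le> f q"
    using continuous_attains_inf[of "K \<times> sphere 0 1" f] by blast
  have "f p \<noteq> 0"
  proof
    assume "f p = 0"
    then have "G (fst p) (snd p) i = 0" if "i \<in> Basis" for i
      unfolding f_def using that by (simp add: sum_nonneg_eq_0_iff)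
    moreover have "fst p \<in> U" using p assms(2) by auto
    ultimately have "G (fst p) (snd p) w = 0" for w
      using linear_expand[OF linear_G2, of "fst p" "snd p" w] by simp
    then have "snd p = 0"
      using lorentzian_form_nondegenerate[OF form[OF \<open>fst p \<in> U\<close>]] by blast
    then show False using p by auto
  qed
  then have pos: "f p > 0" unfolding f_def by (metis abs_ge_zero sum_nonneg less_eq_real_def)
  show ?thesis
  proof (intro exI[of _ "1 / f p"] conjI ballI allI)
    fix x z assume x: "x \<in> K"
    show "norm z \<le> 1 / f p * (\<Sum>i\<in>Basis. \<bar>G x z i\<bar>)"
    proof (cases "z = 0")
      case True
      then show ?thesis using pos by (simp add: sum_nonneg)
    next
      case False
      have "f p \<le> f (x, z /\<^sub>R norm z)"
        by (rule min) (use x False in auto)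
      also have "\<dots> = (\<Sum>i\<in>Basis. \<bar>G x z i\<bar>) / norm z"
        unfolding f_def using linear_scale[OF linear_G1, of x] x assms(2)
        by (auto simp: subset_iff abs_mult divide_inverse sum_distrib_left mult.commute)
      finally show ?thesis
        using pos False by (simp add: field_simps)
    qed
  qed (use pos in auto)
qed (auto intro: exI[of _ 0])

lemma continuous_on_koszul:
  "K \<subseteq> U \<Longrightarrow> continuous_on K (\<lambda>x. (dG x u v w + dG x v u w - dG x w u v) / 2)"
  by (intro continuous_intros continuous_on_subset[OF smooth_on_deriv_continuous[OF smooth]]) auto

lemma bilinear_koszul: "x \<in> U \<Longrightarrow> bilinear (\<lambda>u v. (dG x u v w + dG x v u w - dG x w u v) / 2)"
  unfolding bilinear_def
  using linear_dG1[of x] linear_dG2[of x] linear_dG[of x]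
  by (simp add: linear_iff field_simps)

lemma levi_civita_bound:
  assumes "compact K" "K \<subseteq> U"
  shows "\<exists>C\<ge>0. \<forall>x\<in>K. \<forall>u v. norm (\<Gamma> x u v) \<le> C * norm u * norm v"
proof -
  obtain C where C: "C \<ge> 0" "\<And>x z. x \<in> K \<Longrightarrow> norm z \<le> C * (\<Sum>i\<in>Basis. \<bar>G x z i\<bar>)"
    using nondegeneracy_bound[OF assms] by blast
  have "\<exists>c\<ge>0. \<forall>x\<in>K. \<forall>u v. norm (G x (\<Gamma> x u v) i) \<le> c * norm u * norm v" for i
  proof -
    have "\<exists>c\<ge>0. \<forall>x\<in>K. \<forall>u v. norm ((dG x u v i + dG x v u i - dG x i u v) / 2) \<le> c * norm u * norm v"
      by (rule bilinear_family_bound[OF assms(1) bilinear_koszul continuous_on_koszul[OF assms(2)]])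
        (use assms(2) in auto)
    then show ?thesis
      using levi_civita_koszul assms(2) by (metis subsetD)
  qed
  then obtain c where c: "\<And>i. c i \<ge> 0" "\<And>i x u v. x \<in> K \<Longrightarrow> \<bar>G x (\<Gamma> x u v) i\<bar> \<le> c i * norm u * norm v"
    by (metis real_norm_def)
  have "norm (\<Gamma> x u v) \<le> (C * (\<Sum>i\<in>Basis. c i)) * norm u * norm v" if "x \<in> K" for x u v
  proof -
    have "norm (\<Gamma> x u v) \<le> C * (\<Sum>i\<in>Basis. \<bar>G x (\<Gamma> x u v) i\<bar>)" by (rule C(2)[OF that])
    also have "\<dots> \<le> C * (\<Sum>i\<in>Basis. c i * norm u * norm v)"
      by (intro mult_left_mono sum_mono c(2) that C(1))
    finally show ?thesis by (simp add: sum_distrib_right[symmetric] mult.assoc)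
  qed
  then show ?thesis
    by (intro exI[of _ "C * (\<Sum>i\<in>Basis. c i)"]) (auto intro!: mult_nonneg_nonneg sum_nonneg C c)
qed

end

section \<open>Null Killing fields in coordinates\<close>

locale null_killing_patch = lorentzian_patch U G
  for U :: "'e::euclidean_space set" and G +
  fixes W :: "'e \<Rightarrow> 'e"
  assumes smooth_W: "smooth_on U W"
    and killing: "x \<in> U \<Longrightarrow> dG x (W x) u w + G x (frechet_derivative W (at x) u) w
      + G x u (frechet_derivative W (at x) w) = 0"
    and null: "x \<in> U \<Longrightarrow> G x (W x) (W x) = 0"
    and W_nonzero: "x \<in> U \<Longrightarrow> W x \<noteq> 0"
begin

abbreviation dW :: "'e \<Rightarrow> 'e \<Rightarrow> 'e" where "dW x \<equiv> frechet_derivative W (at x)"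

text \<open>Clairaut's first integral: the Christoffel term differs from the derivative of the metric by one half of
  its derivative along \<open>W\<close>, which Killing's equation turns into the term with the derivative of
  \<open>W\<close>.\<close>

lemma clairaut_derivative:
  assumes "x t \<in> U" "(x has_vector_derivative v t) (at t)"
    "(v has_vector_derivative - \<Gamma> (x t) (v t) (v t)) (at t)"
  shows "((\<lambda>s. G (x s) (W (x s)) (v s)) has_vector_derivative 0) (at t)"
proof -
  have W: "((\<lambda>s. W (x s)) has_vector_derivative dW (x t) (v t)) (at t)"
    by (rule has_vector_derivative_compose[OF smooth_on_has_derivative[OF smooth_W assms(1)] assms(2)])
  have "G (x t) (W (x t)) (\<Gamma> (x t) (v t) (v t)) =
      dG (x t) (v t) (v t) (W (x t)) - dG (x t) (W (x t)) (v t) (v t) / 2"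
    by (subst sym_G[OF assms(1)]) (simp add: levi_civita_koszul[OF assms(1)])
  moreover have "dG (x t) (W (x t)) (v t) (v t) = - 2 * G (x t) (dW (x t) (v t)) (v t)"
    using killing[OF assms(1), of "v t" "v t"] sym_G[OF assms(1), of "v t" "dW (x t) (v t)"] by simp
  ultimately show ?thesis
    using metric_vector_derivative[OF assms(1,2) W assms(3)]
      sym_dG[OF assms(1), of "W (x t)" "v t" "v t"]
    by (simp add: linear_neg[OF linear_G2[OF assms(1)]])
qed

text \<open>The equation \<open>\<nabla>\<^sub>W W = 0\<close>: Killing's equation turns \<open>g(\<nabla>\<^sub>W W, w)\<close> into minus one half of the derivative of
  \<open>g(W, W)\<close> in direction \<open>w\<close>, and this function vanishes identically.\<close>

lemma killing_autoparallel:
  assumes "x \<in> U" shows "dW x (W x) = - \<Gamma> x (W x) (W x)"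
proof (rule G_cancel[OF assms])
  fix w
  have "((\<lambda>s. x + s *\<^sub>R w) has_vector_derivative w) (at 0)"
    by (auto intro!: derivative_eq_intros simp: has_vector_derivative_def)
  note c = this
  have "((\<lambda>s. W (x + s *\<^sub>R w)) has_vector_derivative dW x w) (at 0)"
    using has_vector_derivative_compose[OF _ c, of W "dW x"] smooth_on_has_derivative[OF smooth_W assms] by simp
  from metric_vector_derivative[OF _ c this this] assms
  have d: "((\<lambda>s. G (x + s *\<^sub>R w) (W (x + s *\<^sub>R w)) (W (x + s *\<^sub>R w))) has_vector_derivative
      dG x w (W x) (W x) + G x (dW x w) (W x) + G x (W x) (dW x w)) (at 0)"
    by simp
  have "open ((\<lambda>s::real. x + s *\<^sub>R w) -` U)"
    by (intro continuous_open_vimage open_U continuous_intros)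
  moreover have "0 \<in> (\<lambda>s::real. x + s *\<^sub>R w) -` U" using assms by simp
  ultimately have "((\<lambda>_. 0) has_vector_derivative
      dG x w (W x) (W x) + G x (dW x w) (W x) + G x (W x) (dW x w)) (at 0)"
    by (rule has_vector_derivative_transform_within_open[OF d]) (simp add: null)
  then have "dG x w (W x) (W x) + G x (dW x w) (W x) + G x (W x) (dW x w) = 0"
    using vector_derivative_unique_at has_vector_derivative_const by metis
  then have "dG x w (W x) (W x) = - 2 * G x (W x) (dW x w)"
    using sym_G[OF assms, of "dW x w" "W x"] by simp
  then show "G x (dW x (W x)) w = G x (- \<Gamma> x (W x) (W x)) w"
    using killing[OF assms, of "W x" w]
    by (simp add: linear_neg[OF linear_G1[OF assms]] levi_civita_koszul[OF assms]) (simp add: field_simps)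
qed

text \<open>On \<open>W\<^sup>\<bottom>\<close> the metric is semidefinite with kernel \<open>W\<close>. The hyperplane \<open>l \<bullet> y = 0\<close> is transverse to the kernel, so
  the metric is definite on the intersection, uniformly over \<open>K\<close> by compactness.\<close>

lemma transverse_bound:
  assumes "compact K" "K \<subseteq> U" and l: "\<forall>x\<in>K. l \<bullet> W x > 0"
  shows "\<exists>C\<ge>0. \<forall>x\<in>K. \<forall>y. l \<bullet> y = 0 \<longrightarrow> G x (W x) y = 0 \<longrightarrow> norm y ^ 2 \<le> C * G x y y"
proof -
  define S where "S = {p \<in> K \<times> sphere 0 1. l \<bullet> snd p = 0} \<inter> {p \<in> K \<times> sphere 0 1. G (fst p) (W (fst p)) (snd p) = 0}"
  have K: "compact (K \<times> sphere (0::'e) 1)"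
    using assms(1) by (auto intro: compact_Times)
  have W: "continuous_on (K \<times> sphere 0 1) (\<lambda>p::'e\<times>'e. W (fst p))"
    by (rule continuous_on_compose2[OF smooth_on_continuous[OF smooth_W]])
      (use assms(2) in \<open>auto intro!: continuous_intros\<close>)
  have "closed {p \<in> K \<times> sphere (0::'e) 1. l \<bullet> snd p = 0}"
    "closed {p \<in> K \<times> sphere (0::'e) 1. G (fst p) (W (fst p)) (snd p) = 0}"
    by (intro continuous_closed_preimage_constant compact_imp_closed[OF K] continuous_on_metric
        assms(2) W continuous_intros)+
  then have "closed S"
    unfolding S_def by (rule closed_Int)
  moreover have "S = (K \<times> sphere 0 1) \<inter> S"
    unfolding S_def by auto
  ultimately have "compact S"
    using compact_Int_closed[OF K, of S] by simp
  show ?thesis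
  proof (cases "S = {}")
    case True
    have "y = 0" if "x \<in> K" "l \<bullet> y = 0" "G x (W x) y = 0" for x y
    proof (rule ccontr)
      assume "y \<noteq> 0"
      then have "(x, y /\<^sub>R norm y) \<in> S"
        unfolding S_def using that assms(2) linear_scale[OF linear_G2[of x]] by auto
      then show False using True by blast
    qed
    then show ?thesis using bilinear_G bilinear_lzero assms(2) by (intro exI[of _ 0]) fastforce
  next
    case False
    have "continuous_on S (\<lambda>p. G (fst p) (snd p) (snd p))"
      by (rule continuous_on_subset[OF continuous_on_metric[OF assms(2) continuous_on_snd continuous_on_snd]])
        (auto simp: S_def)
    then obtain p where p: "p \<in> S" and min: "\<And>q. q \<in> S \<Longrightarrow> G (fst p) (snd p) (snd p) \<le> G (fst q) (snd q) (snd q)"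
      using continuous_attains_inf[OF \<open>compact S\<close> False] by blast
    define m where "m = G (fst p) (snd p) (snd p)"
    have "m > 0"
    proof (rule ccontr)
      assume "\<not> m > 0"
      moreover have "fst p \<in> U" using p assms(2) unfolding S_def by auto
      ultimately obtain k where k: "snd p = k *\<^sub>R W (fst p)"
        using lorentzian_form_null_orthogonal[OF form W_nonzero null, of "fst p" "snd p"] p
        unfolding S_def m_def by (auto simp: not_less)
      then have "k * (l \<bullet> W (fst p)) = 0" using p unfolding S_def by auto
      moreover have "l \<bullet> W (fst p) > 0" using p l unfolding S_def by auto
      ultimately have "snd p = 0" using k by auto
      then show False using p unfolding S_def by auto
    qed
    show ?thesis
    proof (intro exI[of _ "1 / m"] conjI ballI allI impI)
      fix x y assume x: "x \<in> K" and y: "l \<bullet> y = 0" "G x (W x) y = 0"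
      have xU: "x \<in> U" using x assms(2) by auto
      show "norm y ^ 2 \<le> 1 / m * G x y y"
      proof (cases "y = 0")
        case True
        then show ?thesis by (simp add: linear_0[OF linear_G1[OF xU]])
      next
        case False
        have "m \<le> G x (y /\<^sub>R norm y) (y /\<^sub>R norm y)"
          using min[of "(x, y /\<^sub>R norm y)"] x y False linear_scale[OF linear_G2[OF xU]]
          unfolding m_def S_def by auto
        also have "\<dots> = G x y y / norm y ^ 2"
          using linear_scale[OF linear_G2[OF xU]] linear_scale[OF linear_G1[OF xU]]
          by (simp add: power2_eq_square divide_inverse)
        finally show ?thesis
          using \<open>m > 0\<close> False by (simp add: field_simps)
      qed
    qed (use \<open>m > 0\<close> in auto)
  qed
qed

text \<open>Decompose the velocity as \<open>v = a W + y\<close> with \<open>l \<bullet> y = 0\<close>. The component \<open>y\<close> is bounded in terms of the energy \<open>E\<close>.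
  In the derivative of \<open>a = l \<bullet> v / (l \<bullet> W)\<close> the terms quadratic in \<open>a\<close> are \<open>l \<bullet> \<Gamma> W W\<close> from the
  numerator and \<open>l \<bullet> dW W\<close> from the denominator; they cancel since \<open>W\<close> is autoparallel. What remains
  is linear in \<open>a\<close>.\<close>

lemma coefficient_growth:
  assumes "compact K" "K \<subseteq> U" and l: "\<forall>x\<in>K. l \<bullet> W x > 0"
  shows "\<exists>C\<ge>0. \<forall>x v t. x t \<in> K \<longrightarrow> (x has_vector_derivative v t) (at t) \<longrightarrow>
      (v has_vector_derivative - \<Gamma> (x t) (v t) (v t)) (at t) \<longrightarrow>
      G (x t) (W (x t)) (v t) = 0 \<longrightarrow> G (x t) (v t) (v t) = E \<longrightarrow>
      norm (v t - (l \<bullet> v t / (l \<bullet> W (x t))) *\<^sub>R W (x t)) \<le> C \<and>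
      norm (v t) \<le> C * (1 + \<bar>l \<bullet> v t / (l \<bullet> W (x t))\<bar>) \<and>
      (\<exists>d. ((\<lambda>s. l \<bullet> v s / (l \<bullet> W (x s))) has_real_derivative d) (at t) \<and>
        \<bar>d\<bar> \<le> C * (1 + \<bar>l \<bullet> v t / (l \<bullet> W (x t))\<bar>))"
proof -
  obtain Cy where Cy: "Cy \<ge> 0" "\<And>x y. x \<in> K \<Longrightarrow> l \<bullet> y = 0 \<Longrightarrow> G x (W x) y = 0 \<Longrightarrow> norm y ^ 2 \<le> Cy * G x y y"
    using transverse_bound[OF assms] by blast
  obtain Cg where Cg: "Cg \<ge> 0" "\<And>x u v. x \<in> K \<Longrightarrow> norm (\<Gamma> x u v) \<le> Cg * norm u * norm v"
    using levi_civita_bound[OF assms(1,2)] by blast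
  have "\<exists>C\<ge>0. \<forall>x\<in>K. \<forall>u. norm (dW x u) \<le> C * norm u"
    by (rule linear_family_bound[OF assms(1)])
      (use smooth_W assms(2) in \<open>auto intro: smooth_on_deriv_linear continuous_on_subset[OF smooth_on_deriv_continuous]\<close>)
  then obtain Cd where Cd: "Cd \<ge> 0" "\<And>x u. x \<in> K \<Longrightarrow> norm (dW x u) \<le> Cd * norm u"
    by blast
  have contW: "continuous_on K W"
    using smooth_on_continuous[OF smooth_W] assms(2) continuous_on_subset by blast
  then have "bounded (W ` K)"
    by (intro compact_imp_bounded compact_continuous_image assms(1))
  then obtain Cw where Cw: "Cw > 0" "\<And>x. x \<in> K \<Longrightarrow> norm (W x) \<le> Cw"
    by (auto simp: bounded_pos)
  have "\<exists>q>0. \<forall>x\<in>K. q \<le> l \<bullet> W x"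
  proof (cases "K = {}")
    case False
    have "continuous_on K (\<lambda>x. l \<bullet> W x)" by (intro continuous_intros contW)
    from continuous_attains_inf[OF assms(1) False this] l show ?thesis by blast
  qed (auto intro: exI[of _ 1])
  then obtain q where q: "q > 0" "\<And>x. x \<in> K \<Longrightarrow> q \<le> l \<bullet> W x" by blast
  define Y where "Y = sqrt (Cy * \<bar>E\<bar>)"
  have Y0: "Y \<ge> 0" using Cy(1) by (simp add: Y_def)
  define D where "D = norm l * (2 * Cg * Cw * Y + Cg * Y * Y + Cd * Y) / q"
  have D0: "D \<ge> 0" unfolding D_def using Cg(1) Cd(1) Cw(1) Y0 q(1) by simp
  define C where "C = D + Y + Cw"
  show ?thesis
  proof (rule exI[of _ C], rule conjI, goal_cases)
    case 1
    show "C \<ge> 0" unfolding C_def using D0 Y0 Cw(1) by simp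
  next
    case 2
    show ?case
    proof (intro allI impI)
      fix x :: "real \<Rightarrow> 'e" and v :: "real \<Rightarrow> 'e" and t
      assume xK: "x t \<in> K" and x: "(x has_vector_derivative v t) (at t)"
        and v: "(v has_vector_derivative - \<Gamma> (x t) (v t) (v t)) (at t)"
        and tang: "G (x t) (W (x t)) (v t) = 0" and en: "G (x t) (v t) (v t) = E"
      define a where "a = l \<bullet> v t / (l \<bullet> W (x t))"
      define w where "w = W (x t)"
      define y where "y = v t - a *\<^sub>R w"
      have xU: "x t \<in> U" using xK assms(2) by auto
      have lw: "q \<le> l \<bullet> w" unfolding w_def by (rule q(2)[OF xK])
      have vt: "v t = a *\<^sub>R w + y" by (simp add: y_def)
      have ly: "l \<bullet> y = 0" using lw q(1) unfolding y_def a_def w_def by (simp add: inner_diff_right)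
      have gww: "G (x t) w w = 0" unfolding w_def by (rule null[OF xU])
      have gwy: "G (x t) w y = 0"
        using tang gww unfolding y_def w_def
        by (simp add: linear_diff[OF linear_G2[OF xU]] linear_scale[OF linear_G2[OF xU]])
      have "G (x t) y y = E"
        using en gww gwy sym_G[OF xU, of y w] unfolding vt
        by (simp add: linear_add[OF linear_G2[OF xU]] linear_scale[OF linear_G2[OF xU]]
            linear_add[OF linear_G1[OF xU]] linear_scale[OF linear_G1[OF xU]])
      then have "norm y ^ 2 \<le> Cy * E"
        using Cy(2)[OF xK ly] gwy by (simp add: w_def)
      also have "\<dots> \<le> Cy * \<bar>E\<bar>" using Cy(1) by (simp add: mult_left_mono)
      finally have ny: "norm y \<le> Y" unfolding Y_def by (rule real_le_rsqrt)
      have nw: "norm w \<le> Cw" unfolding w_def by (rule Cw(2)[OF xK])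
      have "norm (v t) \<le> \<bar>a\<bar> * norm w + norm y"
        unfolding vt by (rule order_trans[OF norm_triangle_ineq]) simp
      also have "\<dots> \<le> \<bar>a\<bar> * Cw + Y" by (intro add_mono mult_left_mono nw ny) auto
      also have "\<dots> \<le> C * (1 + \<bar>a\<bar>)"
      proof -
        have "0 \<le> (D + Y) * \<bar>a\<bar>" "0 \<le> D + Cw" using D0 Y0 Cw(1) by simp_all
        then show ?thesis unfolding C_def by (simp add: algebra_simps)
      qed
      finally have nv: "norm (v t) \<le> C * (1 + \<bar>a\<bar>)" .
      have P: "((\<lambda>s. l \<bullet> v s) has_real_derivative - (l \<bullet> \<Gamma> (x t) (v t) (v t))) (at t)"
        using has_vector_derivative_compose[OF bounded_linear.has_derivative[OF bounded_linear_inner_right has_derivative_ident] v, of l]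
        by (simp add: has_real_derivative_iff_has_vector_derivative)
      have "((\<lambda>s. W (x s)) has_vector_derivative dW (x t) (v t)) (at t)"
        by (rule has_vector_derivative_compose[OF smooth_on_has_derivative[OF smooth_W xU] x])
      from has_vector_derivative_compose[OF bounded_linear.has_derivative[OF bounded_linear_inner_right has_derivative_ident] this, of l]
      have Q: "((\<lambda>s. l \<bullet> W (x s)) has_real_derivative l \<bullet> dW (x t) (v t)) (at t)"
        by (simp add: has_real_derivative_iff_has_vector_derivative)
      define d where "d = (- (l \<bullet> \<Gamma> (x t) (v t) (v t)) * (l \<bullet> w) - (l \<bullet> v t) * (l \<bullet> dW (x t) (v t))) / ((l \<bullet> w) * (l \<bullet> w))"
      have der: "((\<lambda>s. l \<bullet> v s / (l \<bullet> W (x s))) has_real_derivative d) (at t)"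
        using DERIV_divide[OF P Q] lw q(1) unfolding d_def w_def by simp
      have lG: "l \<bullet> \<Gamma> (x t) (v t) (v t) = a * a * (l \<bullet> \<Gamma> (x t) w w) + 2 * a * (l \<bullet> \<Gamma> (x t) w y) + l \<bullet> \<Gamma> (x t) y y"
        unfolding vt using sym_levi_civita[OF xU, of y w]
        by (simp add: bilinear_ladd[OF bilinear_levi_civita[OF xU]] bilinear_radd[OF bilinear_levi_civita[OF xU]]
            bilinear_lmul[OF bilinear_levi_civita[OF xU]] bilinear_rmul[OF bilinear_levi_civita[OF xU]]
            inner_add_right algebra_simps)
      have lin_dW: "linear (dW (x t))" by (rule smooth_on_deriv_linear[OF smooth_W xU])
      have lW: "l \<bullet> dW (x t) (v t) = - a * (l \<bullet> \<Gamma> (x t) w w) + l \<bullet> dW (x t) y"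
        unfolding vt using killing_autoparallel[OF xU]
        by (simp add: linear_add[OF lin_dW] linear_scale[OF lin_dW] inner_add_right inner_diff_right w_def)
      have lv: "l \<bullet> v t = a * (l \<bullet> w)" unfolding vt by (simp add: inner_add_right ly)
      \<comment> \<open>the terms with \<open>\<Gamma> w w\<close> of \<open>lG\<close> and \<open>lW\<close> have disappeared\<close>
      have "d = (- 2 * a * (l \<bullet> \<Gamma> (x t) w y) - l \<bullet> \<Gamma> (x t) y y - a * (l \<bullet> dW (x t) y)) / (l \<bullet> w)"
        unfolding d_def lv lG lW using lw q(1) by (simp add: divide_simps) (simp add: algebra_simps)
      then have "\<bar>d\<bar> = \<bar>- 2 * a * (l \<bullet> \<Gamma> (x t) w y) - l \<bullet> \<Gamma> (x t) y y - a * (l \<bullet> dW (x t) y)\<bar> / (l \<bullet> w)"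
        using lw q(1) by simp
      also have "\<dots> \<le> (norm l * (2 * Cg * Cw * Y + Cg * Y * Y + Cd * Y) * (1 + \<bar>a\<bar>)) / q"
      proof (rule frac_le[OF _ _ q(1) lw])
        have "\<bar>l \<bullet> \<Gamma> (x t) w y\<bar> \<le> norm l * (Cg * Cw * Y)"
          by (rule order_trans[OF Cauchy_Schwarz_ineq2]) (intro mult_left_mono order_trans[OF Cg(2)[OF xK]] mult_mono nw ny,
            use Cg(1) Cw(1) in auto)
        then have 1: "\<bar>a\<bar> * \<bar>l \<bullet> \<Gamma> (x t) w y\<bar> \<le> \<bar>a\<bar> * (norm l * (Cg * Cw * Y))"
          by (rule mult_left_mono) simp
        have 2: "\<bar>l \<bullet> \<Gamma> (x t) y y\<bar> \<le> norm l * (Cg * Y * Y)"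
          by (rule order_trans[OF Cauchy_Schwarz_ineq2]) (intro mult_left_mono order_trans[OF Cg(2)[OF xK]] mult_mono ny,
            use Cg(1) Y0 in auto)
        have "\<bar>l \<bullet> dW (x t) y\<bar> \<le> norm l * (Cd * Y)"
          by (rule order_trans[OF Cauchy_Schwarz_ineq2]) (intro mult_left_mono order_trans[OF Cd(2)[OF xK]] ny,
            use Cd(1) in auto)
        then have 3: "\<bar>a\<bar> * \<bar>l \<bullet> dW (x t) y\<bar> \<le> \<bar>a\<bar> * (norm l * (Cd * Y))"
          by (rule mult_left_mono) simp
        have "\<bar>- 2 * a * (l \<bullet> \<Gamma> (x t) w y) - l \<bullet> \<Gamma> (x t) y y - a * (l \<bullet> dW (x t) y)\<bar>
           \<le> 2 * (\<bar>a\<bar> * \<bar>l \<bullet> \<Gamma> (x t) w y\<bar>) + \<bar>l \<bullet> \<Gamma> (x t) y y\<bar> + \<bar>a\<bar> * \<bar>l \<bullet> dW (x t) y\<bar>"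
          unfolding abs_mult[symmetric] by linarith
        also have "\<dots> \<le> 2 * (\<bar>a\<bar> * (norm l * (Cg * Cw * Y))) + norm l * (Cg * Y * Y) + \<bar>a\<bar> * (norm l * (Cd * Y))"
          using 1 2 3 by linarith
        also have "\<dots> \<le> norm l * (2 * Cg * Cw * Y + Cg * Y * Y + Cd * Y) * (1 + \<bar>a\<bar>)"
        proof -
          have "0 \<le> norm l * (2 * Cg * Cw * Y + Cd * Y)" "0 \<le> norm l * (Cg * Y * Y) * \<bar>a\<bar>"
            using Cg(1) Cw(1) Cd(1) Y0 by simp_all
          then show ?thesis by (simp add: algebra_simps)
        qed
        finally show "\<bar>- 2 * a * (l \<bullet> \<Gamma> (x t) w y) - l \<bullet> \<Gamma> (x t) y y - a * (l \<bullet> dW (x t) y)\<bar>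
           \<le> norm l * (2 * Cg * Cw * Y + Cg * Y * Y + Cd * Y) * (1 + \<bar>a\<bar>)" .
        show "0 \<le> norm l * (2 * Cg * Cw * Y + Cg * Y * Y + Cd * Y) * (1 + \<bar>a\<bar>)"
          using Cg(1) Cw(1) Cd(1) Y0 by simp
      qed
      also have "\<dots> = D * (1 + \<bar>a\<bar>)" by (simp add: D_def)
      also have "\<dots> \<le> C * (1 + \<bar>a\<bar>)" unfolding C_def using Y0 Cw(1) by (intro mult_right_mono) auto
      finally have "\<bar>d\<bar> \<le> C * (1 + \<bar>a\<bar>)" .
      moreover have "norm y \<le> C" using ny D0 Cw(1) unfolding C_def by simp
      ultimately show "norm (v t - (l \<bullet> v t / (l \<bullet> W (x t))) *\<^sub>R W (x t)) \<le> C \<and>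
        norm (v t) \<le> C * (1 + \<bar>l \<bullet> v t / (l \<bullet> W (x t))\<bar>) \<and>
        (\<exists>d. ((\<lambda>s. l \<bullet> v s / (l \<bullet> W (x s))) has_real_derivative d) (at t) \<and>
          \<bar>d\<bar> \<le> C * (1 + \<bar>l \<bullet> v t / (l \<bullet> W (x t))\<bar>))"
        using der nv unfolding y_def a_def w_def by blast
    qed
  qed
qed

end

section \<open>Ordinary differential equations and mean value estimates\<close>

text \<open>Local existence by the contraction principle for the integral operator on bounded continuous
  functions with values in the ball.\<close>

lemma picard_forward:
  fixes F :: "'a::euclidean_space \<Rightarrow> 'a"
  assumes "r > 0" and lip: "L-lipschitz_on (cball y0 r) F"
  obtains \<delta> y where "\<delta> > 0" "y b = y0" "\<And>t. t \<in> {b..b+\<delta>} \<Longrightarrow> y t \<in> cball y0 r"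
    "\<And>t. t \<in> {b..b+\<delta>} \<Longrightarrow> (y has_vector_derivative F (y t)) (at t within {b..b+\<delta>})"
proof -
  have L: "L \<ge> 0" by (rule lipschitz_on_nonneg[OF lip])
  define M where "M = norm (F y0) + L * r + 1"
  have M: "M > 0" unfolding M_def using L \<open>r > 0\<close> by (simp add: add_nonneg_pos)
  have FM: "norm (F z) \<le> M" if "z \<in> cball y0 r" for z
  proof -
    have "norm (F z) \<le> norm (F y0) + norm (F z - F y0)" by (rule norm_triangle_sub)
    also have "norm (F z - F y0) \<le> L * norm (z - y0)"
      using lipschitz_on_normD[OF lip that, of y0] \<open>r > 0\<close> by simp
    also have "\<dots> \<le> L * r"
      using that L by (intro mult_left_mono) (auto simp: dist_norm norm_minus_commute)
    finally show ?thesis unfolding M_def by simp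
  qed
  \<comment> \<open>the first bound keeps the solution in the ball, the second makes the operator a contraction with factor \<open>1/2\<close>\<close>
  define \<delta> where "\<delta> = min (r / M) (1 / (2 * (L + 1)))"
  have \<delta>: "\<delta> > 0" unfolding \<delta>_def using M L \<open>r > 0\<close> by simp
  have \<delta>r: "M * \<delta> \<le> r"
  proof -
    have "M * \<delta> \<le> M * (r / M)" unfolding \<delta>_def using M by (intro mult_left_mono) auto
    then show ?thesis using M by simp
  qed
  have \<delta>L: "L * \<delta> \<le> 1 / 2"
  proof -
    have "L * \<delta> \<le> (L + 1) * (1 / (2 * (L + 1)))" unfolding \<delta>_def by (intro mult_mono) (use L M \<open>r > 0\<close> in auto)
    also have "\<dots> = 1 / 2" using L by (simp add: field_simps)
    finally show ?thesis .
  qed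
  \<comment> \<open>clamping time lets all functions live on the whole real line\<close>
  define \<kappa> where "\<kappa> t = max b (min (b + \<delta>) t)" for t
  have \<kappa>: "\<kappa> t \<in> {b..b+\<delta>}" for t unfolding \<kappa>_def using \<delta> by auto
  have \<kappa>id: "\<kappa> t = t" if "t \<in> {b..b+\<delta>}" for t using that unfolding \<kappa>_def by auto
  have \<kappa>c: "continuous_on UNIV \<kappa>" unfolding \<kappa>_def by (intro continuous_intros)
  define X where "X = PiC (UNIV::real set) (\<lambda>_. cball y0 r)"
  have X: "f \<in> X \<longleftrightarrow> (\<forall>t. apply_bcontfun f t \<in> cball y0 r)" for f
    unfolding X_def mem_PiC_iff by auto
  define \<Phi> where "\<Phi> f t = y0 + integral {b..\<kappa> t} (\<lambda>s. F (apply_bcontfun f s))" for f t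
  have cont: "continuous_on S (\<lambda>s. F (apply_bcontfun f s))" if "f \<in> X" for f S
    by (rule continuous_on_compose2[OF lipschitz_on_continuous_on[OF lip]]) (use that X in auto)
  have \<Phi>ball: "\<Phi> f t \<in> cball y0 r" if "f \<in> X" for f t
  proof -
    have "norm (integral {b..\<kappa> t} (\<lambda>s. F (apply_bcontfun f s))) \<le> M * (\<kappa> t - b)"
      by (rule integral_bound) (use \<kappa>[of t] cont that X FM in auto)
    also have "\<dots> \<le> M * \<delta>" using \<kappa>[of t] M by (intro mult_left_mono) auto
    finally show ?thesis using \<delta>r unfolding \<Phi>_def by (simp add: dist_norm)
  qed
  have \<Phi>cont: "\<Phi> f \<in> bcontfun" if "f \<in> X" for f
  proof -
    have "continuous_on UNIV (\<lambda>t. integral {b..\<kappa> t} (\<lambda>s. F (apply_bcontfun f s)))"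
      by (rule continuous_on_compose2[OF indefinite_integral_continuous_1[OF integrable_continuous_real[OF cont[OF that, of "{b..b+\<delta>}"]]] \<kappa>c])
        (use \<kappa> in auto)
    then have "continuous_on UNIV (\<Phi> f)"
      unfolding \<Phi>_def by (intro continuous_intros)
    moreover have "bounded (range (\<Phi> f))"
      using \<Phi>ball[OF that] by (intro bounded_subset[OF bounded_cball]) auto
    ultimately show ?thesis by (simp add: bcontfun_def)
  qed
  define T where "T f = Bcontfun (\<Phi> f)" for f
  have T: "apply_bcontfun (T f) = \<Phi> f" if "f \<in> X" for f
    unfolding T_def by (rule Bcontfun_inverse[OF \<Phi>cont[OF that]])
  have "\<exists>!f\<in>X. T f = f"
  proof (rule Banach_fix[where c="1/2"])
    show "complete X"
      unfolding X_def complete_eq_closed by (intro closed_PiC closed_cball)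
    have "const_bcontfun y0 \<in> X"
      unfolding X using \<open>r > 0\<close> by (simp add: const_bcontfun.rep_eq)
    then show "X \<noteq> {}" by blast
    show "T ` X \<subseteq> X"
    proof
      fix h assume "h \<in> T ` X"
      then obtain f where f: "f \<in> X" "h = T f" by blast
      show "h \<in> X" unfolding X f(2) T[OF f(1)] using \<Phi>ball[OF f(1)] by blast
    qed
    fix f g assume f: "f \<in> X" and g: "g \<in> X"
    show "dist (T f) (T g) \<le> 1 / 2 * dist f g"
    proof (rule dist_bound)
      fix t
      have "\<Phi> f t - \<Phi> g t = integral {b..\<kappa> t} (\<lambda>s. F (apply_bcontfun f s) - F (apply_bcontfun g s))"
        unfolding \<Phi>_def
        by (simp add: integral_diff[OF integrable_continuous_real[OF cont[OF f]] integrable_continuous_real[OF cont[OF g]]])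
      moreover have "norm (integral {b..\<kappa> t} (\<lambda>s. F (apply_bcontfun f s) - F (apply_bcontfun g s))) \<le> (L * dist f g) * (\<kappa> t - b)"
      proof (rule integral_bound)
        fix s
        have "norm (F (apply_bcontfun f s) - F (apply_bcontfun g s)) \<le> L * norm (apply_bcontfun f s - apply_bcontfun g s)"
          by (rule lipschitz_on_normD[OF lip]) (use f g X in auto)
        also have "\<dots> \<le> L * dist f g"
          using dist_bounded[of f s g] L by (intro mult_left_mono) (auto simp: dist_norm)
        finally show "norm (F (apply_bcontfun f s) - F (apply_bcontfun g s)) \<le> L * dist f g" .
      qed (use \<kappa>[of t] in \<open>auto intro!: continuous_intros cont f g\<close>)
      moreover have "(L * dist f g) * (\<kappa> t - b) \<le> (L * dist f g) * \<delta>"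
        using \<kappa>[of t] L by (intro mult_left_mono) auto
      moreover have "(L * dist f g) * \<delta> \<le> 1 / 2 * dist f g"
        using mult_right_mono[OF \<delta>L zero_le_dist[of f g]] by (simp add: mult_ac)
      ultimately show "dist (apply_bcontfun (T f) t) (apply_bcontfun (T g) t) \<le> 1 / 2 * dist f g"
        unfolding T[OF f] T[OF g] dist_norm by (simp add: dist_norm)
    qed
  qed auto
  then obtain f where f: "f \<in> X" "T f = f" by blast
  have eq: "apply_bcontfun f t = y0 + integral {b..t} (\<lambda>s. F (apply_bcontfun f s))" if "t \<in> {b..b+\<delta>}" for t
    using T[OF f(1)] f(2) \<kappa>id[OF that] unfolding \<Phi>_def by metis
  have der: "(apply_bcontfun f has_vector_derivative F (apply_bcontfun f t)) (at t within {b..b+\<delta>})"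
    if t: "t \<in> {b..b+\<delta>}" for t
  proof -
    have "((\<lambda>t. y0 + integral {b..t} (\<lambda>s. F (apply_bcontfun f s))) has_vector_derivative
        0 + F (apply_bcontfun f t)) (at t within {b..b+\<delta>})"
      by (intro has_vector_derivative_add has_vector_derivative_const
          integral_has_vector_derivative[OF cont[OF f(1)] t])
    from has_vector_derivative_transform[OF t eq this] show ?thesis by simp
  qed
  show thesis
    by (rule that[of \<delta> "apply_bcontfun f"]) (use \<delta> f(1) X der eq[of b] in auto)
qed

text \<open>The mean value inequality applied to \<open>f\<close> minus its expected linear part. It serves to join two solutions of a
  differential equation at a common endpoint.\<close>

lemma has_vector_derivative_removable:
  fixes f :: "real \<Rightarrow> 'a::euclidean_space"
  assumes b: "a < b" "b < c" and cont: "continuous_on {a<..<c} f"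
    and der: "\<And>t. t \<in> {a<..<c} \<Longrightarrow> t \<noteq> b \<Longrightarrow> (f has_vector_derivative f' t) (at t)"
    and lim: "isCont f' b"
  shows "(f has_vector_derivative f' b) (at b)"
  unfolding has_vector_derivative_def has_derivative_at_alt
proof (intro conjI allI impI bounded_linear_scaleR_left)
  fix e :: real assume "e > 0"
  then obtain d where d: "d > 0" "\<And>t. dist t b < d \<Longrightarrow> dist (f' t) (f' b) < e"
    using lim unfolding continuous_at_eps_delta by metis
  define g where "g t = f t - (t - b) *\<^sub>R f' b" for t
  have g: "(g has_derivative (\<lambda>h. h *\<^sub>R (f' t - f' b))) (at t)" if "t \<in> {a<..<c}" "t \<noteq> b" for t
    using der[OF that] unfolding g_def has_vector_derivative_def
    by (auto intro!: derivative_eq_intros simp: scaleR_diff_right)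
  have gc: "continuous_on {a<..<c} g"
    unfolding g_def by (intro continuous_intros cont)
  have key: "norm (g t - g s) \<le> e * \<bar>t - s\<bar>"
    if "s < t" "a < s" "t < c" "b \<le> s \<or> t \<le> b" "b - d < s" "t < b + d" for s t
  proof -
    have "\<exists>x\<in>{s<..<t}. norm (g t - g s) \<le> norm ((t - s) *\<^sub>R (f' x - f' b))"
      by (rule mvt_general[where f'="\<lambda>x h. h *\<^sub>R (f' x - f' b)"])
        (use that g in \<open>auto intro: continuous_on_subset[OF gc]\<close>)
    then obtain x where x: "x \<in> {s<..<t}" "norm (g t - g s) \<le> \<bar>t - s\<bar> * dist (f' x) (f' b)"
      by (auto simp: dist_norm)
    have "\<bar>x - b\<bar> < d" using x(1) that by (auto simp: abs_less_iff)
    then have "dist (f' x) (f' b) \<le> e"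
      using d(2)[of x] by (simp add: dist_real_def less_imp_le)
    then show ?thesis using x(2) mult_left_mono[of "dist (f' x) (f' b)" e "\<bar>t - s\<bar>"] by (simp add: mult.commute)
  qed
  define m where "m = min d (min (b - a) (c - b))"
  have "norm (f t - f b - (t - b) *\<^sub>R f' b) \<le> e * norm (t - b)" if "norm (t - b) < m" for t
  proof -
    have "f t - f b - (t - b) *\<^sub>R f' b = g t - g b" by (simp add: g_def)
    moreover have "norm (g t - g b) \<le> e * \<bar>t - b\<bar>"
    proof (cases t b rule: linorder_cases)
      case less
      then have "norm (g b - g t) \<le> e * \<bar>b - t\<bar>"
        using that d(1) b unfolding m_def by (intro key) auto
      then show ?thesis by (simp add: norm_minus_commute abs_minus_commute)
    next
      case greater
      then show ?thesis using that d(1) b unfolding m_def by (intro key) auto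
    qed simp
    ultimately show ?thesis by simp
  qed
  moreover have "m > 0" using d(1) b by (simp add: m_def)
  ultimately show "\<exists>d>0. \<forall>y. norm (y - b) < d \<longrightarrow> norm (f y - f b - (y - b) *\<^sub>R f' b) \<le> e * norm (y - b)"
    by blast
qed

lemma bounded_derivative_lipschitz:
  fixes f :: "real \<Rightarrow> 'a::real_normed_vector"
  assumes "convex S" "M \<ge> 0" and "\<And>t. t \<in> S \<Longrightarrow> (f has_vector_derivative f' t) (at t)"
    and "\<And>t. t \<in> S \<Longrightarrow> norm (f' t) \<le> M"
  shows "M-lipschitz_on S f"
proof (rule lipschitz_onI[OF _ assms(2)])
  fix x y assume "x \<in> S" "y \<in> S"
  then have "norm (f x - f y) \<le> M * norm (x - y)"
  proof (intro differentiable_bound[OF assms(1), where f'="\<lambda>t h. h *\<^sub>R f' t"])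
    fix t assume "t \<in> S"
    then show "(f has_derivative (\<lambda>h. h *\<^sub>R f' t)) (at t within S)"
      using assms(3) has_derivative_at_withinI unfolding has_vector_derivative_def by blast
    have "\<bar>h\<bar> * norm (f' t) \<le> M * \<bar>h\<bar>" for h :: real
      using assms(4)[OF \<open>t \<in> S\<close>] by (metis abs_ge_zero mult.commute mult_right_mono)
    then show "onorm (\<lambda>h. h *\<^sub>R f' t) \<le> M"
      by (intro onorm_le) auto
  qed auto
  then show "dist (f x) (f y) \<le> M * dist x y" by (simp add: dist_norm)
qed

lemma bounded_derivative_tendsto:
  fixes f :: "real \<Rightarrow> 'a::euclidean_space"
  assumes "a < b" and "\<And>t. t \<in> {a<..<b} \<Longrightarrow> (f has_vector_derivative f' t) (at t)"
    and "\<And>t. t \<in> {a<..<b} \<Longrightarrow> norm (f' t) \<le> M"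
  obtains l where "(f \<longlongrightarrow> l) (at_left b)"
proof -
  have "(max M 0)-lipschitz_on {a<..<b} f"
    by (rule bounded_derivative_lipschitz[OF convex_real_interval(8) _ assms(2)])
      (use assms(3) in \<open>auto simp: le_max_iff_disj\<close>)
  then have "uniformly_continuous_on {a<..<b} f"
    by (rule lipschitz_on_uniformly_continuous)
  moreover have "b \<in> closure {a<..<b}" using assms(1) by simp
  ultimately obtain l where "(f \<longlongrightarrow> l) (at b within {a<..<b})"
    using uniformly_continuous_on_extension_at_closure by blast
  moreover have "at b within {a<..<b} = at_left b"
    using at_within_Icc_at_left[OF assms(1)] at_within_nhd[of b "{a<..}" "{a<..<b}" "{..<b}"] assms(1)
    by (auto simp: greaterThanLessThan_def)
  ultimately show thesis using that by simp
qed

text \<open>Gronwall's argument: under the hypothesis \<open>ln (1 + f\<^sup>2)\<close> has a bounded derivative, so it cannot become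
  infinite in finite time.\<close>

lemma linear_growth_bounded:
  fixes f :: "real \<Rightarrow> real"
  assumes "convex I" "t0 \<in> I" "C \<ge> 0"
    and der: "\<And>t. t \<in> I \<Longrightarrow> \<exists>d. (f has_real_derivative d) (at t) \<and> \<bar>d\<bar> \<le> C * (1 + \<bar>f t\<bar>)"
  obtains M where "\<And>t. t \<in> I \<Longrightarrow> \<bar>t - t0\<bar> \<le> T \<Longrightarrow> \<bar>f t\<bar> \<le> M"
proof -
  obtain d where d: "\<And>t. t \<in> I \<Longrightarrow> (f has_real_derivative d t) (at t)"
      "\<And>t. t \<in> I \<Longrightarrow> \<bar>d t\<bar> \<le> C * (1 + \<bar>f t\<bar>)"
    using der by metis
  define g where "g t = ln (1 + f t ^ 2)" for t
  have pos: "1 + f t ^ 2 > 0" for t by (simp add: add_pos_nonneg)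
  have g: "(g has_vector_derivative 2 * f t * d t / (1 + f t ^ 2)) (at t)" if "t \<in> I" for t
    unfolding g_def has_real_derivative_iff_has_vector_derivative[symmetric] using pos[of t]
    by (auto intro!: derivative_eq_intros d(1)[OF that] simp: field_simps)
  have "norm (2 * f t * d t / (1 + f t ^ 2)) \<le> 4 * C" if "t \<in> I" for t
  proof -
    have "\<bar>2 * f t * d t\<bar> \<le> 2 * \<bar>f t\<bar> * (C * (1 + \<bar>f t\<bar>))"
      unfolding abs_mult using d(2)[OF that] by (intro mult_mono) auto
    also have "\<dots> = C * (2 * \<bar>f t\<bar> + 2 * f t ^ 2)" by (simp add: algebra_simps power2_eq_square)
    also have "\<dots> \<le> C * (4 * (1 + f t ^ 2))"
    proof (rule mult_left_mono[OF _ assms(3)])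
      have "0 \<le> (1 - \<bar>f t\<bar>) ^ 2" by simp
      then show "2 * \<bar>f t\<bar> + 2 * f t ^ 2 \<le> 4 * (1 + f t ^ 2)"
        by (simp add: power2_diff)
    qed
    finally show ?thesis using pos[of t] by (simp add: abs_divide divide_le_eq mult_ac)
  qed
  then have lip: "(4 * C)-lipschitz_on I g"
    by (intro bounded_derivative_lipschitz[OF assms(1) _ g]) (use assms(3) in auto)
  define B where "B = exp (g t0 + 4 * C * T)"
  have "\<bar>f t\<bar> \<le> B" if "t \<in> I" "\<bar>t - t0\<bar> \<le> T" for t
  proof -
    have "\<bar>g t - g t0\<bar> \<le> 4 * C * \<bar>t - t0\<bar>"
      using lipschitz_on_normD[OF lip that(1) assms(2)] by simp
    also have "\<dots> \<le> 4 * C * T" using that(2) assms(3) by (intro mult_left_mono) auto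
    finally have "g t \<le> g t0 + 4 * C * T" by simp
    then have "exp (g t) \<le> B" unfolding B_def by simp
    then have "1 + f t ^ 2 \<le> B" unfolding g_def using pos[of t] by simp
    moreover have "\<bar>f t\<bar> \<le> 1 + f t ^ 2"
      using zero_le_power2[of "\<bar>f t\<bar> - 1"] by (simp add: power2_diff)
    ultimately show ?thesis by simp
  qed
  then show thesis by (rule that)
qed

section \<open>Symmetry of second derivatives\<close>

text \<open>Two applications of the mean value theorem, first along \<open>u\<close> and then along \<open>v\<close>. The left-hand side of the
  equation is symmetric in \<open>u\<close> and \<open>v\<close>, the right-hand side is a second derivative in a definite
  order; letting \<open>h\<close> tend to zero gives the symmetry of second derivatives.\<close>

lemma second_difference_mean_value:
  fixes f :: "'e::euclidean_space \<Rightarrow> real"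
  assumes h: "h > 0" and r: "h * (norm u + norm v) < r"
    and D1: "\<And>y. y \<in> ball x r \<Longrightarrow> (f has_derivative D y) (at y)"
    and D2: "\<And>y. y \<in> ball x r \<Longrightarrow> ((\<lambda>y. D y u) has_derivative D2 y) (at y)"
  obtains p where "dist p x \<le> h * (norm u + norm v)"
    "f (x + h *\<^sub>R u + h *\<^sub>R v) - f (x + h *\<^sub>R u) - f (x + h *\<^sub>R v) + f x = h * h * D2 p v"
proof -
  have near: "dist (x + s *\<^sub>R u + t *\<^sub>R v) x \<le> h * (norm u + norm v)"
    if "0 \<le> s" "s \<le> h" "0 \<le> t" "t \<le> h" for s t
  proof -
    have "dist (x + s *\<^sub>R u + t *\<^sub>R v) x = norm (s *\<^sub>R u + t *\<^sub>R v)" by (simp add: dist_norm)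
    also have "\<dots> \<le> s * norm u + t * norm v"
      by (rule order_trans[OF norm_triangle_ineq]) (use that in simp)
    also have "\<dots> \<le> h * norm u + h * norm v"
      using that by (intro add_mono mult_right_mono) auto
    finally show ?thesis by (simp add: algebra_simps)
  qed
  have ball: "x + s *\<^sub>R u + t *\<^sub>R v \<in> ball x r" if "0 \<le> s" "s \<le> h" "0 \<le> t" "t \<le> h" for s t
    using near[OF that] r by (simp add: dist_commute)
  have line: "((\<lambda>s. q + s *\<^sub>R w) has_vector_derivative w) (at s)" for q w :: 'e and s
    by (auto intro!: derivative_eq_intros simp: has_vector_derivative_def)
  define g where "g s = f (x + s *\<^sub>R u + h *\<^sub>R v) - f (x + s *\<^sub>R u)" for s
  define g' where "g' s = D (x + s *\<^sub>R u + h *\<^sub>R v) u - D (x + s *\<^sub>R u) u" for s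
  have "DERIV g s :> g' s" if "0 \<le> s" "s \<le> h" for s
  proof -
    have "((\<lambda>s. f (x + s *\<^sub>R u + h *\<^sub>R v)) has_vector_derivative D (x + s *\<^sub>R u + h *\<^sub>R v) u) (at s)"
      using has_vector_derivative_compose[where x="\<lambda>s. x + h *\<^sub>R v + s *\<^sub>R u", OF D1 line, of s] ball[of s h] that h
      by (simp add: ac_simps)
    moreover have "((\<lambda>s. f (x + s *\<^sub>R u)) has_vector_derivative D (x + s *\<^sub>R u) u) (at s)"
      using has_vector_derivative_compose[where x="\<lambda>s. x + s *\<^sub>R u", OF D1 line, of s] ball[of s 0] that h
      by simp
    ultimately show ?thesis
      unfolding g_def g'_def has_real_derivative_iff_has_vector_derivative
      by (intro has_vector_derivative_diff) auto
  qed
  from MVT2[OF h, of g, OF this]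
  obtain s where s: "0 < s" "s < h" "g h - g 0 = (h - 0) * g' s"
    by blast
  define k where "k t = D (x + s *\<^sub>R u + t *\<^sub>R v) u" for t
  have "DERIV k t :> D2 (x + s *\<^sub>R u + t *\<^sub>R v) v" if "0 \<le> t" "t \<le> h" for t
    unfolding k_def has_real_derivative_iff_has_vector_derivative
    by (rule has_vector_derivative_compose[where x="\<lambda>t. x + s *\<^sub>R u + t *\<^sub>R v", OF D2 line])
      (use ball that s in auto)
  from MVT2[OF h, of k, OF this]
  obtain t where t: "0 < t" "t < h" "k h - k 0 = (h - 0) * D2 (x + s *\<^sub>R u + t *\<^sub>R v) v"
    by blast
  show thesis
  proof (rule that)
    show "dist (x + s *\<^sub>R u + t *\<^sub>R v) x \<le> h * (norm u + norm v)" using near s t by simp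
    have "g' s = k h - k 0" unfolding g'_def k_def by simp
    then show "f (x + h *\<^sub>R u + h *\<^sub>R v) - f (x + h *\<^sub>R u) - f (x + h *\<^sub>R v) + f x = h * h * D2 (x + s *\<^sub>R u + t *\<^sub>R v) v"
      using s(3) t(3) unfolding g_def by simp
  qed
qed

lemma second_derivative_symmetric:
  fixes f :: "'e::euclidean_space \<Rightarrow> 'f::euclidean_space"
  assumes sm: "smooth_on U f" and "open U" "x \<in> U"
  shows "frechet_derivative (\<lambda>y. frechet_derivative f (at y) u) (at x) v =
    frechet_derivative (\<lambda>y. frechet_derivative f (at y) v) (at x) u"
proof (rule euclidean_eqI)
  fix i :: 'f assume "i \<in> Basis"
  define D2 where "D2 u v y = frechet_derivative (\<lambda>y. frechet_derivative f (at y) u) (at y) v \<bullet> i" for u v y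
  obtain r0 where r0: "r0 > 0" "ball x r0 \<subseteq> U"
    using assms(2,3) openE by blast
  have "\<bar>D2 u v x - D2 v u x\<bar> \<le> e" if "e > 0" for e
  proof -
    have cont: "continuous_on U (D2 u v)" for u v
      unfolding D2_def by (intro continuous_intros smooth_on_deriv_continuous smooth_on_deriv sm)
    have "\<exists>d>0. \<forall>y\<in>U. dist y x < d \<longrightarrow> dist (D2 u v y) (D2 u v x) < e / 2" for u v
      using cont[of u v] \<open>x \<in> U\<close> that unfolding continuous_on_iff by (meson half_gt_zero)
    then obtain d1 d2 where d: "d1 > 0" "\<And>y. y \<in> U \<Longrightarrow> dist y x < d1 \<Longrightarrow> dist (D2 u v y) (D2 u v x) < e / 2"
      "d2 > 0" "\<And>y. y \<in> U \<Longrightarrow> dist y x < d2 \<Longrightarrow> dist (D2 v u y) (D2 v u x) < e / 2"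
      by metis
    define r where "r = min r0 (min d1 d2)"
    have r: "r > 0" "ball x r \<subseteq> U" using r0 d by (auto simp: r_def)
    define n where "n = norm u + norm v + 1"
    define h where "h = r / (2 * n)"
    have n: "n > 0" unfolding n_def by (simp add: add_nonneg_pos)
    have h: "h > 0" unfolding h_def using r n by simp
    have "h * n = r / 2" using n by (simp add: h_def)
    then have hr: "h * (norm u + norm v) < r" using h r unfolding n_def by (simp add: algebra_simps)
    have D1: "((\<lambda>y. f y \<bullet> i) has_derivative (\<lambda>v. frechet_derivative f (at y) v \<bullet> i)) (at y)" if "y \<in> ball x r" for y
      by (intro has_derivative_inner_left smooth_on_has_derivative[OF sm]) (use that r in auto)
    have D2: "((\<lambda>y. frechet_derivative f (at y) u \<bullet> i) has_derivative (\<lambda>v. D2 u v y)) (at y)" if "y \<in> ball x r" for y u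
      unfolding D2_def
      by (intro has_derivative_inner_left smooth_on_has_derivative[OF smooth_on_deriv[OF sm]]) (use that r in auto)
    obtain p where p: "dist p x \<le> h * (norm u + norm v)"
      "f (x + h *\<^sub>R u + h *\<^sub>R v) \<bullet> i - f (x + h *\<^sub>R u) \<bullet> i - f (x + h *\<^sub>R v) \<bullet> i + f x \<bullet> i = h * h * D2 u v p"
      using second_difference_mean_value[OF h hr D1 D2] by blast
    have hr': "h * (norm v + norm u) < r" using hr by (simp add: add.commute)
    obtain q where q: "dist q x \<le> h * (norm v + norm u)"
      "f (x + h *\<^sub>R v + h *\<^sub>R u) \<bullet> i - f (x + h *\<^sub>R v) \<bullet> i - f (x + h *\<^sub>R u) \<bullet> i + f x \<bullet> i = h * h * D2 v u q"
      using second_difference_mean_value[OF h hr' D1 D2] by blast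
    have "x + h *\<^sub>R v + h *\<^sub>R u = x + h *\<^sub>R u + h *\<^sub>R v" by simp
    then have "h * h * D2 u v p = h * h * D2 v u q" using p(2) q(2) by (simp only:)
    then have eq: "D2 u v p = D2 v u q" using h by simp
    have "dist p x < r" "dist q x < r" using p(1) q(1) hr hr' by linarith+
    then have "dist (D2 u v p) (D2 u v x) < e / 2" "dist (D2 v u q) (D2 v u x) < e / 2"
      using d r unfolding r_def by (auto simp: dist_commute subset_iff)
    then show ?thesis using eq unfolding dist_real_def by linarith
  qed
  then have "D2 u v x = D2 v u x"
    by (metis abs_le_zero_iff dense_ge eq_iff_diff_eq_0)
  then show "frechet_derivative (\<lambda>y. frechet_derivative f (at y) u) (at x) v \<bullet> i =
    frechet_derivative (\<lambda>y. frechet_derivative f (at y) v) (at x) u \<bullet> i"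
    unfolding D2_def .
qed

section \<open>Local solvability of the geodesic equation\<close>

text \<open>Boundedness is included so that products stay in the class: the geodesic equation is polynomial in the
  velocity.\<close>

definition bounded_lipschitz_on :: "'a::metric_space set \<Rightarrow> ('a \<Rightarrow> real) \<Rightarrow> bool" where
  "bounded_lipschitz_on S f \<longleftrightarrow> (\<exists>B. \<forall>x\<in>S. \<bar>f x\<bar> \<le> B) \<and> (\<exists>L. L-lipschitz_on S f)"

lemma bounded_lipschitz_on_add:
  assumes "bounded_lipschitz_on S f" "bounded_lipschitz_on S g"
  shows "bounded_lipschitz_on S (\<lambda>x. f x + g x)"
proof -
  obtain B L B' L' where *: "\<forall>x\<in>S. \<bar>f x\<bar> \<le> B" "L-lipschitz_on S f" "\<forall>x\<in>S. \<bar>g x\<bar> \<le> B'" "L'-lipschitz_on S g"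
    using assms unfolding bounded_lipschitz_on_def by blast
  have "\<forall>x\<in>S. \<bar>f x + g x\<bar> \<le> B + B'" using * by fastforce
  then show ?thesis
    unfolding bounded_lipschitz_on_def using lipschitz_on_add[OF *(2,4)] by blast
qed

lemma bounded_lipschitz_on_mult:
  assumes "bounded_lipschitz_on S f" "bounded_lipschitz_on S g"
  shows "bounded_lipschitz_on S (\<lambda>x. f x * g x)"
proof -
  obtain B L B' L' where *: "\<And>x. x \<in> S \<Longrightarrow> \<bar>f x\<bar> \<le> B" "L-lipschitz_on S f"
      "\<And>x. x \<in> S \<Longrightarrow> \<bar>g x\<bar> \<le> B'" "L'-lipschitz_on S g"
    using assms unfolding bounded_lipschitz_on_def by blast
  have L: "L \<ge> 0" "L' \<ge> 0" using * lipschitz_on_nonneg by auto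
  have "\<forall>x\<in>S. \<bar>f x * g x\<bar> \<le> B * B'"
    unfolding abs_mult using * by (auto intro!: mult_mono order_trans[OF abs_ge_zero])
  moreover have "(\<bar>B\<bar> * L' + \<bar>B'\<bar> * L)-lipschitz_on S (\<lambda>x. f x * g x)"
  proof (rule lipschitz_onI)
    fix x y assume x: "x \<in> S" and y: "y \<in> S"
    have "f x * g x - f y * g y = f x * (g x - g y) + g y * (f x - f y)" by (simp add: algebra_simps)
    then have "\<bar>f x * g x - f y * g y\<bar> \<le> \<bar>f x\<bar> * \<bar>g x - g y\<bar> + \<bar>g y\<bar> * \<bar>f x - f y\<bar>"
      by (metis abs_mult abs_triangle_ineq)
    also have "\<dots> \<le> \<bar>B\<bar> * (L' * dist x y) + \<bar>B'\<bar> * (L * dist x y)"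
      using lipschitz_onD[OF *(4) x y] lipschitz_onD[OF *(2) x y] *(1)[OF x] *(3)[OF y]
      by (intro add_mono mult_mono) (auto simp: dist_real_def)
    finally show "dist (f x * g x) (f y * g y) \<le> (\<bar>B\<bar> * L' + \<bar>B'\<bar> * L) * dist x y"
      by (simp add: dist_real_def algebra_simps)
  qed (use L in simp)
  ultimately show ?thesis unfolding bounded_lipschitz_on_def by blast
qed

lemma bounded_lipschitz_on_const: "bounded_lipschitz_on S (\<lambda>x. c)"
  unfolding bounded_lipschitz_on_def using lipschitz_on_constant by blast

lemma bounded_lipschitz_on_sum:
  "(\<And>i. i \<in> I \<Longrightarrow> bounded_lipschitz_on S (f i)) \<Longrightarrow> bounded_lipschitz_on S (\<lambda>x. \<Sum>i\<in>I. f i x)"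
  by (induction I rule: infinite_finite_induct)
    (auto intro: bounded_lipschitz_on_add bounded_lipschitz_on_const)

lemma bounded_lipschitz_on_compose:
  assumes "bounded_lipschitz_on S f" "L-lipschitz_on T g" "g ` T \<subseteq> S"
  shows "bounded_lipschitz_on T (\<lambda>x. f (g x))"
proof -
  obtain B L' where *: "\<forall>x\<in>S. \<bar>f x\<bar> \<le> B" "L'-lipschitz_on S f"
    using assms unfolding bounded_lipschitz_on_def by blast
  have "(L' * L)-lipschitz_on T (\<lambda>x. f (g x))"
    using lipschitz_on_compose2[OF assms(2) lipschitz_on_subset[OF *(2) assms(3)]] by (simp add: mult.commute)
  then show ?thesis unfolding bounded_lipschitz_on_def using * assms(3) by blast
qed

lemma smooth_on_bounded_lipschitz:
  fixes f :: "'e::euclidean_space \<Rightarrow> real"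
  assumes sm: "smooth_on U f" and K: "compact K" "convex K" "K \<subseteq> U"
  shows "bounded_lipschitz_on K f"
proof -
  have "bounded (f ` K)"
    by (intro compact_imp_bounded compact_continuous_image K(1)
        continuous_on_subset[OF smooth_on_continuous[OF sm] K(3)])
  then have "\<exists>B. \<forall>x\<in>K. \<bar>f x\<bar> \<le> B" by (auto simp: bounded_iff)
  moreover have "\<exists>C\<ge>0. \<forall>x\<in>K. \<forall>u. norm (frechet_derivative f (at x) u) \<le> C * norm u"
    by (rule linear_family_bound[OF K(1)])
      (use sm K(3) in \<open>auto intro: smooth_on_deriv_linear continuous_on_subset[OF smooth_on_deriv_continuous]\<close>)
  then obtain C where C: "C \<ge> 0" "\<And>x u. x \<in> K \<Longrightarrow> norm (frechet_derivative f (at x) u) \<le> C * norm u"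
    by blast
  have "C-lipschitz_on K f"
  proof (rule lipschitz_onI[OF _ C(1)])
    fix x y assume "x \<in> K" "y \<in> K"
    then have "norm (f x - f y) \<le> C * norm (x - y)"
    proof (intro differentiable_bound[OF K(2), where f'="\<lambda>x. frechet_derivative f (at x)"])
      fix t assume t: "t \<in> K"
      then show "(f has_derivative frechet_derivative f (at t)) (at t within K)"
        using smooth_on_has_derivative[OF sm] K(3) has_derivative_at_withinI by blast
      show "onorm (frechet_derivative f (at t)) \<le> C"
        by (intro onorm_le C(2) t)
    qed auto
    then show "dist (f x) (f y) \<le> C * dist x y" by (simp add: dist_norm)
  qed
  ultimately show ?thesis unfolding bounded_lipschitz_on_def by blast
qed

context lorentzian_patch
begin

text \<open>The functions \<open>G x (\<Gamma> x v v) i\<close> are polynomials in \<open>v\<close> with smooth coefficients, hence Lipschitz. To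
  compare \<open>\<Gamma>\<close> itself at two points, the difference is tested against the basis with the metric at
  one point, and the error from the change of the metric is Lipschitz as well.\<close>

lemma geodesic_spray_lipschitz:
  assumes "cball x0 r \<subseteq> U"
  shows "\<exists>L. L-lipschitz_on (cball x0 r \<times> cball v0 s) (\<lambda>p. (snd p, - \<Gamma> (fst p) (snd p) (snd p)))"
proof -
  let ?K = "cball x0 r" and ?S = "cball x0 r \<times> cball v0 s"
  define k where "k i p = G (fst p) (\<Gamma> (fst p) (snd p) (snd p)) i" for i p
  have fst: "1-lipschitz_on ?S fst" and snd: "1-lipschitz_on ?S snd"
    by (rule lipschitz_onI; simp add: dist_fst_le dist_snd_le)+
  have base: "bounded_lipschitz_on ?K f" if "smooth_on U f" for f :: "'e \<Rightarrow> real"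
    by (rule smooth_on_bounded_lipschitz[OF that compact_cball convex_cball assms])
  have comp: "bounded_lipschitz_on ?S (\<lambda>p. f (fst p))" if "smooth_on U f" for f :: "'e \<Rightarrow> real"
    by (rule bounded_lipschitz_on_compose[OF base[OF that] fst]) auto
  have coord: "bounded_lipschitz_on ?S (\<lambda>p. snd p \<bullet> j)" for j
  proof (rule bounded_lipschitz_on_compose[OF _ snd])
    have "\<bar>v \<bullet> j\<bar> \<le> (norm v0 + s) * norm j" if "v \<in> cball v0 s" for v
    proof -
      have "norm v \<le> norm v0 + s"
        using that norm_triangle_sub[of v v0] by (simp add: dist_norm norm_minus_commute)
      then show ?thesis
        by (intro order_trans[OF Cauchy_Schwarz_ineq2] mult_right_mono) auto
    qed
    moreover have "(norm j)-lipschitz_on (cball v0 s) (\<lambda>v. v \<bullet> j)"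
    proof (rule lipschitz_onI)
      fix x y show "dist (x \<bullet> j) (y \<bullet> j) \<le> norm j * dist x y"
        using Cauchy_Schwarz_ineq2[of "x - y" j] by (simp add: dist_norm inner_diff_left mult.commute)
    qed simp
    ultimately show "bounded_lipschitz_on (cball v0 s) (\<lambda>v. v \<bullet> j)"
      unfolding bounded_lipschitz_on_def by blast
  qed auto
  have kS: "bounded_lipschitz_on ?S (k i)" for i
  proof -
    let ?q = "\<lambda>x j l. (dG x j l i + dG x l j i - dG x i j l) / 2"
    have "k i p = (\<Sum>j\<in>Basis. \<Sum>l\<in>Basis. (snd p \<bullet> j) * (snd p \<bullet> l) * ((1/2) * (dG (fst p) j l i + dG (fst p) l j i + (-1) * dG (fst p) i j l)))"
      if "p \<in> ?S" for p
    proof -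
      have x: "fst p \<in> U" using that assms by auto
      have "k i p = ?q (fst p) (snd p) (snd p)"
        unfolding k_def using levi_civita_koszul[OF x] by simp
      also have "\<dots> = (\<Sum>j\<in>Basis. (snd p \<bullet> j) *\<^sub>R ?q (fst p) j (snd p))"
        by (rule linear_expand[OF bilinear_linear_left[OF bilinear_koszul[OF x]]])
      also have "\<dots> = (\<Sum>j\<in>Basis. (snd p \<bullet> j) *\<^sub>R (\<Sum>l\<in>Basis. (snd p \<bullet> l) *\<^sub>R ?q (fst p) j l))"
        by (intro sum.cong refl arg_cong[where f="scaleR _"] linear_expand[OF bilinear_linear_right[OF bilinear_koszul[OF x]]])
      finally show ?thesis
        by (simp add: sum_distrib_left algebra_simps diff_divide_distrib add_divide_distrib)
    qed
    moreover have "bounded_lipschitz_on ?S (\<lambda>p. \<Sum>j\<in>Basis. \<Sum>l\<in>Basis. (snd p \<bullet> j) * (snd p \<bullet> l) * ((1/2) * (dG (fst p) j l i + dG (fst p) l j i + (-1) * dG (fst p) i j l)))"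
      by (intro bounded_lipschitz_on_sum bounded_lipschitz_on_mult bounded_lipschitz_on_add
          bounded_lipschitz_on_const coord comp smooth_on_deriv smooth)
    ultimately show ?thesis
      unfolding bounded_lipschitz_on_def by (auto intro: lipschitz_on_transform)
  qed
  obtain C where C: "C \<ge> 0" "\<And>x z. x \<in> ?K \<Longrightarrow> norm z \<le> C * (\<Sum>i\<in>Basis. \<bar>G x z i\<bar>)"
    using nondegeneracy_bound[OF compact_cball assms] by blast
  obtain Cg where Cg: "Cg \<ge> 0" "\<And>x u v. x \<in> ?K \<Longrightarrow> norm (\<Gamma> x u v) \<le> Cg * norm u * norm v"
    using levi_civita_bound[OF compact_cball assms] by blast
  define R where "R = Cg * (norm v0 + \<bar>s\<bar>) * (norm v0 + \<bar>s\<bar>)"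
  have R: "norm (\<Gamma> (fst p) (snd p) (snd p)) \<le> R" if "p \<in> ?S" for p
  proof -
    have "norm (snd p) \<le> norm v0 + \<bar>s\<bar>"
      using that norm_triangle_sub[of "snd p" v0] by (auto simp: dist_norm norm_minus_commute)
    moreover have "fst p \<in> ?K" using that by auto
    ultimately show ?thesis
      unfolding R_def using Cg(1) by (intro order_trans[OF Cg(2)] mult_mono) auto
  qed
  have R0: "R \<ge> 0" unfolding R_def using Cg(1) by simp
  obtain Lk where Lk: "\<And>i. (Lk i)-lipschitz_on ?S (k i)"
    using kS unfolding bounded_lipschitz_on_def by metis
  have "\<exists>L. L-lipschitz_on ?S (\<lambda>p. G (fst p) j i)" for i j
    using comp[OF smooth, of j i] unfolding bounded_lipschitz_on_def by blast
  note ex = this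
  define Lg where "Lg i j = (SOME L. L-lipschitz_on ?S (\<lambda>p. G (fst p) j i))" for i j
  have Lg: "(Lg i j)-lipschitz_on ?S (\<lambda>p. G (fst p) j i)" for i j
    unfolding Lg_def by (rule someI_ex[OF ex])
  define L where "L = C * (\<Sum>i\<in>Basis. Lk i + R * (\<Sum>j\<in>Basis. Lg i j))"
  have Lk0: "Lk i \<ge> 0" and Lg0: "Lg i j \<ge> 0" for i j
    using lipschitz_on_nonneg[OF Lk] lipschitz_on_nonneg[OF Lg] by blast+
  have "L-lipschitz_on ?S (\<lambda>p. \<Gamma> (fst p) (snd p) (snd p))"
  proof (rule lipschitz_onI)
    fix p q assume p: "p \<in> ?S" and q: "q \<in> ?S"
    define z z' where "z = \<Gamma> (fst p) (snd p) (snd p)" and "z' = \<Gamma> (fst q) (snd q) (snd q)"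
    have xp: "fst p \<in> U" "fst p \<in> ?K" and xq: "fst q \<in> U" using p q assms by auto
    have "\<bar>G (fst p) (z - z') i\<bar> \<le> (Lk i + R * (\<Sum>j\<in>Basis. Lg i j)) * dist p q" for i
    proof -
      have "G (fst p) (z - z') i = (k i p - k i q) + (G (fst q) z' i - G (fst p) z' i)"
        unfolding k_def z_def z'_def by (simp add: linear_diff[OF linear_G1[OF xp(1)]])
      moreover have "G (fst q) z' i - G (fst p) z' i = (\<Sum>j\<in>Basis. (z' \<bullet> j) * (G (fst q) j i - G (fst p) j i))"
        using linear_expand[OF linear_G1[OF xq], of z' i] linear_expand[OF linear_G1[OF xp(1)], of z' i]
        by (simp add: sum_subtractf algebra_simps)
      moreover have "\<bar>\<Sum>j\<in>Basis. (z' \<bullet> j) * (G (fst q) j i - G (fst p) j i)\<bar> \<le> (\<Sum>j\<in>Basis. R * (Lg i j * dist p q))"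
      proof (rule order_trans[OF sum_abs], rule sum_mono)
        fix j :: 'e assume j: "j \<in> Basis"
        have "\<bar>z' \<bullet> j\<bar> \<le> R" using Basis_le_norm[OF j, of z'] R[OF q] unfolding z'_def by linarith
        moreover have "\<bar>G (fst q) j i - G (fst p) j i\<bar> \<le> Lg i j * dist p q"
          using lipschitz_onD[OF Lg q p, of j i] by (simp add: dist_real_def dist_commute)
        ultimately show "\<bar>(z' \<bullet> j) * (G (fst q) j i - G (fst p) j i)\<bar> \<le> R * (Lg i j * dist p q)"
          unfolding abs_mult using R0 by (intro mult_mono) auto
      qed
      moreover have "\<bar>k i p - k i q\<bar> \<le> Lk i * dist p q"
        using lipschitz_onD[OF Lk p q, of i] by (simp add: dist_real_def)
      ultimately show ?thesis
        by (simp add: sum_distrib_left sum_distrib_right algebra_simps)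
    qed
    then have "C * (\<Sum>i\<in>Basis. \<bar>G (fst p) (z - z') i\<bar>) \<le> C * (\<Sum>i\<in>Basis. (Lk i + R * (\<Sum>j\<in>Basis. Lg i j)) * dist p q)"
      by (intro mult_left_mono sum_mono C(1))
    then show "dist z z' \<le> L * dist p q"
      using C(2)[OF xp(2), of "z - z'"] unfolding L_def dist_norm
      by (simp add: sum_distrib_right mult.assoc)
  next
    show "0 \<le> L"
      unfolding L_def using C(1) R0 Lk0 Lg0
      by (intro mult_nonneg_nonneg sum_nonneg add_nonneg_nonneg) auto
  qed
  then have "(sqrt (1\<^sup>2 + L\<^sup>2))-lipschitz_on ?S (\<lambda>p. (snd p, - \<Gamma> (fst p) (snd p) (snd p)))"
    by (intro lipschitz_on_Pair snd) simp
  then show ?thesis by blast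
qed

lemma geodesic_spray_continuous:
  "continuous_on (U \<times> UNIV) (\<lambda>p. - \<Gamma> (fst p) (snd p) (snd p))"
  unfolding continuous_on_eq_continuous_at[OF open_Times[OF open_U open_UNIV]]
proof
  fix p assume "p \<in> U \<times> (UNIV :: 'e set)"
  then obtain r where r: "r > 0" "cball (fst p) r \<subseteq> U"
    using open_U open_contains_cball by (metis mem_Times_iff)
  obtain L where "L-lipschitz_on (cball (fst p) r \<times> cball (snd p) 1) (\<lambda>p. (snd p, - \<Gamma> (fst p) (snd p) (snd p)))"
    using geodesic_spray_lipschitz[OF r(2)] by blast
  then have "continuous_on (cball (fst p) r \<times> cball (snd p) 1) (\<lambda>p. snd (snd p, - \<Gamma> (fst p) (snd p) (snd p)))"
    by (intro continuous_on_snd lipschitz_on_continuous_on)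
  then have "continuous_on (ball (fst p) r \<times> ball (snd p) 1) (\<lambda>p. - \<Gamma> (fst p) (snd p) (snd p))"
    by (auto elim: continuous_on_subset)
  then show "isCont (\<lambda>p. - \<Gamma> (fst p) (snd p) (snd p)) p"
    by (rule continuous_on_interior) (use r in \<open>auto simp: interior_open open_Times mem_Times_iff\<close>)
qed

end

section \<open>Charts\<close>

locale atlas =
  fixes A :: "('m::{t2_space, second_countable_topology}, 'e::euclidean_space) chart set"
  assumes smooth_structure: "smooth_structure A"
begin

lemma chart: "c \<in> A \<Longrightarrow> is_chart c"
  using smooth_structure unfolding smooth_structure_def by blast

lemma chart_at: obtains c where "c \<in> A" "p \<in> cdom c"
  using smooth_structure unfolding smooth_structure_def by blast

lemma open_cdom: "c \<in> A \<Longrightarrow> open (cdom c)"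
  and open_cimage: "c \<in> A \<Longrightarrow> open (cimage c)"
  and chart_homeomorphism: "c \<in> A \<Longrightarrow> homeomorphism (cdom c) (cimage c) (cmap c) (cinv c)"
  using chart unfolding is_chart_def by blast+

lemma continuous_on_cmap: "c \<in> A \<Longrightarrow> continuous_on (cdom c) (cmap c)"
  and continuous_on_cinv: "c \<in> A \<Longrightarrow> continuous_on (cimage c) (cinv c)"
  and cinv_cmap: "c \<in> A \<Longrightarrow> p \<in> cdom c \<Longrightarrow> cinv c (cmap c p) = p"
  and cmap_cinv: "c \<in> A \<Longrightarrow> x \<in> cimage c \<Longrightarrow> cmap c (cinv c x) = x"
  and cinv_in_cdom: "c \<in> A \<Longrightarrow> x \<in> cimage c \<Longrightarrow> cinv c x \<in> cdom c"
  using chart_homeomorphism[of c] unfolding homeomorphism_def by auto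

lemma cmap_in_cimage: "p \<in> cdom c \<Longrightarrow> cmap c p \<in> cimage c"
  unfolding cimage_def by blast

definition overlap :: "('m, 'e) chart \<Rightarrow> ('m, 'e) chart \<Rightarrow> 'e set" where
  "overlap c d = cmap c ` (cdom c \<inter> cdom d)"

lemma overlap_iff:
  assumes c: "c \<in> A"
  shows "x \<in> overlap c d \<longleftrightarrow> x \<in> cimage c \<and> cinv c x \<in> cdom d"
proof
  assume "x \<in> overlap c d"
  then show "x \<in> cimage c \<and> cinv c x \<in> cdom d"
    unfolding overlap_def by (elim imageE) (simp add: cinv_cmap cmap_in_cimage c)
next
  assume "x \<in> cimage c \<and> cinv c x \<in> cdom d"
  then have "x = cmap c (cinv c x)" "cinv c x \<in> cdom c \<inter> cdom d"
    by (simp_all add: cmap_cinv cinv_in_cdom c)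
  then show "x \<in> overlap c d"
    unfolding overlap_def by (rule image_eqI)
qed

lemma open_overlap: assumes "c \<in> A" "d \<in> A" shows "open (overlap c d)"
proof -
  have "overlap c d = cinv c -` cdom d \<inter> cimage c"
    using overlap_iff[OF assms(1)] by blast
  then show ?thesis
    using continuous_on_open_vimage[OF open_cimage[OF assms(1)], of "cinv c"]
      continuous_on_cinv[OF assms(1)] open_cdom[OF assms(2)] by simp
qed

lemma smooth_transition: "c \<in> A \<Longrightarrow> d \<in> A \<Longrightarrow> smooth_on (overlap c d) (transition c d)"
  using smooth_structure unfolding smooth_structure_def compatible_def overlap_def by blast

lemma transition_cmap: "c \<in> A \<Longrightarrow> p \<in> cdom c \<Longrightarrow> transition c d (cmap c p) = cmap d p"
  by (simp add: transition_def cinv_cmap)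

lemma cmap_in_overlap: "p \<in> cdom c \<Longrightarrow> p \<in> cdom d \<Longrightarrow> cmap c p \<in> overlap c d"
  by (simp add: overlap_def)

abbreviation jacobian :: "('m, 'e) chart \<Rightarrow> ('m, 'e) chart \<Rightarrow> 'm \<Rightarrow> 'e \<Rightarrow> 'e" where
  "jacobian c d p \<equiv> frechet_derivative (transition c d) (at (cmap c p))"

lemma jacobian_derivative:
  assumes "c \<in> A" "d \<in> A" "p \<in> cdom c" "p \<in> cdom d"
  shows "(transition c d has_derivative jacobian c d p) (at (cmap c p))"
  by (rule smooth_on_has_derivative[OF smooth_transition[OF assms(1,2)] cmap_in_overlap[OF assms(3,4)]])

lemma linear_jacobian:
  assumes "c \<in> A" "d \<in> A" "p \<in> cdom c" "p \<in> cdom d" shows "linear (jacobian c d p)"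
  by (rule has_derivative_linear[OF jacobian_derivative[OF assms]])

lemma jacobian_self:
  assumes "c \<in> A" "p \<in> cdom c" shows "jacobian c c p u = u"
proof -
  have "((\<lambda>x. x) has_derivative jacobian c c p) (at (cmap c p))"
    by (rule has_derivative_transform_within_open[OF jacobian_derivative[OF assms(1,1,2,2)]
          open_cimage[OF assms(1)] cmap_in_cimage[OF assms(2)]])
      (simp add: transition_def cmap_cinv assms)
  from frechet_derivative_at[OF this] show ?thesis by simp
qed

lemma jacobian_cocycle:
  assumes "c \<in> A" "d \<in> A" "e \<in> A" and p: "p \<in> cdom c" "p \<in> cdom d" "p \<in> cdom e"
  shows "jacobian d e p (jacobian c d p u) = jacobian c e p u"
proof -
  have "((\<lambda>x. transition d e (transition c d x)) has_derivative (\<lambda>u. jacobian d e p (jacobian c d p u))) (at (cmap c p))"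
    by (rule has_derivative_compose[OF jacobian_derivative[OF assms(1,2) p(1,2)]])
      (use jacobian_derivative[OF assms(2,3) p(2,3)] transition_cmap assms p in simp)
  then have "(transition c e has_derivative (\<lambda>u. jacobian d e p (jacobian c d p u))) (at (cmap c p))"
  proof (rule has_derivative_transform_within_open)
    show "open (overlap c d)" "cmap c p \<in> overlap c d"
      using open_overlap cmap_in_overlap assms by auto
    fix x assume "x \<in> overlap c d"
    then show "transition d e (transition c d x) = transition c e x"
      unfolding transition_def using overlap_iff[OF assms(1)] cinv_cmap[OF assms(2)] by simp
  qed
  from frechet_derivative_at[OF this] show ?thesis by (simp add: fun_eq_iff)
qed

lemma tangent_vector_transform:
  "\<xi> \<in> tangent_space A p \<Longrightarrow> c \<in> A \<Longrightarrow> d \<in> A \<Longrightarrow> p \<in> cdom c \<Longrightarrow> p \<in> cdom d \<Longrightarrow> \<xi> d = jacobian c d p (\<xi> c)"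
  unfolding tangent_space_def by blast

lemma tangent_vector_eq_tvec_of:
  assumes \<xi>: "\<xi> \<in> tangent_space A p" and c: "c \<in> A" "p \<in> cdom c"
  shows "tvec_of A c p (\<xi> c) = \<xi>"
proof (rule ext)
  fix d
  show "tvec_of A c p (\<xi> c) d = \<xi> d"
  proof (cases "d \<in> A \<and> p \<in> cdom d")
    case True
    then show ?thesis
      unfolding tvec_of_def using tangent_vector_transform[OF \<xi> c(1) _ c(2), of d] by simp
  next
    case False
    then have "\<xi> d = 0" using \<xi> unfolding tangent_space_def by blast
    moreover have "tvec_of A c p (\<xi> c) d = 0" unfolding tvec_of_def by (rule if_not_P[OF False])
    ultimately show ?thesis by simp
  qed
qed

lemma metric_coord_eq:
  assumes "\<xi> \<in> tangent_space A p" "\<eta> \<in> tangent_space A p" "c \<in> A" "p \<in> cdom c"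
  shows "metric_coord A g c (cmap c p) (\<xi> c) (\<eta> c) = g p \<xi> \<eta>"
  unfolding metric_coord_def using assms by (simp add: cinv_cmap tangent_vector_eq_tvec_of)

lemma metric_coord_transform:
  assumes "c \<in> A" "d \<in> A" and p: "p \<in> cdom c" "p \<in> cdom d"
  shows "metric_coord A g d (cmap d p) (jacobian c d p u) (jacobian c d p w) = metric_coord A g c (cmap c p) u w"
proof -
  have "tvec_of A d p (jacobian c d p u) = tvec_of A c p u" for u
    unfolding tvec_of_def using jacobian_cocycle[OF assms(1,2) _ p] by (auto simp: fun_eq_iff)
  then show ?thesis
    unfolding metric_coord_def using assms by (simp add: cinv_cmap)
qed

lemma curve_in_chart:
  assumes "c \<in> A" "open I" "continuous_on I \<gamma>"
  shows "open {t \<in> I. \<gamma> t \<in> cdom c}"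
proof -
  have "{t \<in> I. \<gamma> t \<in> cdom c} = \<gamma> -` cdom c \<inter> I" by blast
  then show ?thesis
    using continuous_on_open_vimage[OF assms(2), of \<gamma>] assms(3) open_cdom[OF assms(1)] by simp
qed

lemma curve_transition:
  assumes "c \<in> A" "d \<in> A" and S: "open S" "t \<in> S" "\<And>s. s \<in> S \<Longrightarrow> \<gamma> s \<in> cdom c" "\<And>s. s \<in> S \<Longrightarrow> \<gamma> s \<in> cdom d"
    and der: "((cmap c \<circ> \<gamma>) has_vector_derivative v) (at t)"
  shows "((cmap d \<circ> \<gamma>) has_vector_derivative jacobian c d (\<gamma> t) v) (at t)"
proof -
  have "((\<lambda>s. transition c d ((cmap c \<circ> \<gamma>) s)) has_vector_derivative jacobian c d (\<gamma> t) v) (at t)"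
    by (rule has_vector_derivative_compose[OF _ der]) (use jacobian_derivative assms in simp)
  then show ?thesis
    by (rule has_vector_derivative_transform_within_open[OF _ S(1,2)]) (use transition_cmap assms in simp)
qed

lemma velocity_tangent:
  assumes "open I" "continuous_on I \<gamma>" "t \<in> I"
    and diff: "\<And>c. c \<in> A \<Longrightarrow> \<gamma> t \<in> cdom c \<Longrightarrow> (cmap c \<circ> \<gamma>) differentiable (at t)"
  shows "velocity A \<gamma> t \<in> tangent_space A (\<gamma> t)"
  unfolding tangent_space_def
proof (intro CollectI conjI allI ballI impI)
  fix c d assume c: "c \<in> A" and d: "d \<in> A" and p: "\<gamma> t \<in> cdom c \<inter> cdom d"
  define S where "S = {s \<in> I. \<gamma> s \<in> cdom c} \<inter> {s \<in> I. \<gamma> s \<in> cdom d}"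
  have S: "open S" "t \<in> S"
    unfolding S_def using curve_in_chart[OF c assms(1,2)] curve_in_chart[OF d assms(1,2)] p \<open>t \<in> I\<close>
    by (simp_all add: open_Int)
  have x: "((cmap c \<circ> \<gamma>) has_vector_derivative vector_derivative (cmap c \<circ> \<gamma>) (at t)) (at t)"
    using diff[OF c] p vector_derivative_works by blast
  have "((cmap d \<circ> \<gamma>) has_vector_derivative jacobian c d (\<gamma> t) (vector_derivative (cmap c \<circ> \<gamma>) (at t))) (at t)"
    by (rule curve_transition[OF c d S _ _ x]) (simp_all add: S_def)
  from vector_derivative_at[OF this]
  show "velocity A \<gamma> t d = jacobian c d (\<gamma> t) (velocity A \<gamma> t c)"
    unfolding velocity_def using c d p by simp
qed (simp add: velocity_def, blast)

text \<open>Inverse images of closed coordinate balls are compact in the manifold, hence closed because it is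
  Hausdorff. So a function that is zero off such a ball is zero near every point off the ball, also near
  points outside the chart.\<close>

lemma closed_chart_ball:
  assumes "c \<in> A" "cball x r \<subseteq> cimage c"
  shows "compact {p \<in> cdom c. cmap c p \<in> cball x r}" "closed {p \<in> cdom c. cmap c p \<in> cball x r}"
proof -
  have "{p \<in> cdom c. cmap c p \<in> cball x r} = cinv c ` cball x r"
  proof (intro equalityI subsetI)
    fix p assume "p \<in> {p \<in> cdom c. cmap c p \<in> cball x r}"
    then show "p \<in> cinv c ` cball x r"
      using cinv_cmap[OF assms(1)] by (intro image_eqI[of _ _ "cmap c p"]) auto
  next
    fix p assume "p \<in> cinv c ` cball x r"
    then obtain y where y: "y \<in> cball x r" "p = cinv c y" by blast
    then have "y \<in> cimage c" using assms(2) by blast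
    then show "p \<in> {p \<in> cdom c. cmap c p \<in> cball x r}"
      using y cmap_cinv cinv_in_cdom assms(1) by simp
  qed
  then show "compact {p \<in> cdom c. cmap c p \<in> cball x r}"
    using compact_continuous_image[OF continuous_on_subset[OF continuous_on_cinv[OF assms(1)] assms(2)] compact_cball] by simp
  then show "closed {p \<in> cdom c. cmap c p \<in> cball x r}"
    by (rule compact_imp_closed)
qed

end

section \<open>Geodesics\<close>

locale lorentzian_manifold = atlas A
  for A :: "('m::{t2_space, second_countable_topology}, 'e::euclidean_space) chart set" +
  fixes g :: "('m, 'e) metric"
  assumes lorentzian_metric: "lorentzian_metric A g"
begin

lemma lorentzian_patch: "c \<in> A \<Longrightarrow> lorentzian_patch (cimage c) (metric_coord A g c)"
  using lorentzian_metric open_cimage unfolding lorentzian_patch_def lorentzian_metric_def by blast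

lemma geodesicD:
  assumes "geodesic A g \<gamma> I"
  shows "open I" "is_interval I" "I \<noteq> {}" "continuous_on I \<gamma>"
  using assms unfolding geodesic_def by blast+

lemma geodesic_equation:
  assumes "geodesic A g \<gamma> I" "c \<in> A" "t \<in> I" "\<gamma> t \<in> cdom c"
  shows "((cmap c \<circ> \<gamma>) has_vector_derivative vector_derivative (cmap c \<circ> \<gamma>) (at t)) (at t)"
    "((\<lambda>s. vector_derivative (cmap c \<circ> \<gamma>) (at s)) has_vector_derivative
        - levi_civita (metric_coord A g c) (cmap c (\<gamma> t)) (vector_derivative (cmap c \<circ> \<gamma>) (at t))
          (vector_derivative (cmap c \<circ> \<gamma>) (at t))) (at t)"
  using assms vector_derivative_works unfolding geodesic_def velocity_def christoffel_eq_levi_civita by auto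

lemma geodesic_velocity_tangent:
  "geodesic A g \<gamma> I \<Longrightarrow> t \<in> I \<Longrightarrow> velocity A \<gamma> t \<in> tangent_space A (\<gamma> t)"
  by (rule velocity_tangent[of I]) (auto simp: geodesic_def)

text \<open>Differentiating \<open>g\<^sub>c(a, b) = g\<^sub>d(J a, J b)\<close>, where \<open>J\<close> is the Jacobian of the transition map, produces second
  derivatives of the transition map. In the Koszul combination all of them but one cancel by their
  symmetry, and this one is the correction term of the transformation law.\<close>

lemma christoffel_transform:
  assumes c: "c \<in> A" and d: "d \<in> A" and p: "p \<in> cdom c" "p \<in> cdom d"
  shows "levi_civita (metric_coord A g d) (cmap d p) (jacobian c d p u) (jacobian c d p u) =
    jacobian c d p (levi_civita (metric_coord A g c) (cmap c p) u u) -
    frechet_derivative (\<lambda>y. frechet_derivative (transition c d) (at y) u) (at (cmap c p)) u"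
proof -
  interpret C: lorentzian_patch "cimage c" "metric_coord A g c" by (rule lorentzian_patch[OF c])
  interpret D: lorentzian_patch "cimage d" "metric_coord A g d" by (rule lorentzian_patch[OF d])
  define x y where "x = cmap c p" and "y = cmap d p"
  define J where "J = jacobian c d p"
  define H where "H a b = frechet_derivative (\<lambda>y. frechet_derivative (transition c d) (at y) a) (at x) b" for a b
  have x: "x \<in> overlap c d" unfolding x_def by (rule cmap_in_overlap[OF p])
  have xc: "x \<in> cimage c" and yd: "y \<in> cimage d" unfolding x_def y_def by (rule cmap_in_cimage[OF p(1)], rule cmap_in_cimage[OF p(2)])
  have \<tau>x: "transition c d x = y" unfolding x_def y_def by (rule transition_cmap[OF c p(1)])
  have H: "H a b = H b a" for a b
    unfolding H_def by (rule second_derivative_symmetric[OF smooth_transition[OF c d] open_overlap[OF c d] x])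
  have dG: "C.dG x z a b = D.dG y (J z) (J a) (J b) + metric_coord A g d y (H a z) (J b) + metric_coord A g d y (J a) (H b z)" for z a b
  proof -
    have line: "((\<lambda>s. x + s *\<^sub>R z) has_vector_derivative z) (at 0)"
      by (auto intro!: derivative_eq_intros simp: has_vector_derivative_def)
    have 1: "((\<lambda>s. transition c d (x + s *\<^sub>R z)) has_vector_derivative J z) (at 0)"
      using has_vector_derivative_compose[OF _ line, of "transition c d" J] jacobian_derivative[OF c d p]
      unfolding x_def J_def by simp
    have 2: "((\<lambda>s. frechet_derivative (transition c d) (at (x + s *\<^sub>R z)) a) has_vector_derivative H a z) (at 0)" for a
      using has_vector_derivative_compose[OF _ line, of "\<lambda>y. frechet_derivative (transition c d) (at y) a" "H a"]
        smooth_on_has_derivative[OF smooth_on_deriv[OF smooth_transition[OF c d]] x, of a]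
      unfolding H_def by simp
    have "((\<lambda>s. metric_coord A g d (transition c d (x + s *\<^sub>R z)) (frechet_derivative (transition c d) (at (x + s *\<^sub>R z)) a)
        (frechet_derivative (transition c d) (at (x + s *\<^sub>R z)) b)) has_vector_derivative
        D.dG y (J z) (J a) (J b) + metric_coord A g d y (H a z) (J b) + metric_coord A g d y (J a) (H b z)) (at 0)"
      using D.metric_vector_derivative[OF _ 1 2 2, of a b] \<tau>x yd unfolding J_def x_def by simp
    moreover have "open ((\<lambda>s::real. x + s *\<^sub>R z) -` overlap c d)"
      by (intro continuous_open_vimage open_overlap c d continuous_intros)
    moreover have "0 \<in> (\<lambda>s::real. x + s *\<^sub>R z) -` overlap c d" using x by simp
    ultimately have "((\<lambda>s. metric_coord A g c (x + s *\<^sub>R z) a b) has_vector_derivative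
        D.dG y (J z) (J a) (J b) + metric_coord A g d y (H a z) (J b) + metric_coord A g d y (J a) (H b z)) (at 0)"
    proof (rule has_vector_derivative_transform_within_open)
      fix s assume "s \<in> (\<lambda>s. x + s *\<^sub>R z) -` overlap c d"
      then obtain q where q: "q \<in> cdom c" "q \<in> cdom d" "x + s *\<^sub>R z = cmap c q"
        unfolding overlap_def by auto
      show "metric_coord A g d (transition c d (x + s *\<^sub>R z)) (frechet_derivative (transition c d) (at (x + s *\<^sub>R z)) a)
        (frechet_derivative (transition c d) (at (x + s *\<^sub>R z)) b) = metric_coord A g c (x + s *\<^sub>R z) a b"
        unfolding q(3) transition_cmap[OF c q(1)] by (rule metric_coord_transform[OF c d q(1,2)])
    qed
    moreover have "((\<lambda>s. metric_coord A g c (x + s *\<^sub>R z) a b) has_vector_derivative C.dG x z a b) (at 0)"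
      using has_vector_derivative_compose[OF _ line, of "\<lambda>y. metric_coord A g c y a b"]
        smooth_on_has_derivative[OF C.smooth xc, of a b] by simp
    ultimately show ?thesis using vector_derivative_unique_at by blast
  qed
  have lin: "linear J" unfolding J_def by (rule linear_jacobian[OF c d p])
  have "D.\<Gamma> y (J u) (J u) = J (C.\<Gamma> x u u) - H u u"
  proof (rule D.G_cancel[OF yd])
    fix w0
    \<comment> \<open>every test vector is of the form \<open>J w\<close>, since the Jacobian is invertible\<close>
    define w where "w = jacobian d c p w0"
    have w: "J w = w0"
      unfolding J_def w_def using jacobian_cocycle[OF d c d p(2,1,2)] jacobian_self[OF d p(2)] by simp
    have "metric_coord A g d y (J (C.\<Gamma> x u u)) (J w) = metric_coord A g c x (C.\<Gamma> x u u) w"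
      unfolding J_def x_def y_def by (rule metric_coord_transform[OF c d p])
    also have "\<dots> = C.dG x u u w - C.dG x w u u / 2"
      using C.levi_civita_koszul[OF xc, of u u w] by (simp add: field_simps)
    also have "\<dots> = metric_coord A g d y (D.\<Gamma> y (J u) (J u)) (J w) + metric_coord A g d y (H u u) (J w)"
      using D.levi_civita_koszul[OF yd, of "J u" "J u" "J w"] D.sym_G[OF yd, of "H u w" "J u"] H[of u w]
      unfolding dG by (simp add: field_simps)
    finally show "metric_coord A g d y (D.\<Gamma> y (J u) (J u)) w0 = metric_coord A g d y (J (C.\<Gamma> x u u) - H u u) w0"
      unfolding w[symmetric] by (simp add: linear_diff[OF D.linear_G1[OF yd]])
  qed
  then show ?thesis unfolding J_def x_def y_def H_def .
qed

text \<open>The correction term in the transformation law of the Christoffel symbols is the one that arises when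
  \<open>J v\<close>, the velocity in the other chart, is differentiated along the curve.\<close>

lemma geodesic_from_chart:
  assumes I: "open I" "is_interval I" "I \<noteq> {}" and c: "c \<in> A" and dom: "\<And>t. t \<in> I \<Longrightarrow> \<gamma> t \<in> cdom c"
    and x: "\<And>t. t \<in> I \<Longrightarrow> ((cmap c \<circ> \<gamma>) has_vector_derivative v t) (at t)"
    and v: "\<And>t. t \<in> I \<Longrightarrow> (v has_vector_derivative - levi_civita (metric_coord A g c) (cmap c (\<gamma> t)) (v t) (v t)) (at t)"
  shows "geodesic A g \<gamma> I"
  unfolding geodesic_def
proof (intro conjI I ballI impI)
  have "continuous_on I (cmap c \<circ> \<gamma>)"
    using x has_vector_derivative_continuous by (blast intro: continuous_at_imp_continuous_on)
  then have "continuous_on I (\<lambda>t. cinv c ((cmap c \<circ> \<gamma>) t))"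
    by (rule continuous_on_compose2[OF continuous_on_cinv[OF c]]) (simp add: image_subset_iff dom cmap_in_cimage)
  then show cont: "continuous_on I \<gamma>"
    by (rule continuous_on_eq) (simp add: cinv_cmap c dom)
  fix d t assume d: "d \<in> A" and t: "t \<in> I" and td: "\<gamma> t \<in> cdom d"
  define S where "S = {s \<in> I. \<gamma> s \<in> cdom d}"
  have S: "open S" "t \<in> S" unfolding S_def using curve_in_chart[OF d I(1) cont] t td by auto
  have y: "((cmap d \<circ> \<gamma>) has_vector_derivative jacobian c d (\<gamma> s) (v s)) (at s)" if "s \<in> S" for s
    by (rule curve_transition[OF c d S(1) that]) (use that dom x in \<open>auto simp: S_def\<close>)
  show "(cmap d \<circ> \<gamma>) differentiable (at t)"
    using y[OF S(2)] by (rule differentiableI_vector)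
  have vel: "velocity A \<gamma> t d = jacobian c d (\<gamma> t) (v t)"
    unfolding velocity_def using d td vector_derivative_at[OF y[OF S(2)]] by simp
  interpret D: lorentzian_patch "cimage d" "metric_coord A g d" by (rule lorentzian_patch[OF d])
  have "((\<lambda>s. frechet_derivative (transition c d) (at ((cmap c \<circ> \<gamma>) s)) (v s)) has_vector_derivative
      frechet_derivative (\<lambda>y. frechet_derivative (transition c d) (at y) (v t)) (at ((cmap c \<circ> \<gamma>) t)) (v t) +
      frechet_derivative (transition c d) (at ((cmap c \<circ> \<gamma>) t))
        (- levi_civita (metric_coord A g c) (cmap c (\<gamma> t)) (v t) (v t))) (at t)"
  proof (rule linear_family_vector_derivative[OF open_overlap[OF c d] _ _ _ x[OF t] v[OF t]])
    show "(cmap c \<circ> \<gamma>) t \<in> overlap c d" using cmap_in_overlap dom t td by simp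
    show "linear (frechet_derivative (transition c d) (at y))" if "y \<in> overlap c d" for y
      by (rule smooth_on_deriv_linear[OF smooth_transition[OF c d] that])
    show "smooth_on (overlap c d) (\<lambda>y. frechet_derivative (transition c d) (at y) u)" for u
      by (rule smooth_on_deriv[OF smooth_transition[OF c d]])
  qed
  then have "((\<lambda>s. jacobian c d (\<gamma> s) (v s)) has_vector_derivative
      - levi_civita (metric_coord A g d) (cmap d (\<gamma> t)) (velocity A \<gamma> t d) (velocity A \<gamma> t d)) (at t)"
    unfolding vel christoffel_transform[OF c d dom[OF t] td]
    using linear_neg[OF linear_jacobian[OF c d dom[OF t] td]] by simp
  then show "((\<lambda>s. vector_derivative (cmap d \<circ> \<gamma>) (at s)) has_vector_derivative
      - christoffel A g d (cmap d (\<gamma> t)) (velocity A \<gamma> t d) (velocity A \<gamma> t d)) (at t)"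
    unfolding christoffel_eq_levi_civita
    by (rule has_vector_derivative_transform_within_open[OF _ S]) (simp add: vector_derivative_at[OF y])
qed

lemma vector_derivative_cong_open:
  assumes "open S" "t \<in> S" "\<And>s. s \<in> S \<Longrightarrow> f s = h s"
  shows "vector_derivative f (at t) = vector_derivative h (at t)"
proof -
  have "(f has_vector_derivative D) (at t) \<longleftrightarrow> (h has_vector_derivative D) (at t)" for D
    using has_vector_derivative_transform_within_open[OF _ assms(1,2)] assms(3) by metis
  then show ?thesis unfolding vector_derivative_def by simp
qed

lemma velocity_cong:
  assumes "open S" "t \<in> S" "\<And>s. s \<in> S \<Longrightarrow> \<gamma> s = \<sigma> s"
  shows "velocity A \<gamma> t = velocity A \<sigma> t"
proof -
  have "vector_derivative (cmap c \<circ> \<gamma>) (at t) = vector_derivative (cmap c \<circ> \<sigma>) (at t)" for c :: "('m, 'e) chart"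
    by (rule vector_derivative_cong_open[OF assms(1,2)]) (simp add: assms(3))
  then show ?thesis unfolding velocity_def using assms(2,3) by auto
qed

text \<open>Locality is what allows one to glue geodesics and to take unions of increasing families.\<close>

lemma geodesic_local:
  assumes I: "open I" "is_interval I" "I \<noteq> {}"
    and loc: "\<And>t. t \<in> I \<Longrightarrow> \<exists>\<sigma> K. geodesic A g \<sigma> K \<and> t \<in> K \<and> (\<forall>s\<in>K. \<gamma> s = \<sigma> s)"
  shows "geodesic A g \<gamma> I"
  unfolding geodesic_def
proof (intro conjI I ballI impI)
  show "continuous_on I \<gamma>"
  proof (rule continuous_at_imp_continuous_on, rule ballI)
    fix t assume "t \<in> I"
    then obtain \<sigma> K where K: "geodesic A g \<sigma> K" "t \<in> K" "\<And>s. s \<in> K \<Longrightarrow> \<gamma> s = \<sigma> s" using loc by blast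
    then have "continuous_on K \<gamma>" using geodesicD(4)[OF K(1)] continuous_on_eq by metis
    then show "isCont \<gamma> t" using geodesicD(1)[OF K(1)] K(2) continuous_on_eq_continuous_at by blast
  qed
  fix c t assume c: "c \<in> A" and t: "t \<in> I" and tc: "\<gamma> t \<in> cdom c"
  obtain \<sigma> K where K: "geodesic A g \<sigma> K" "t \<in> K" "\<And>s. s \<in> K \<Longrightarrow> \<gamma> s = \<sigma> s" using loc[OF t] by blast
  note S = geodesicD(1)[OF K(1)] K(2)
  have \<sigma>t: "\<sigma> t \<in> cdom c" using tc K(3)[OF K(2)] by simp
  have vd: "vector_derivative (cmap c \<circ> \<gamma>) (at s) = vector_derivative (cmap c \<circ> \<sigma>) (at s)" if "s \<in> K" for s
    by (rule vector_derivative_cong_open[OF S(1) that]) (simp add: K(3))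
  have "((cmap c \<circ> \<gamma>) has_vector_derivative vector_derivative (cmap c \<circ> \<sigma>) (at t)) (at t)"
    by (rule has_vector_derivative_transform_within_open[OF geodesic_equation(1)[OF K(1) c K(2) \<sigma>t] S])
      (simp add: K(3))
  then show "(cmap c \<circ> \<gamma>) differentiable (at t)" by (rule differentiableI_vector)
  have "((\<lambda>s. vector_derivative (cmap c \<circ> \<sigma>) (at s)) has_vector_derivative
      - christoffel A g c (cmap c (\<sigma> t)) (velocity A \<sigma> t c) (velocity A \<sigma> t c)) (at t)"
    using K(1) c K(2) \<sigma>t unfolding geodesic_def by blast
  moreover have "velocity A \<sigma> t = velocity A \<gamma> t"
    by (rule velocity_cong[OF S K(3), symmetric])
  ultimately have "((\<lambda>s. vector_derivative (cmap c \<circ> \<sigma>) (at s)) has_vector_derivative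
      - christoffel A g c (cmap c (\<gamma> t)) (velocity A \<gamma> t c) (velocity A \<gamma> t c)) (at t)"
    using K(3)[OF K(2)] by metis
  then show "((\<lambda>s. vector_derivative (cmap c \<circ> \<gamma>) (at s)) has_vector_derivative
      - christoffel A g c (cmap c (\<gamma> t)) (velocity A \<gamma> t c) (velocity A \<gamma> t c)) (at t)"
    by (rule has_vector_derivative_transform_within_open[OF _ S]) (simp add: vd)
qed

text \<open>The geodesic equation is quadratic in the velocity, so it is invariant under reversal of time.\<close>

lemma geodesic_reflect:
  assumes \<gamma>: "geodesic A g \<gamma> I"
  shows "geodesic A g (\<lambda>t. \<gamma> (- t)) (uminus ` I)"
    "t \<in> I \<Longrightarrow> c \<in> A \<Longrightarrow> \<gamma> t \<in> cdom c \<Longrightarrow> velocity A (\<lambda>t. \<gamma> (- t)) (- t) c = - velocity A \<gamma> t c"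
proof -
  have fst: "((cmap c \<circ> (\<lambda>t. \<gamma> (- t))) has_vector_derivative - vector_derivative (cmap c \<circ> \<gamma>) (at (- t))) (at t)"
    if "c \<in> A" "- t \<in> I" "\<gamma> (- t) \<in> cdom c" for c t
  proof -
    have "((\<lambda>t::real. - t) has_vector_derivative - 1) (at t)"
      by (auto intro!: derivative_eq_intros simp: has_vector_derivative_def)
    from vector_diff_chain_at[OF this geodesic_equation(1)[OF \<gamma> that]]
    show ?thesis by (simp add: o_def)
  qed
  show "velocity A (\<lambda>t. \<gamma> (- t)) (- t) c = - velocity A \<gamma> t c" if "t \<in> I" "c \<in> A" "\<gamma> t \<in> cdom c"
    using vector_derivative_at[OF fst[of c "- t"]] that by (simp add: velocity_def)
  have mem: "t \<in> uminus ` I \<longleftrightarrow> - t \<in> I" for t by force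
  have open': "open (uminus ` I)" by (rule open_negations[OF geodesicD(1)[OF \<gamma>]])
  have cont: "continuous_on (uminus ` I) (\<lambda>t. \<gamma> (- t))"
    by (rule continuous_on_compose2[OF geodesicD(4)[OF \<gamma>]]) (auto intro!: continuous_intros)
  show "geodesic A g (\<lambda>t. \<gamma> (- t)) (uminus ` I)"
    unfolding geodesic_def
  proof (intro conjI ballI impI open' cont)
    show "is_interval (uminus ` I)"
      using geodesicD(2)[OF \<gamma>] by (simp add: is_interval_neg_translationI)
    show "uminus ` I \<noteq> {}" using geodesicD(3)[OF \<gamma>] by simp
    fix c t assume c: "c \<in> A" and t: "t \<in> uminus ` I" and tc: "\<gamma> (- t) \<in> cdom c"
    have t': "- t \<in> I" using t mem by simp
    show "(cmap c \<circ> (\<lambda>t. \<gamma> (- t))) differentiable (at t)"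
      using fst[OF c t' tc] by (rule differentiableI_vector)
    define S where "S = {s \<in> uminus ` I. \<gamma> (- s) \<in> cdom c}"
    have S: "open S" "t \<in> S" unfolding S_def using curve_in_chart[OF c open' cont] t tc by auto
    interpret C: lorentzian_patch "cimage c" "metric_coord A g c" by (rule lorentzian_patch[OF c])
    define u where "u = vector_derivative (cmap c \<circ> \<gamma>) (at (- t))"
    have vel: "velocity A (\<lambda>t. \<gamma> (- t)) t c = - u"
      unfolding velocity_def u_def using c tc vector_derivative_at[OF fst[OF c t' tc]] by simp
    have bil: "bilinear (C.\<Gamma> (cmap c (\<gamma> (- t))))"
      by (rule C.bilinear_levi_civita[OF cmap_in_cimage[OF tc]])
    have neg: "((\<lambda>t::real. - t) has_vector_derivative - 1) (at t)"
      by (auto intro!: derivative_eq_intros simp: has_vector_derivative_def)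
    from vector_diff_chain_at[OF neg geodesic_equation(2)[OF \<gamma> c t' tc]]
    have "((\<lambda>s. vector_derivative (cmap c \<circ> \<gamma>) (at (- s))) has_vector_derivative
        C.\<Gamma> (cmap c (\<gamma> (- t))) u u) (at t)" by (simp add: o_def u_def)
    then have "((\<lambda>s. - vector_derivative (cmap c \<circ> \<gamma>) (at (- s))) has_vector_derivative
        - C.\<Gamma> (cmap c (\<gamma> (- t))) (- u) (- u)) (at t)"
      using bilinear_lneg[OF bil] bilinear_rneg[OF bil] by (intro derivative_eq_intros) auto
    then show "((\<lambda>s. vector_derivative (cmap c \<circ> (\<lambda>t. \<gamma> (- t))) (at s)) has_vector_derivative
        - christoffel A g c (cmap c (\<gamma> (- t))) (velocity A (\<lambda>t. \<gamma> (- t)) t c) (velocity A (\<lambda>t. \<gamma> (- t)) t c)) (at t)"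
      unfolding vel christoffel_eq_levi_civita
      by (rule has_vector_derivative_transform_within_open[OF _ S])
        (use c mem in \<open>auto simp: S_def vector_derivative_at[OF fst]\<close>)
  qed
qed

end

section \<open>Weighted means\<close>

text \<open>Differentiating the mean gives the sum of \<open>\<rho>\<^sub>p' (a\<^sub>p - m) + \<rho>\<^sub>p a\<^sub>p'\<close> divided by the total weight. The derivatives of
  the weights may grow like the coefficients themselves, but they meet only differences \<open>a\<^sub>p - m\<close>, which
  are bounded because the active coefficients are close to each other. An index is active when the
  curve is in the closed ball on which its coefficient makes sense.\<close>

lemma weighted_mean_growth:
  fixes a \<rho> :: "'p \<Rightarrow> real \<Rightarrow> real" and F :: "'p set"
  defines "m \<equiv> \<lambda>s. (\<Sum>p\<in>F. \<rho> p s * a p s) / (\<Sum>p\<in>F. \<rho> p s)"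
  assumes "C \<ge> 0"
    and act: "\<And>p. p \<in> F \<Longrightarrow> act p \<Longrightarrow> \<exists>r' a'. (\<rho> p has_real_derivative r') (at t) \<and>
      (a p has_real_derivative a') (at t) \<and> \<bar>r'\<bar> \<le> C * (1 + \<bar>a p t\<bar>) \<and> \<bar>a'\<bar> \<le> C * (1 + \<bar>a p t\<bar>) \<and>
      0 \<le> \<rho> p t \<and> \<rho> p t \<le> 1"
    and inact: "\<And>p. p \<in> F \<Longrightarrow> \<not> act p \<Longrightarrow> \<exists>S. open S \<and> t \<in> S \<and> (\<forall>s\<in>S. \<rho> p s = 0)"
    and close: "\<And>p q. p \<in> F \<Longrightarrow> q \<in> F \<Longrightarrow> act p \<Longrightarrow> act q \<Longrightarrow> \<bar>a p t - a q t\<bar> \<le> C"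
    and total: "(\<Sum>p\<in>F. \<rho> p t) \<ge> 1 / 2"
  shows "\<exists>d. (m has_real_derivative d) (at t) \<and> \<bar>d\<bar> \<le> (2 * real (card F) * (C * (1 + C) * (1 + C))) * (1 + \<bar>m t\<bar>)"
    and "\<And>p. p \<in> F \<Longrightarrow> act p \<Longrightarrow> \<bar>a p t - m t\<bar> \<le> C"
proof -
  let ?ok = "\<lambda>p q. (\<rho> p has_real_derivative fst q) (at t) \<and> (a p has_real_derivative snd q) (at t) \<and>
      \<bar>fst q\<bar> \<le> C * (1 + \<bar>a p t\<bar>) \<and> \<bar>snd q\<bar> \<le> C * (1 + \<bar>a p t\<bar>) \<and> 0 \<le> \<rho> p t \<and> \<rho> p t \<le> 1"
  have "\<exists>q. ?ok p q" if "p \<in> {p \<in> F. act p}" for p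
    using act[of p] that by auto
  then obtain q where q: "\<forall>p\<in>{p \<in> F. act p}. ?ok p (q p)"
    using bchoice[of "{p \<in> F. act p}" ?ok] by blast
  define r' a' where "r' p = fst (q p)" and "a' p = snd (q p)" for p
  have der: "\<And>p. p \<in> F \<Longrightarrow> act p \<Longrightarrow> (\<rho> p has_real_derivative r' p) (at t)"
      "\<And>p. p \<in> F \<Longrightarrow> act p \<Longrightarrow> (a p has_real_derivative a' p) (at t)"
    and bd: "\<And>p. p \<in> F \<Longrightarrow> act p \<Longrightarrow> \<bar>r' p\<bar> \<le> C * (1 + \<bar>a p t\<bar>)"
      "\<And>p. p \<in> F \<Longrightarrow> act p \<Longrightarrow> \<bar>a' p\<bar> \<le> C * (1 + \<bar>a p t\<bar>)"
    and \<rho>: "\<And>p. p \<in> F \<Longrightarrow> act p \<Longrightarrow> 0 \<le> \<rho> p t" "\<And>p. p \<in> F \<Longrightarrow> act p \<Longrightarrow> \<rho> p t \<le> 1"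
    using q unfolding r'_def a'_def by blast+
  have \<rho>0: "\<rho> p t = 0" if "p \<in> F" "\<not> act p" for p using inact[OF that] by blast
  have \<rho>pos: "0 \<le> \<rho> p t" if "p \<in> F" for p using \<rho>(1)[OF that] \<rho>0[OF that] by fastforce
  define P where "P = (\<Sum>p\<in>F. \<rho> p t)"
  define N where "N = (\<Sum>p\<in>F. \<rho> p t * a p t)"
  have P: "P \<ge> 1 / 2" unfolding P_def by (rule total)
  have mt: "m t = N / P" unfolding m_def N_def P_def ..
  show near: "\<bar>a p t - m t\<bar> \<le> C" if p: "p \<in> F" "act p" for p
  proof -
    have "(a p t - m t) * P = (\<Sum>q\<in>F. \<rho> q t * (a p t - a q t))"
      using P unfolding mt by (simp add: left_diff_distrib)
        (simp add: P_def N_def sum_distrib_left sum_subtractf right_diff_distrib mult.commute)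
    also have "\<bar>\<dots>\<bar> \<le> (\<Sum>q\<in>F. \<rho> q t * C)"
    proof (rule order_trans[OF sum_abs], rule sum_mono)
      fix q assume q: "q \<in> F"
      show "\<bar>\<rho> q t * (a p t - a q t)\<bar> \<le> \<rho> q t * C"
      proof (cases "act q")
        case True
        then show ?thesis using close[OF p(1) q p(2)] \<rho>pos[OF q] by (simp add: abs_mult mult_left_mono)
      qed (simp add: \<rho>0[OF q])
    qed
    also have "\<dots> = C * P" unfolding P_def by (simp add: sum_distrib_left mult.commute)
    finally show ?thesis using P by (simp add: abs_mult)
  qed
  define R where "R p = (if act p then r' p else 0)" for p
  define B where "B p = (if act p then r' p * a p t + a' p * \<rho> p t else 0)" for p
  have zero: "(f has_real_derivative 0) (at t)" if "open S" "t \<in> S" "\<And>s. s \<in> S \<Longrightarrow> f s = 0" for f :: "real \<Rightarrow> real" and S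
    using has_field_derivative_transform_within_open[OF DERIV_const[of 0] that(1,2)] that(3) by simp
  have R: "(\<rho> p has_real_derivative R p) (at t)" if "p \<in> F" for p
  proof (cases "act p")
    case False
    then show ?thesis using inact[OF that False] zero[of _ "\<rho> p"] unfolding R_def by auto
  qed (use der that R_def in auto)
  have B: "((\<lambda>s. \<rho> p s * a p s) has_real_derivative B p) (at t)" if "p \<in> F" for p
  proof (cases "act p")
    case True
    then show ?thesis unfolding B_def using DERIV_mult[OF der(1)[OF that True] der(2)[OF that True]] by simp
  next
    case False
    then show ?thesis using inact[OF that False] zero[of _ "\<lambda>s. \<rho> p s * a p s"] unfolding B_def by auto
  qed
  define d where "d = ((\<Sum>p\<in>F. B p) * P - N * (\<Sum>p\<in>F. R p)) / (P * P)"
  have md: "(m has_real_derivative d) (at t)"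
    unfolding m_def d_def P_def N_def
    by (intro DERIV_divide DERIV_sum R B) (use P P_def in auto)
  have "d = (\<Sum>p\<in>F. B p - m t * R p) / P"
  proof -
    have "(\<Sum>p\<in>F. B p - m t * R p) = (\<Sum>p\<in>F. B p) - N / P * (\<Sum>p\<in>F. R p)"
      unfolding mt by (simp add: sum_subtractf sum_distrib_left)
    moreover have "((\<Sum>p\<in>F. B p) * P - N * (\<Sum>p\<in>F. R p)) / (P * P) = ((\<Sum>p\<in>F. B p) - N / P * (\<Sum>p\<in>F. R p)) / P"
      using P by (simp add: divide_simps)
    ultimately show ?thesis unfolding d_def by simp
  qed
  moreover have "\<bar>\<Sum>p\<in>F. B p - m t * R p\<bar> \<le> (\<Sum>p\<in>F. C * (1 + C) * (1 + C) * (1 + \<bar>m t\<bar>))"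
  proof (rule order_trans[OF sum_abs], rule sum_mono)
    fix p assume p: "p \<in> F"
    show "\<bar>B p - m t * R p\<bar> \<le> C * (1 + C) * (1 + C) * (1 + \<bar>m t\<bar>)"
    proof (cases "act p")
      case True
      have am: "\<bar>a p t - m t\<bar> \<le> C" by (rule near[OF p True])
      have "B p - m t * R p = r' p * (a p t - m t) + a' p * \<rho> p t"
        unfolding B_def R_def using True by (simp add: algebra_simps)
      then have "\<bar>B p - m t * R p\<bar> \<le> \<bar>r' p\<bar> * \<bar>a p t - m t\<bar> + \<bar>a' p\<bar> * \<rho> p t"
        using abs_triangle_ineq[of "r' p * (a p t - m t)" "a' p * \<rho> p t"] \<rho>pos[OF p] by (simp add: abs_mult)
      also have "\<dots> \<le> (C * (1 + \<bar>a p t\<bar>)) * C + (C * (1 + \<bar>a p t\<bar>)) * 1"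
        using bd[OF p True] am \<rho>[OF p True] assms(2) by (intro add_mono mult_mono) auto
      also have "\<dots> = (C * (1 + C)) * (1 + \<bar>a p t\<bar>)" by (simp add: algebra_simps)
      also have "\<dots> \<le> (C * (1 + C)) * ((1 + C) * (1 + \<bar>m t\<bar>))"
      proof (rule mult_left_mono)
        have "\<bar>a p t\<bar> \<le> C + \<bar>m t\<bar>" using am by linarith
        moreover have "0 \<le> C * \<bar>m t\<bar>" using assms(2) by simp
        ultimately show "1 + \<bar>a p t\<bar> \<le> (1 + C) * (1 + \<bar>m t\<bar>)" by (simp add: algebra_simps)
      qed (use assms(2) in simp)
      finally show ?thesis by (simp add: mult_ac)
    qed (use assms(2) in \<open>simp add: B_def R_def\<close>)
  qed
  ultimately have "\<bar>d\<bar> \<le> (\<Sum>p\<in>F. C * (1 + C) * (1 + C) * (1 + \<bar>m t\<bar>)) / (1 / 2)"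
    using P by (simp only: abs_divide) (intro frac_le, auto)
  also have "\<dots> = (2 * real (card F) * (C * (1 + C) * (1 + C))) * (1 + \<bar>m t\<bar>)" by simp
  finally show "\<exists>d. (m has_real_derivative d) (at t) \<and> \<bar>d\<bar> \<le> (2 * real (card F) * (C * (1 + C) * (1 + C))) * (1 + \<bar>m t\<bar>)"
    using md by blast
qed

text \<open>Squaring the positive part makes this cut-off function once continuously differentiable, as the
  estimate of the derivative of a weighted mean requires.\<close>

definition bump :: "'e::euclidean_space \<Rightarrow> real \<Rightarrow> 'e \<Rightarrow> real" where
  "bump x0 r x = (max 0 (1 - (norm (x - x0) / r)\<^sup>2))\<^sup>2"

lemma bump_nonneg: "0 \<le> bump x0 r x" by (simp add: bump_def)

lemma bump_le_1: "bump x0 r x \<le> 1"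
  unfolding bump_def by (intro power_le_one) auto

lemma bump_outside: "r > 0 \<Longrightarrow> x \<notin> cball x0 r \<Longrightarrow> bump x0 r x = 0"
  unfolding bump_def by (simp add: dist_norm norm_minus_commute)

lemma bump_inside:
  assumes "r > 0" "x \<in> ball x0 (r / 2)" shows "bump x0 r x \<ge> 1 / 2"
proof -
  have "norm (x - x0) / r \<le> 1 / 2"
    using assms by (simp add: dist_norm norm_minus_commute field_simps)
  then have "(norm (x - x0) / r)\<^sup>2 \<le> (1 / 2)\<^sup>2"
    using assms by (intro power_mono) auto
  then have "(norm (x - x0) / r)\<^sup>2 \<le> 1 / 4" by (simp add: power_one_over)
  then have "3 / 4 \<le> max 0 (1 - (norm (x - x0) / r)\<^sup>2)" by (subst le_max_iff_disj) linarith
  then have "(3 / 4)\<^sup>2 \<le> bump x0 r x" unfolding bump_def by (rule power_mono) simp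
  then show ?thesis by (simp add: power2_eq_square)
qed

lemma bump_derivative:
  fixes x :: "real \<Rightarrow> 'e::euclidean_space"
  assumes "r > 0" "x t \<in> cball x0 r" and x: "(x has_vector_derivative v) (at t)"
  shows "\<exists>d. ((\<lambda>s. bump x0 r (x s)) has_real_derivative d) (at t) \<and> \<bar>d\<bar> \<le> 4 / r * norm v"
proof -
  define \<beta> where "\<beta> s = (max 0 (1 - s))\<^sup>2" for s :: real
  define \<beta>' where "\<beta>' s = - 2 * max 0 (1 - s)" for s :: real
  \<comment> \<open>at the corner \<open>s = 1\<close> of the positive part the derivative exists because it extends continuously\<close>
  have \<beta>: "(\<beta> has_real_derivative \<beta>' s) (at s)" for s
  proof -
    have far: "(\<beta> has_real_derivative \<beta>' s) (at s)" if "s \<noteq> 1" for s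
    proof (cases "s < 1")
      case True
      have "((\<lambda>s::real. (1 - s)\<^sup>2) has_real_derivative \<beta>' s) (at s)"
        unfolding \<beta>'_def using True by (auto intro!: derivative_eq_intros)
      then show ?thesis
        by (rule has_field_derivative_transform_within_open[where S="{..<1}"]) (use True in \<open>auto simp: \<beta>_def\<close>)
    next
      case False
      have "((\<lambda>s::real. 0) has_real_derivative \<beta>' s) (at s)"
        unfolding \<beta>'_def using False by (auto intro!: derivative_eq_intros)
      then show ?thesis
        by (rule has_field_derivative_transform_within_open[where S="{1<..}"]) (use False that in \<open>auto simp: \<beta>_def\<close>)
    qed
    show ?thesis
    proof (cases "s = 1")
      case True
      have "isCont \<beta>' 1" unfolding \<beta>'_def by (intro continuous_intros)
      moreover have "continuous_on {0<..<2} \<beta>" unfolding \<beta>_def by (intro continuous_intros)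
      ultimately have "(\<beta> has_vector_derivative \<beta>' 1) (at 1)"
        using far by (intro has_vector_derivative_removable[of 0 1 2])
          (auto simp: has_real_derivative_iff_has_vector_derivative)
      then show ?thesis using True by (simp add: has_real_derivative_iff_has_vector_derivative)
    qed (rule far)
  qed
  define q where "q s = ((x s - x0) \<bullet> (x s - x0)) / r\<^sup>2" for s
  have "((\<lambda>s. x s - x0) has_vector_derivative v) (at t)"
    using has_vector_derivative_diff[OF x has_vector_derivative_const[of x0]] by simp
  note has_derivative_inner[OF this[unfolded has_vector_derivative_def] this[unfolded has_vector_derivative_def]]
  then have "((\<lambda>s. (x s - x0) \<bullet> (x s - x0)) has_real_derivative 2 * ((x t - x0) \<bullet> v)) (at t)"
    unfolding has_field_derivative_def
    by (rule has_derivative_eq_rhs) (auto simp: fun_eq_iff inner_commute algebra_simps)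
  then have q: "(q has_real_derivative 2 * ((x t - x0) \<bullet> v) / r\<^sup>2) (at t)"
    unfolding q_def by (rule DERIV_cdivide)
  have "((\<lambda>s. \<beta> (q s)) has_real_derivative \<beta>' (q t) * (2 * ((x t - x0) \<bullet> v) / r\<^sup>2)) (at t)"
    by (rule DERIV_chain2[OF \<beta> q])
  moreover have "(\<lambda>s. \<beta> (q s)) = (\<lambda>s. bump x0 r (x s))"
    by (simp add: \<beta>_def q_def bump_def power_divide power2_norm_eq_inner)
  moreover have "\<bar>\<beta>' (q t) * (2 * ((x t - x0) \<bullet> v) / r\<^sup>2)\<bar> \<le> 4 / r * norm v"
  proof -
    have "q t \<ge> 0" unfolding q_def by simp
    then have "\<bar>\<beta>' (q t)\<bar> \<le> 2" unfolding \<beta>'_def by auto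
    moreover have "\<bar>(x t - x0) \<bullet> v\<bar> \<le> r * norm v"
      by (rule order_trans[OF Cauchy_Schwarz_ineq2])
        (use assms(2) in \<open>auto intro!: mult_right_mono simp: dist_norm norm_minus_commute\<close>)
    ultimately have "\<bar>\<beta>' (q t)\<bar> * (2 * \<bar>(x t - x0) \<bullet> v\<bar> / r\<^sup>2) \<le> 2 * (2 * (r * norm v) / r\<^sup>2)"
      by (intro mult_mono divide_right_mono mult_left_mono) auto
    also have "\<dots> = 4 / r * norm v" using assms(1) by (simp add: power2_eq_square field_simps)
    finally show ?thesis by (simp add: abs_mult abs_divide)
  qed
  ultimately show ?thesis by auto
qed

section \<open>Geodesics orthogonal to a null Killing field\<close>

locale null_killing_manifold = lorentzian_manifold A g
  for A :: "('m::{t2_space, second_countable_topology}, 'e::euclidean_space) chart set"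
    and g :: "('m, 'e) metric" +
  fixes V :: "'m \<Rightarrow> ('m, 'e) tvec"
  assumes compact_manifold: "compact (UNIV :: 'm set)"
    and null_killing: "null_killing_field A g V"
begin

lemma V_tangent: "V p \<in> tangent_space A p"
  using null_killing unfolding null_killing_field_def killing_field_def smooth_vector_field_def by blast

lemma vf_coord_cmap: "c \<in> A \<Longrightarrow> p \<in> cdom c \<Longrightarrow> vf_coord V c (cmap c p) = V p c"
  by (simp add: vf_coord_def cinv_cmap)

lemma null_killing_patch:
  assumes c: "c \<in> A"
  shows "null_killing_patch (cimage c) (metric_coord A g c) (vf_coord V c)"
  unfolding null_killing_patch_def null_killing_patch_axioms_def
proof (intro conjI allI impI lorentzian_patch[OF c])
  show "smooth_on (cimage c) (vf_coord V c)"
    using null_killing c unfolding null_killing_field_def killing_field_def smooth_vector_field_def by blast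
  fix x assume x: "x \<in> cimage c"
  define p where "p = cinv c x"
  have p: "p \<in> cdom c" "x = cmap c p" unfolding p_def using cinv_in_cdom[OF c x] cmap_cinv[OF c x] by auto
  show "frechet_derivative (\<lambda>y. metric_coord A g c y u w) (at x) (vf_coord V c x)
      + metric_coord A g c x (frechet_derivative (vf_coord V c) (at x) u) w
      + metric_coord A g c x u (frechet_derivative (vf_coord V c) (at x) w) = 0" for u w
    using null_killing c x unfolding null_killing_field_def killing_field_def lie_metric_def by blast
  show "metric_coord A g c x (vf_coord V c x) (vf_coord V c x) = 0"
    using null_killing metric_coord_eq[OF V_tangent V_tangent c p(1), of g]
    unfolding p(2) vf_coord_cmap[OF c p(1)] null_killing_field_def by simp
  show "vf_coord V c x \<noteq> 0"
  proof
    assume "vf_coord V c x = 0"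
    then have "V p c = 0" unfolding p(2) vf_coord_cmap[OF c p(1)] .
    then have "V p = (\<lambda>d. 0)"
      using tangent_vector_eq_tvec_of[OF V_tangent c p(1)] linear_0[OF linear_jacobian[OF c _ p(1)]]
      unfolding tvec_of_def by (auto simp: fun_eq_iff split: if_splits)
    then show False using null_killing unfolding null_killing_field_def by blast
  qed
qed

text \<open>Energy and Clairaut's integral are defined without coordinates, so that the vanishing of their
  derivatives, computed in a chart around each point, makes them constant on the whole interval.\<close>

lemma geodesic_conserved:
  assumes \<gamma>: "geodesic A g \<gamma> I"
  obtains E k where "\<And>t. t \<in> I \<Longrightarrow> g (\<gamma> t) (velocity A \<gamma> t) (velocity A \<gamma> t) = E"
    "\<And>t. t \<in> I \<Longrightarrow> g (\<gamma> t) (V (\<gamma> t)) (velocity A \<gamma> t) = k"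
proof -
  have "((\<lambda>t. g (\<gamma> t) (velocity A \<gamma> t) (velocity A \<gamma> t)) has_vector_derivative 0) (at t) \<and>
      ((\<lambda>t. g (\<gamma> t) (V (\<gamma> t)) (velocity A \<gamma> t)) has_vector_derivative 0) (at t)" if t: "t \<in> I" for t
  proof -
    obtain c where c: "c \<in> A" and tc: "\<gamma> t \<in> cdom c" by (rule chart_at)
    interpret C: null_killing_patch "cimage c" "metric_coord A g c" "vf_coord V c" by (rule null_killing_patch[OF c])
    define x where "x = cmap c \<circ> \<gamma>"
    define v where "v s = vector_derivative x (at s)" for s
    define S where "S = {s \<in> I. \<gamma> s \<in> cdom c}"
    have S: "open S" "t \<in> S"
      unfolding S_def using curve_in_chart[OF c geodesicD(1,4)[OF \<gamma>]] t tc by auto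
    have x: "(x has_vector_derivative v t) (at t)" and v: "(v has_vector_derivative - C.\<Gamma> (x t) (v t) (v t)) (at t)"
      using geodesic_equation[OF \<gamma> c t tc] unfolding x_def v_def by (auto simp: o_def)
    have xt: "x t \<in> cimage c" unfolding x_def using cmap_in_cimage[OF tc] by simp
    have vel: "velocity A \<gamma> s c = v s" if "s \<in> S" for s
      using that c unfolding velocity_def v_def x_def S_def by simp
    have tan: "velocity A \<gamma> s \<in> tangent_space A (\<gamma> s)" if "s \<in> S" for s
      using geodesic_velocity_tangent[OF \<gamma>] that unfolding S_def by blast
    have energy: "metric_coord A g c (x s) (v s) (v s) = g (\<gamma> s) (velocity A \<gamma> s) (velocity A \<gamma> s)"
      and clairaut: "metric_coord A g c (x s) (vf_coord V c (x s)) (v s) = g (\<gamma> s) (V (\<gamma> s)) (velocity A \<gamma> s)" if "s \<in> S" for s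
    proof -
      have s: "\<gamma> s \<in> cdom c" using that unfolding S_def by simp
      show "metric_coord A g c (x s) (v s) (v s) = g (\<gamma> s) (velocity A \<gamma> s) (velocity A \<gamma> s)"
        using metric_coord_eq[OF tan[OF that] tan[OF that] c s, of g] unfolding vel[OF that] by (simp add: x_def)
      show "metric_coord A g c (x s) (vf_coord V c (x s)) (v s) = g (\<gamma> s) (V (\<gamma> s)) (velocity A \<gamma> s)"
        using metric_coord_eq[OF V_tangent tan[OF that] c s, of g] unfolding vel[OF that]
        by (simp add: x_def vf_coord_cmap[OF c s])
    qed
    show ?thesis
      by (rule conjI; rule has_vector_derivative_transform_within_open[OF C.energy_derivative[OF xt x v] S energy]
          has_vector_derivative_transform_within_open[OF C.clairaut_derivative[OF xt x v] S clairaut])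
  qed
  then have der: "((\<lambda>t. g (\<gamma> t) (velocity A \<gamma> t) (velocity A \<gamma> t)) has_vector_derivative 0) (at t within I)"
      "((\<lambda>t. g (\<gamma> t) (V (\<gamma> t)) (velocity A \<gamma> t)) has_vector_derivative 0) (at t within I)" if "t \<in> I" for t
    using that has_vector_derivative_at_within by blast+
  have "convex I" using geodesicD(2)[OF \<gamma>] by (simp add: is_interval_convex)
  obtain E where "\<And>t. t \<in> I \<Longrightarrow> g (\<gamma> t) (velocity A \<gamma> t) (velocity A \<gamma> t) = E"
    using has_vector_derivative_zero_constant[OF \<open>convex I\<close> der(1)] by metis
  moreover obtain k where "\<And>t. t \<in> I \<Longrightarrow> g (\<gamma> t) (V (\<gamma> t)) (velocity A \<gamma> t) = k"
    using has_vector_derivative_zero_constant[OF \<open>convex I\<close> der(2)] by metis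
  ultimately show thesis by (rule that)
qed

lemma orthogonality_persists:
  assumes \<gamma>: "geodesic A g \<gamma> I" and "t0 \<in> I" "velocity A \<gamma> t0 \<in> orth A g V (\<gamma> t0)" "t \<in> I"
  shows "velocity A \<gamma> t \<in> orth A g V (\<gamma> t)"
proof -
  obtain k where "\<And>t. t \<in> I \<Longrightarrow> g (\<gamma> t) (V (\<gamma> t)) (velocity A \<gamma> t) = k"
    using geodesic_conserved[OF \<gamma>] by metis
  then have "g (\<gamma> t) (V (\<gamma> t)) (velocity A \<gamma> t) = 0"
    using assms(2,3,4) unfolding orth_def by force
  then show ?thesis
    unfolding orth_def using geodesic_velocity_tangent[OF \<gamma> assms(4)] by blast
qed

text \<open>In a foliated chart, tangency to \<open>V\<^sup>\<bottom>\<close> means that the coordinate with constant values on plaques has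
  derivative zero along the geodesic.\<close>

theorem orthogonal_foliation_totally_geodesic:
  assumes int: "integrable_distribution A (orth A g V)"
  shows "totally_geodesic A g (orth A g V)"
  unfolding totally_geodesic_def
proof (intro allI ballI impI, elim conjE)
  fix \<gamma> I t0 assume t0: "t0 \<in> I" and \<gamma>: "geodesic A g \<gamma> I" and orth0: "velocity A \<gamma> t0 \<in> orth A g V (\<gamma> t0)"
  obtain c b where fol: "foliated_chart A (orth A g V) c b" and p: "\<gamma> t0 \<in> cdom c"
    using int unfolding integrable_distribution_def by blast
  have c: "c \<in> A" and D: "\<And>p. p \<in> cdom c \<Longrightarrow> orth A g V p = {\<xi> \<in> tangent_space A p. \<xi> c \<bullet> b = 0}"
    using fol unfolding foliated_chart_def by blast+
  have "open {t \<in> I. \<gamma> t \<in> cdom c}"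
    by (rule curve_in_chart[OF c geodesicD(1,4)[OF \<gamma>]])
  then obtain e where e: "e > 0" "ball t0 e \<subseteq> {t \<in> I. \<gamma> t \<in> cdom c}"
    using t0 p unfolding open_contains_ball by blast
  have "((\<lambda>t. (cmap c \<circ> \<gamma>) t \<bullet> b) has_vector_derivative 0) (at t within ball t0 e)" if "t \<in> ball t0 e" for t
  proof -
    have t: "t \<in> I" "\<gamma> t \<in> cdom c" using e(2) that by auto
    have "vector_derivative (cmap c \<circ> \<gamma>) (at t) \<bullet> b = 0"
      using orthogonality_persists[OF \<gamma> t0 orth0 t(1)] D[OF t(2)] c t(2) unfolding velocity_def by auto
    moreover have "((\<lambda>t. (cmap c \<circ> \<gamma>) t \<bullet> b) has_vector_derivative vector_derivative (cmap c \<circ> \<gamma>) (at t) \<bullet> b) (at t)"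
      by (rule has_vector_derivative_compose[OF _ geodesic_equation(1)[OF \<gamma> c t]])
        (intro has_derivative_inner_left has_derivative_ident)
    ultimately show ?thesis by (simp add: has_vector_derivative_at_within)
  qed
  then obtain k where k: "\<And>t. t \<in> ball t0 e \<Longrightarrow> (cmap c \<circ> \<gamma>) t \<bullet> b = k"
    using has_vector_derivative_zero_constant[OF convex_ball] by metis
  show "\<exists>\<epsilon>>0. \<forall>t\<in>I. \<bar>t - t0\<bar> < \<epsilon> \<longrightarrow> \<gamma> t \<in> leaf A (orth A g V) (\<gamma> t0)"
  proof (intro exI[of _ e] conjI ballI impI e(1))
    fix t assume "t \<in> I" "\<bar>t - t0\<bar> < e"
    then have t: "t \<in> ball t0 e" by (simp add: dist_real_def abs_minus_commute)
    have "same_plaque A (orth A g V) (\<gamma> t0) (\<gamma> t)"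
      unfolding same_plaque_def
    proof (intro exI conjI)
      show "foliated_chart A (orth A g V) c b" by (rule fol)
      show "\<gamma> t0 \<in> cdom c" by (rule p)
      show "\<gamma> t \<in> cdom c" using e(2) t by blast
      show "cmap c (\<gamma> t0) \<bullet> b = cmap c (\<gamma> t) \<bullet> b" using k[OF t] k[of t0] e(1) by simp
    qed
    then show "\<gamma> t \<in> leaf A (orth A g V) (\<gamma> t0)" unfolding leaf_def by auto
  qed
qed

text \<open>The covector is the inner product with the coordinate vector of \<open>V\<close> at the centre of the ball.\<close>

lemma adapted_ball:
  "\<exists>c r. c \<in> A \<and> p \<in> cdom c \<and> r > 0 \<and> cball (cmap c p) r \<subseteq> cimage c \<and>
    (\<forall>x\<in>cball (cmap c p) r. vf_coord V c (cmap c p) \<bullet> vf_coord V c x > 0)"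
proof -
  obtain c where c: "c \<in> A" and p: "p \<in> cdom c" by (rule chart_at)
  interpret C: null_killing_patch "cimage c" "metric_coord A g c" "vf_coord V c" by (rule null_killing_patch[OF c])
  let ?x = "cmap c p" and ?f = "\<lambda>x. vf_coord V c (cmap c p) \<bullet> vf_coord V c x"
  have x: "?x \<in> cimage c" by (rule cmap_in_cimage[OF p])
  have "continuous_on (cimage c) ?f"
    by (intro continuous_intros smooth_on_continuous[OF C.smooth_W])
  then have "open (?f -` {0<..} \<inter> cimage c)"
    using continuous_on_open_vimage[OF C.open_U, of ?f] open_greaterThan by blast
  moreover have "?x \<in> ?f -` {0<..} \<inter> cimage c"
    using x C.W_nonzero[OF x] by simp
  ultimately obtain r where "r > 0" "cball ?x r \<subseteq> ?f -` {0<..} \<inter> cimage c"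
    unfolding open_contains_cball by blast
  then show ?thesis using c p by (intro exI[of _ c] exI[of _ r]) auto
qed

text \<open>The points that lie in both closed balls form a compact set.\<close>

lemma jacobian_bound:
  assumes "c \<in> A" "d \<in> A" "cball x r \<subseteq> cimage c" "cball y s \<subseteq> cimage d"
  shows "\<exists>C\<ge>0. \<forall>p\<in>cdom c \<inter> cdom d. cmap c p \<in> cball x r \<longrightarrow> cmap d p \<in> cball y s \<longrightarrow>
    (\<forall>u. norm (jacobian c d p u) \<le> C * norm u)"
proof -
  let ?K = "{p \<in> cdom c. cmap c p \<in> cball x r} \<inter> {p \<in> cdom d. cmap d p \<in> cball y s}"
  have "compact ?K"
    by (intro compact_Int_closed closed_chart_ball assms)
  then have "compact (cmap c ` ?K)"
    by (rule compact_continuous_image[rotated]) (auto intro: continuous_on_subset[OF continuous_on_cmap[OF assms(1)]])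
  moreover have sub: "cmap c ` ?K \<subseteq> overlap c d" unfolding overlap_def by blast
  ultimately have "\<exists>C\<ge>0. \<forall>x\<in>cmap c ` ?K. \<forall>u. norm (frechet_derivative (transition c d) (at x) u) \<le> C * norm u"
    by (intro linear_family_bound smooth_on_deriv_linear[OF smooth_transition[OF assms(1,2)]]
        continuous_on_subset[OF smooth_on_deriv_continuous[OF smooth_transition[OF assms(1,2)]]]) auto
  then show ?thesis by auto
qed

text \<open>Near every point \<open>q\<close> there is a coordinate ball in which the geodesic has bounded velocity during a
  bounded time. The coefficients \<open>a p\<close> belong to finitely many adapted balls that cover the
  manifold. If the geodesic is in two of the balls, the Jacobian maps \<open>v - a V\<close> for one
  ball to a bounded vector, on which the covector of the other ball takes the value
  \<open>(a q - a p) l(V)\<close>; so the two coefficients differ by a bounded amount, and the estimate for weighted means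
  applies.\<close>

theorem velocity_bound:
  assumes \<gamma>: "geodesic A g \<gamma> I" and orth: "\<And>t. t \<in> I \<Longrightarrow> velocity A \<gamma> t \<in> orth A g V (\<gamma> t)" and t0: "t0 \<in> I"
  shows "\<exists>c\<in>A. \<exists>r>0. q \<in> cdom c \<and> cball (cmap c q) r \<subseteq> cimage c \<and>
    (\<exists>M. \<forall>t\<in>I. \<bar>t - t0\<bar> \<le> T \<longrightarrow> \<gamma> t \<in> cdom c \<longrightarrow> cmap c (\<gamma> t) \<in> cball (cmap c q) r \<longrightarrow> norm (velocity A \<gamma> t c) \<le> M)"
proof -
  obtain ch r where ch: "\<And>p. ch p \<in> A" and dom: "\<And>p. p \<in> cdom (ch p)" and r: "\<And>p. r p > 0"
    and ball: "\<And>p. cball (cmap (ch p) p) (r p) \<subseteq> cimage (ch p)"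
    and pos: "\<And>p x. x \<in> cball (cmap (ch p) p) (r p) \<Longrightarrow> vf_coord V (ch p) (cmap (ch p) p) \<bullet> vf_coord V (ch p) x > 0"
    using adapted_ball by metis
  define ctr where "ctr p = cmap (ch p) p" for p
  define l where "l p = vf_coord V (ch p) (ctr p)" for p
  \<comment> \<open>balls of half the radius form the cover, so that some weight is at least \<open>1/2\<close> everywhere\<close>
  define H where "H p = cmap (ch p) -` ball (ctr p) (r p / 2) \<inter> cdom (ch p)" for p
  define act where "act t p \<longleftrightarrow> \<gamma> t \<in> cdom (ch p) \<and> cmap (ch p) (\<gamma> t) \<in> cball (ctr p) (r p)" for t p
  note ball = ball[folded ctr_def] and pos = pos[folded ctr_def, folded l_def]
  have "open (H p)" for p
    unfolding H_def using continuous_on_open_vimage[OF open_cdom[OF ch]] continuous_on_cmap[OF ch] by blast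
  moreover have "p \<in> H p" for p unfolding H_def ctr_def using dom r by simp
  ultimately obtain F where F: "finite F" "UNIV \<subseteq> (\<Union>p\<in>F. H p)"
    using compactE_image[OF compact_manifold, of UNIV H] by (metis UNIV_I UN_I subsetI)
  obtain E where E: "\<And>t. t \<in> I \<Longrightarrow> g (\<gamma> t) (velocity A \<gamma> t) (velocity A \<gamma> t) = E"
    using geodesic_conserved[OF \<gamma>] by metis
  define x where "x p t = cmap (ch p) (\<gamma> t)" for p t
  define v where "v p t = vector_derivative (cmap (ch p) \<circ> \<gamma>) (at t)" for p t
  define a where "a p t = l p \<bullet> v p t / (l p \<bullet> vf_coord V (ch p) (x p t))" for p t
  define \<rho> where "\<rho> p t = (if \<gamma> t \<in> cdom (ch p) then bump (ctr p) (r p) (x p t) else 0)" for p t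
  have vel: "velocity A \<gamma> t (ch p) = v p t" if "act t p" for t p
    using that ch unfolding velocity_def v_def act_def by simp
  have eqs: "(x p has_vector_derivative v p t) (at t)"
    "(v p has_vector_derivative - levi_civita (metric_coord A g (ch p)) (x p t) (v p t) (v p t)) (at t)"
    if "t \<in> I" "act t p" for t p
    using geodesic_equation[OF \<gamma> ch that(1), of p] that(2) unfolding act_def x_def v_def by (auto simp: o_def)
  have "\<exists>C\<ge>0. \<forall>t\<in>I. act t p \<longrightarrow>
      norm (v p t - a p t *\<^sub>R vf_coord V (ch p) (x p t)) \<le> C \<and> norm (v p t) \<le> C * (1 + \<bar>a p t\<bar>) \<and>
      (\<exists>d. (a p has_real_derivative d) (at t) \<and> \<bar>d\<bar> \<le> C * (1 + \<bar>a p t\<bar>))" for p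
  proof -
    interpret C: null_killing_patch "cimage (ch p)" "metric_coord A g (ch p)" "vf_coord V (ch p)"
      by (rule null_killing_patch[OF ch])
    have posb: "\<forall>x\<in>cball (ctr p) (r p). l p \<bullet> vf_coord V (ch p) x > 0" using pos by blast
    from C.coefficient_growth[OF compact_cball ball posb, where E=E]
    obtain C where C: "C \<ge> 0" and *:
      "\<forall>x v t. x t \<in> cball (ctr p) (r p) \<longrightarrow> (x has_vector_derivative v t) (at t) \<longrightarrow>
      (v has_vector_derivative - C.\<Gamma> (x t) (v t) (v t)) (at t) \<longrightarrow>
      metric_coord A g (ch p) (x t) (vf_coord V (ch p) (x t)) (v t) = 0 \<longrightarrow> metric_coord A g (ch p) (x t) (v t) (v t) = E \<longrightarrow>
      norm (v t - (l p \<bullet> v t / (l p \<bullet> vf_coord V (ch p) (x t))) *\<^sub>R vf_coord V (ch p) (x t)) \<le> C \<and>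
      norm (v t) \<le> C * (1 + \<bar>l p \<bullet> v t / (l p \<bullet> vf_coord V (ch p) (x t))\<bar>) \<and>
      (\<exists>d. ((\<lambda>s. l p \<bullet> v s / (l p \<bullet> vf_coord V (ch p) (x s))) has_real_derivative d) (at t) \<and>
        \<bar>d\<bar> \<le> C * (1 + \<bar>l p \<bullet> v t / (l p \<bullet> vf_coord V (ch p) (x t))\<bar>))"
      by (elim exE conjE) (rule that)
    show ?thesis
    proof (intro exI[of _ C] conjI[OF C] ballI impI)
      fix t assume t: "t \<in> I" and at: "act t p"
      have p: "\<gamma> t \<in> cdom (ch p)" and xt: "x p t \<in> cball (ctr p) (r p)" using at unfolding act_def x_def by auto
      have tan: "velocity A \<gamma> t \<in> tangent_space A (\<gamma> t)" by (rule geodesic_velocity_tangent[OF \<gamma> t])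
      have "metric_coord A g (ch p) (x p t) (vf_coord V (ch p) (x p t)) (v p t) = 0"
        using metric_coord_eq[OF V_tangent tan ch p, of g] orth[OF t]
        unfolding vel[OF at] x_def vf_coord_cmap[OF ch p] orth_def by simp
      moreover have "metric_coord A g (ch p) (x p t) (v p t) (v p t) = E"
        using metric_coord_eq[OF tan tan ch p, of g] E[OF t] unfolding vel[OF at] x_def by simp
      ultimately show "norm (v p t - a p t *\<^sub>R vf_coord V (ch p) (x p t)) \<le> C \<and> norm (v p t) \<le> C * (1 + \<bar>a p t\<bar>) \<and>
          (\<exists>d. (a p has_real_derivative d) (at t) \<and> \<bar>d\<bar> \<le> C * (1 + \<bar>a p t\<bar>))"
        using *[rule_format, of "x p" t "v p", OF xt eqs[OF t at]] unfolding a_def[abs_def] by blast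
    qed
  qed
  then obtain C1 where C1: "\<And>p. C1 p \<ge> 0"
    "\<And>p t. t \<in> I \<Longrightarrow> act t p \<Longrightarrow> norm (v p t - a p t *\<^sub>R vf_coord V (ch p) (x p t)) \<le> C1 p"
    "\<And>p t. t \<in> I \<Longrightarrow> act t p \<Longrightarrow> norm (v p t) \<le> C1 p * (1 + \<bar>a p t\<bar>)"
    "\<And>p t. t \<in> I \<Longrightarrow> act t p \<Longrightarrow> \<exists>d. (a p has_real_derivative d) (at t) \<and> \<bar>d\<bar> \<le> C1 p * (1 + \<bar>a p t\<bar>)"
    by metis
  have "\<exists>C\<ge>0. \<forall>t\<in>I. act t p \<longrightarrow> act t q \<longrightarrow> \<bar>a p t - a q t\<bar> \<le> C" for p q
  proof -
    obtain J where J: "J \<ge> 0" "\<And>z u. z \<in> cdom (ch p) \<Longrightarrow> z \<in> cdom (ch q) \<Longrightarrow> cmap (ch p) z \<in> cball (ctr p) (r p) \<Longrightarrow>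
        cmap (ch q) z \<in> cball (ctr q) (r q) \<Longrightarrow> norm (jacobian (ch p) (ch q) z u) \<le> J * norm u"
      using jacobian_bound[OF ch ch ball ball] by blast
    interpret Q: null_killing_patch "cimage (ch q)" "metric_coord A g (ch q)" "vf_coord V (ch q)"
      by (rule null_killing_patch[OF ch])
    have "continuous_on (cball (ctr q) (r q)) (\<lambda>x. l q \<bullet> vf_coord V (ch q) x)"
      by (intro continuous_intros continuous_on_subset[OF smooth_on_continuous[OF Q.smooth_W]] ball)
    then obtain y where y: "y \<in> cball (ctr q) (r q)" and
      min: "\<And>x. x \<in> cball (ctr q) (r q) \<Longrightarrow> l q \<bullet> vf_coord V (ch q) y \<le> l q \<bullet> vf_coord V (ch q) x"
      using continuous_attains_inf[OF compact_cball, of "ctr q" "r q"] r[of q] by (metis cball_eq_empty less_asym)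
    define b where "b = l q \<bullet> vf_coord V (ch q) y"
    have b: "b > 0" unfolding b_def by (rule pos[OF y])
    have "\<bar>a p t - a q t\<bar> \<le> norm (l q) * (J * C1 p) / b" if t: "t \<in> I" and ap: "act t p" and aq: "act t q" for t
    proof -
      define w where "w = v p t - a p t *\<^sub>R vf_coord V (ch p) (x p t)"
      define Wq where "Wq = vf_coord V (ch q) (x q t)"
      have p: "\<gamma> t \<in> cdom (ch p)" "\<gamma> t \<in> cdom (ch q)" using ap aq unfolding act_def by auto
      have lin: "linear (jacobian (ch p) (ch q) (\<gamma> t))" by (rule linear_jacobian[OF ch ch p])
      have "jacobian (ch p) (ch q) (\<gamma> t) (v p t) = v q t"
        using tangent_vector_transform[OF geodesic_velocity_tangent[OF \<gamma> t] ch ch p] unfolding vel[OF ap] vel[OF aq] by simp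
      moreover have "jacobian (ch p) (ch q) (\<gamma> t) (vf_coord V (ch p) (x p t)) = Wq"
        using tangent_vector_transform[OF V_tangent ch ch p] unfolding x_def Wq_def vf_coord_cmap[OF ch p(1)] vf_coord_cmap[OF ch p(2)] by simp
      ultimately have Jw: "jacobian (ch p) (ch q) (\<gamma> t) w = v q t - a p t *\<^sub>R Wq"
        unfolding w_def by (simp add: linear_diff[OF lin] linear_scale[OF lin])
      have lW: "b \<le> l q \<bullet> Wq" unfolding b_def Wq_def by (rule min) (use aq in \<open>simp add: act_def x_def\<close>)
      have "l q \<bullet> v q t = a q t * (l q \<bullet> Wq)" using lW b unfolding a_def Wq_def by simp
      then have "(a q t - a p t) * (l q \<bullet> Wq) = l q \<bullet> jacobian (ch p) (ch q) (\<gamma> t) w"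
        unfolding Jw by (simp add: inner_diff_right algebra_simps)
      then have "\<bar>a q t - a p t\<bar> * (l q \<bullet> Wq) = \<bar>l q \<bullet> jacobian (ch p) (ch q) (\<gamma> t) w\<bar>"
        using lW b by (metis abs_mult abs_of_pos less_le_trans)
      also have "\<dots> \<le> norm (l q) * (J * C1 p)"
      proof (rule order_trans[OF Cauchy_Schwarz_ineq2], rule mult_left_mono)
        have "norm (jacobian (ch p) (ch q) (\<gamma> t) w) \<le> J * norm w"
          using ap aq by (intro J(2)) (auto simp: act_def)
        also have "\<dots> \<le> J * C1 p" unfolding w_def by (intro mult_left_mono C1(2) t ap J(1))
        finally show "norm (jacobian (ch p) (ch q) (\<gamma> t) w) \<le> J * C1 p" .
      qed simp
      finally have "\<bar>a q t - a p t\<bar> * b \<le> norm (l q) * (J * C1 p)"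
        using lW mult_left_mono[OF lW, of "\<bar>a q t - a p t\<bar>"] by simp
      then show ?thesis using b by (simp add: field_simps abs_minus_commute)
    qed
    moreover have "norm (l q) * (J * C1 p) / b \<ge> 0" using J(1) C1(1) b by simp
    ultimately show ?thesis by blast
  qed
  then obtain C2 where C2: "\<And>p q. C2 p q \<ge> 0" "\<And>p q t. t \<in> I \<Longrightarrow> act t p \<Longrightarrow> act t q \<Longrightarrow> \<bar>a p t - a q t\<bar> \<le> C2 p q"
    by metis
  define C where "C = (\<Sum>p\<in>F. C1 p) + (\<Sum>p\<in>F. 4 / r p * C1 p) + (\<Sum>p\<in>F. \<Sum>q\<in>F. C2 p q)"
  have n1: "(\<Sum>p\<in>F. C1 p) \<ge> 0" and n2: "(\<Sum>p\<in>F. 4 / r p * C1 p) \<ge> 0" and n3: "(\<Sum>p\<in>F. \<Sum>q\<in>F. C2 p q) \<ge> 0"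
    using C1(1) C2(1) less_imp_le[OF r] by (auto intro!: sum_nonneg divide_nonneg_nonneg mult_nonneg_nonneg)
  have C0: "C \<ge> 0" unfolding C_def using n1 n2 n3 by simp
  have Cle: "C1 p \<le> C" "4 / r p * C1 p \<le> C" "q \<in> F \<Longrightarrow> C2 p q \<le> C" if "p \<in> F" for p q
  proof -
    have "C1 p \<le> (\<Sum>p\<in>F. C1 p)" by (rule member_le_sum[OF that C1(1) F(1)])
    then show "C1 p \<le> C" using n2 n3 unfolding C_def by simp
    have "4 / r p * C1 p \<le> (\<Sum>p\<in>F. 4 / r p * C1 p)"
      by (rule member_le_sum[OF that _ F(1)]) (simp add: C1(1) less_imp_le[OF r])
    then show "4 / r p * C1 p \<le> C" using n1 n3 unfolding C_def by simp
    assume "q \<in> F"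
    then have "C2 p q \<le> (\<Sum>q\<in>F. C2 p q)" by (rule member_le_sum[OF _ C2(1) F(1)])
    also have "\<dots> \<le> (\<Sum>p\<in>F. \<Sum>q\<in>F. C2 p q)"
      by (rule member_le_sum[OF that _ F(1), where f="\<lambda>p. \<Sum>q\<in>F. C2 p q"]) (auto intro: sum_nonneg C2)
    finally show "C2 p q \<le> C" using n1 n2 unfolding C_def by simp
  qed
  define m where "m t = (\<Sum>p\<in>F. \<rho> p t * a p t) / (\<Sum>p\<in>F. \<rho> p t)" for t
  have "(\<exists>d. (m has_real_derivative d) (at t) \<and> \<bar>d\<bar> \<le> (2 * real (card F) * (C * (1 + C) * (1 + C))) * (1 + \<bar>m t\<bar>)) \<and>
      (\<forall>p\<in>F. act t p \<longrightarrow> \<bar>a p t - m t\<bar> \<le> C)" if t: "t \<in> I" for t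
  proof -
    have act: "\<exists>r' a'. (\<rho> p has_real_derivative r') (at t) \<and>
      (a p has_real_derivative a') (at t) \<and> \<bar>r'\<bar> \<le> C * (1 + \<bar>a p t\<bar>) \<and> \<bar>a'\<bar> \<le> C * (1 + \<bar>a p t\<bar>) \<and>
      0 \<le> \<rho> p t \<and> \<rho> p t \<le> 1" if p: "p \<in> F" and ap: "act t p" for p
    proof -
      obtain d where d: "((\<lambda>s. bump (ctr p) (r p) (x p s)) has_real_derivative d) (at t)" "\<bar>d\<bar> \<le> 4 / r p * norm (v p t)"
        using bump_derivative[OF r _ eqs(1)[OF t ap], of "ctr p"] ap unfolding act_def x_def by blast
      have "(\<rho> p has_real_derivative d) (at t)"
        by (rule has_field_derivative_transform_within_open[OF d(1) curve_in_chart[OF ch geodesicD(1,4)[OF \<gamma>]]])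
          (use t ap in \<open>auto simp: \<rho>_def act_def\<close>)
      moreover have "\<bar>d\<bar> \<le> C * (1 + \<bar>a p t\<bar>)"
      proof -
        have "\<bar>d\<bar> \<le> 4 / r p * (C1 p * (1 + \<bar>a p t\<bar>))"
          using d(2) mult_left_mono[OF C1(3)[OF t ap], of "4 / r p"] r[of p] by simp
        also have "\<dots> \<le> C * (1 + \<bar>a p t\<bar>)"
          using mult_right_mono[OF Cle(2)[OF p], of "1 + \<bar>a p t\<bar>"] by simp
        finally show ?thesis .
      qed
      moreover obtain a' where "(a p has_real_derivative a') (at t)" "\<bar>a'\<bar> \<le> C1 p * (1 + \<bar>a p t\<bar>)"
        using C1(4)[OF t ap] by blast
      moreover have "C1 p * (1 + \<bar>a p t\<bar>) \<le> C * (1 + \<bar>a p t\<bar>)"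
        by (rule mult_right_mono[OF Cle(1)[OF p]]) simp
      moreover have "0 \<le> \<rho> p t" "\<rho> p t \<le> 1" unfolding \<rho>_def using bump_nonneg bump_le_1 by auto
      ultimately show ?thesis by (meson order_trans)
    qed
    have inact: "\<exists>S. open S \<and> t \<in> S \<and> (\<forall>s\<in>S. \<rho> p s = 0)" if ap: "\<not> act t p" for p
    proof -
      let ?K = "{z \<in> cdom (ch p). cmap (ch p) z \<in> cball (ctr p) (r p)}"
      have "open (\<gamma> -` (- ?K) \<inter> I)"
        using continuous_on_open_vimage[OF geodesicD(1)[OF \<gamma>], of \<gamma>] geodesicD(4)[OF \<gamma>]
          closed_chart_ball(2)[OF ch ball] open_Compl by blast
      moreover have "\<rho> p s = 0" if "\<gamma> s \<notin> ?K" for s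
        using that bump_outside[OF r] unfolding \<rho>_def x_def by auto
      ultimately show ?thesis
        using t ap by (intro exI[of _ "\<gamma> -` (- ?K) \<inter> I"]) (auto simp: act_def)
    qed
    have close: "\<bar>a p t - a q t\<bar> \<le> C" if "p \<in> F" "q \<in> F" "act t p" "act t q" for p q
      using C2(2)[OF t that(3,4)] Cle(3)[OF that(1,2)] by simp
    obtain p where p: "p \<in> F" "\<gamma> t \<in> H p" using F(2) by blast
    have "1 / 2 \<le> \<rho> p t"
      using p(2) bump_inside[OF r, of "x p t" "ctr p" p] unfolding H_def \<rho>_def x_def by auto
    also have "\<dots> \<le> (\<Sum>p\<in>F. \<rho> p t)"
      by (rule member_le_sum[OF p(1) _ F(1)]) (auto simp: \<rho>_def bump_nonneg)
    finally have total: "(\<Sum>p\<in>F. \<rho> p t) \<ge> 1 / 2" .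
    show ?thesis
      using weighted_mean_growth[OF C0 act inact close total] unfolding m_def[abs_def] by blast
  qed
  note mean = this
  define C' where "C' = 2 * real (card F) * (C * (1 + C) * (1 + C))"
  have "C' \<ge> 0" unfolding C'_def using C0 by simp
  moreover have "convex I" using geodesicD(2)[OF \<gamma>] by (simp add: is_interval_convex)
  ultimately obtain M where M: "\<And>t. t \<in> I \<Longrightarrow> \<bar>t - t0\<bar> \<le> T \<Longrightarrow> \<bar>m t\<bar> \<le> M"
    using linear_growth_bounded[of I t0 C' m T] t0 mean unfolding C'_def by blast
  obtain p where p: "p \<in> F" "q \<in> H p" using F(2) by blast
  have q: "q \<in> cdom (ch p)" "cmap (ch p) q \<in> ball (ctr p) (r p / 2)" using p(2) unfolding H_def by auto
  have sub: "cball (cmap (ch p) q) (r p / 2) \<subseteq> cball (ctr p) (r p)"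
  proof
    fix z assume "z \<in> cball (cmap (ch p) q) (r p / 2)"
    then show "z \<in> cball (ctr p) (r p)"
      using q(2) dist_triangle[of "ctr p" z "cmap (ch p) q"] by simp
  qed
  show ?thesis
  proof (rule bexI[OF exI[of _ "r p / 2"] ch], intro conjI q(1) exI[of _ "C * (1 + (C + M))"] ballI impI)
    show "r p / 2 > 0" using r[of p] by simp
    show "cball (cmap (ch p) q) (r p / 2) \<subseteq> cimage (ch p)" using sub ball by blast
    fix t assume t: "t \<in> I" "\<bar>t - t0\<bar> \<le> T" "\<gamma> t \<in> cdom (ch p)" "cmap (ch p) (\<gamma> t) \<in> cball (cmap (ch p) q) (r p / 2)"
    have ap: "act t p" unfolding act_def using t(3,4) sub by blast
    have "\<bar>a p t - m t\<bar> \<le> C" using mean[OF t(1)] p(1) ap by blast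
    then have "\<bar>a p t\<bar> \<le> C + M" using M[OF t(1,2)] by linarith
    then have "C1 p * (1 + \<bar>a p t\<bar>) \<le> C * (1 + (C + M))"
      using Cle(1)[OF p(1)] C0 C1(1)[of p] by (intro mult_mono) auto
    then show "norm (velocity A \<gamma> t (ch p)) \<le> C * (1 + (C + M))"
      using C1(3)[OF t(1) ap] unfolding vel[OF ap] by linarith
  qed (rule q(1))
qed

end

section \<open>Extension of geodesics\<close>

context lorentzian_manifold
begin

text \<open>Bounded velocity gives a limit of the curve at \<open>b\<close>, and then bounded acceleration gives a limit of the velocity.
  The solution of the geodesic equation that starts at these limits joins twice differentiably, because the
  derivatives of position and velocity extend continuously to \<open>b\<close>.\<close>

lemma geodesic_extend_bounded_velocity:
  assumes \<gamma>: "geodesic A g \<gamma> I" and end_I: "\<And>t. t \<in> I \<Longrightarrow> t < b" and t1: "t1 < b" "{t1<..<b} \<subseteq> I"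
    and c: "c \<in> A" and ball: "cball x0 r \<subseteq> cimage c" and "r > 0"
    and dom: "\<And>t. t \<in> {t1<..<b} \<Longrightarrow> \<gamma> t \<in> cdom c \<and> cmap c (\<gamma> t) \<in> cball x0 (r / 2)"
    and speed: "\<And>t. t \<in> {t1<..<b} \<Longrightarrow> norm (velocity A \<gamma> t c) \<le> M"
  shows "\<exists>\<sigma> J. geodesic_extension A g \<gamma> I \<sigma> J \<and> b \<in> J"
proof -
  interpret C: lorentzian_patch "cimage c" "metric_coord A g c" by (rule lorentzian_patch[OF c])
  define x where "x = cmap c \<circ> \<gamma>"
  define v where "v t = vector_derivative x (at t)" for t
  define acc where "acc p = - C.\<Gamma> (fst p) (snd p) (snd p)" for p
  have x: "(x has_vector_derivative v t) (at t)" and v: "(v has_vector_derivative acc (x t, v t)) (at t)"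
    if "t \<in> {t1<..<b}" for t
  proof -
    have t: "t \<in> I" "\<gamma> t \<in> cdom c" using that t1(2) dom by blast+
    show "(x has_vector_derivative v t) (at t)" "(v has_vector_derivative acc (x t, v t)) (at t)"
      using geodesic_equation[OF \<gamma> c t] unfolding x_def v_def acc_def by (auto simp: o_def)
  qed
  have vM: "norm (v t) \<le> M" if "t \<in> {t1<..<b}" for t
    using speed[OF that] dom[OF that] c unfolding velocity_def v_def x_def by simp
  obtain xb where xb: "(x \<longlongrightarrow> xb) (at_left b)"
    using bounded_derivative_tendsto[OF t1(1) x vM] by blast
  have left: "eventually (\<lambda>t. t \<in> {t1<..<b}) (at_left b)"
    by (rule eventually_at_left_real[OF t1(1)])
  have xball: "x t \<in> cball x0 (r / 2)" if "t \<in> {t1<..<b}" for t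
    using dom[OF that] unfolding x_def by simp
  have xb_ball: "xb \<in> cball x0 (r / 2)"
    by (rule Lim_in_closed_set[OF closed_cball eventually_mono[OF left xball] _ xb]) (simp_all add: trivial_limit_at_left_real)
  have half: "cball x0 (r / 2) \<subseteq> cimage c"
    using ball \<open>r > 0\<close> by (intro order_trans[OF subset_cball ball]) auto
  obtain Cg where Cg: "Cg \<ge> 0" "\<And>y u w. y \<in> cball x0 (r / 2) \<Longrightarrow> norm (C.\<Gamma> y u w) \<le> Cg * norm u * norm w"
    using C.levi_civita_bound[OF compact_cball half] by blast
  have aM: "norm (acc (x t, v t)) \<le> Cg * M * M" if "t \<in> {t1<..<b}" for t
  proof -
    have "norm (acc (x t, v t)) \<le> Cg * norm (v t) * norm (v t)"
      unfolding acc_def using Cg(2)[OF xball[OF that], of "v t" "v t"] by simp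
    also have "\<dots> \<le> Cg * M * M"
      using vM[OF that] Cg(1) order_trans[OF norm_ge_zero vM[OF that]] by (intro mult_mono) auto
    finally show ?thesis .
  qed
  obtain vb where vb: "(v \<longlongrightarrow> vb) (at_left b)"
    using bounded_derivative_tendsto[OF t1(1) v aM] by blast
  have sub: "cball xb (r / 2) \<subseteq> cimage c"
  proof
    fix z assume "z \<in> cball xb (r / 2)"
    then have "z \<in> cball x0 r" using xb_ball dist_triangle[of x0 z xb] by simp
    then show "z \<in> cimage c" using ball by blast
  qed
  define s where "s = min (r / 2) 1"
  have "s > 0" unfolding s_def using \<open>r > 0\<close> by simp
  have prod: "cball (xb, vb) s \<subseteq> cball xb (r / 2) \<times> cball vb 1"
  proof
    fix p assume "p \<in> cball (xb, vb) s"
    then have "dist xb (fst p) \<le> s" "dist vb (snd p) \<le> s"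
      using dist_fst_le[of "(xb, vb)" p] dist_snd_le[of "(xb, vb)" p] by auto
    then show "p \<in> cball xb (r / 2) \<times> cball vb 1" unfolding s_def by (simp add: mem_Times_iff)
  qed
  obtain L where "L-lipschitz_on (cball xb (r / 2) \<times> cball vb 1) (\<lambda>p. (snd p, acc p))"
    using C.geodesic_spray_lipschitz[OF sub] unfolding acc_def by blast
  then have "L-lipschitz_on (cball (xb, vb) s) (\<lambda>p. (snd p, acc p))"
    by (rule lipschitz_on_subset[OF _ prod])
  then obtain \<delta> y where \<delta>: "\<delta> > 0" and yb: "y b = (xb, vb)"
    and yball: "\<And>t. t \<in> {b..b+\<delta>} \<Longrightarrow> y t \<in> cball (xb, vb) s"
    and y: "\<And>t. t \<in> {b..b+\<delta>} \<Longrightarrow> (y has_vector_derivative (snd (y t), acc (y t))) (at t within {b..b+\<delta>})"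
    using picard_forward[OF \<open>s > 0\<close>, of L "(xb, vb)" "\<lambda>p. (snd p, acc p)" b] by metis
  define P where "P t = (if t < b then (x t, v t) else y t)" for t
  define P' where "P' t = (snd (P t), acc (P t))" for t
  define K where "K = {t1<..<b+\<delta>}"
  have PU: "fst (P t) \<in> cimage c" if "t \<in> K" for t
  proof (cases "t < b")
    case True
    then show ?thesis using that xball half unfolding P_def K_def by auto
  next
    case False
    then have "y t \<in> cball xb (r / 2) \<times> cball vb 1"
      using that prod yball[of t] unfolding K_def by auto
    then show ?thesis using False sub unfolding P_def by auto
  qed
  have P: "(P has_vector_derivative P' t) (at t)" if "t \<in> K" "t \<noteq> b" for t
  proof (cases "t < b")
    case True
    have "((\<lambda>t. (x t, v t)) has_vector_derivative (v t, acc (x t, v t))) (at t)"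
      by (rule has_vector_derivative_Pair) (use x v True that in \<open>auto simp: K_def\<close>)
    then have "((\<lambda>t. (x t, v t)) has_vector_derivative P' t) (at t)" using True by (simp add: P_def P'_def)
    then show ?thesis
      by (rule has_vector_derivative_transform_within_open[where S="{..<b}"]) (use True in \<open>auto simp: P_def\<close>)
  next
    case False
    then have t: "t \<in> {b<..<b+\<delta>}" using that unfolding K_def by auto
    then have "(y has_vector_derivative (snd (y t), acc (y t))) (at t within {b<..<b+\<delta>})"
      using y[of t] by (auto intro: has_vector_derivative_within_subset)
    then have "(y has_vector_derivative (snd (y t), acc (y t))) (at t)"
      using at_within_open[OF t open_greaterThanLessThan] by simp
    then have "(y has_vector_derivative P' t) (at t)" using t by (simp add: P_def P'_def)
    then show ?thesis
      by (rule has_vector_derivative_transform_within_open[where S="{b<..}"]) (use t in \<open>auto simp: P_def\<close>)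
  qed
  have Pb: "isCont P b"
  proof -
    have "((\<lambda>t. (x t, v t)) \<longlongrightarrow> P b) (at_left b)"
      using tendsto_Pair[OF xb vb] by (simp add: P_def yb)
    then have 1: "(P \<longlongrightarrow> P b) (at_left b)"
      by (rule Lim_transform_eventually) (rule eventually_mono[OF left], simp add: P_def)
    have "continuous (at b within {b..b+\<delta>}) y"
      using y[of b] \<delta> by (intro has_vector_derivative_continuous) auto
    then have "(y \<longlongrightarrow> P b) (at_right b)"
      using at_within_Icc_at_right[of b "b + \<delta>"] \<delta> unfolding continuous_within by (simp add: P_def)
    then have 2: "(P \<longlongrightarrow> P b) (at_right b)"
      by (rule Lim_transform_eventually) (auto simp: eventually_at_filter P_def)
    show ?thesis unfolding isCont_def by (rule filterlim_split_at[OF 1 2])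
  qed
  have cont: "isCont P t" if "t \<in> K" for t
    using P[OF that] Pb has_vector_derivative_continuous by (cases "t = b") auto
  have "isCont P' b"
  proof -
    have "b \<in> K" unfolding K_def using t1 \<delta> by simp
    then have "P b \<in> cimage c \<times> UNIV" using PU by (simp add: mem_Times_iff)
    from bspec[OF iffD1[OF continuous_on_eq_continuous_at[OF open_Times[OF C.open_U open_UNIV]]
          C.geodesic_spray_continuous] this]
    have "isCont acc (P b)" unfolding acc_def[abs_def] .
    then have "isCont (\<lambda>t. acc (P t)) b" by (rule isCont_o2[OF Pb])
    then show ?thesis unfolding P'_def by (intro continuous_intros Pb)
  qed
  then have "(P has_vector_derivative P' b) (at b)"
    by (rule has_vector_derivative_removable[of t1 b "b + \<delta>", rotated 4])
      (use t1 \<delta> P cont in \<open>auto simp: K_def intro!: continuous_at_imp_continuous_on\<close>)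
  then have der: "(P has_vector_derivative P' t) (at t)" if "t \<in> K" for t
    using P[OF that] by (cases "t = b") auto
  define \<sigma> where "\<sigma> t = (if t < b then \<gamma> t else cinv c (fst (P t)))" for t
  have K: "open K" "is_interval K" "b \<in> K" unfolding K_def using t1 \<delta> by (auto simp: is_interval_oo)
  have \<sigma>_dom: "\<sigma> t \<in> cdom c" and \<sigma>_coord: "cmap c (\<sigma> t) = fst (P t)" if "t \<in> K" for t
    using that dom[of t] cinv_in_cdom[OF c PU[OF that]] cmap_cinv[OF c PU[OF that]]
    unfolding \<sigma>_def K_def by (auto simp: P_def x_def)
  have fst_der: "((\<lambda>t. fst (P t)) has_vector_derivative fst (P' t)) (at t)"
    and snd_der: "((\<lambda>t. snd (P t)) has_vector_derivative snd (P' t)) (at t)" if "t \<in> K" for t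
    by (rule bounded_linear.has_vector_derivative[OF bounded_linear_fst der[OF that]],
        rule bounded_linear.has_vector_derivative[OF bounded_linear_snd der[OF that]])
  have \<sigma>K: "geodesic A g \<sigma> K"
  proof (rule geodesic_from_chart[OF K(1,2) _ c \<sigma>_dom, where v="\<lambda>t. snd (P t)"])
    show "K \<noteq> {}" using K(3) by blast
    fix t assume t: "t \<in> K"
    show "((cmap c \<circ> \<sigma>) has_vector_derivative snd (P t)) (at t)"
      by (rule has_vector_derivative_transform_within_open[OF fst_der[OF t, unfolded P'_def fst_conv] K(1) t])
        (simp add: \<sigma>_coord)
    show "((\<lambda>t. snd (P t)) has_vector_derivative
        - levi_civita (metric_coord A g c) (cmap c (\<sigma> t)) (snd (P t)) (snd (P t))) (at t)"
      using snd_der[OF t] unfolding P'_def acc_def \<sigma>_coord[OF t] by simp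
  qed
  have \<sigma>I: "\<sigma> t = \<gamma> t" if "t \<in> I" for t
    unfolding \<sigma>_def using end_I[OF that] by simp
  have "geodesic A g \<sigma> (I \<union> K)"
  proof (rule geodesic_local)
    show "open (I \<union> K)" using geodesicD(1)[OF \<gamma>] K(1) by blast
    have "(t1 + b) / 2 \<in> I \<inter> K" using t1 \<delta> unfolding K_def by (auto simp: field_simps subset_iff)
    then have "I \<inter> K \<noteq> {}" by blast
    then show "is_interval (I \<union> K)"
      using connected_Un[of I K] geodesicD(2)[OF \<gamma>] K(2) unfolding is_interval_connected_1 by blast
    show "I \<union> K \<noteq> {}" using K(3) by blast
    fix t assume "t \<in> I \<union> K"
    then show "\<exists>\<sigma>' K'. geodesic A g \<sigma>' K' \<and> t \<in> K' \<and> (\<forall>s\<in>K'. \<sigma> s = \<sigma>' s)"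
      using \<gamma> \<sigma>I \<sigma>K by blast
  qed
  then show ?thesis
    unfolding geodesic_extension_def using \<sigma>I K(3) by blast
qed

text \<open>Extensions of \<open>\<gamma>\<close> are compared by inclusion of their graphs, as values outside the domain carry no meaning. The union
  of a chain of graphs is again the graph of a geodesic, by locality.\<close>

lemma maximal_geodesic_extension:
  assumes \<gamma>: "geodesic A g \<gamma> I"
  obtains \<sigma> J where "geodesic_extension A g \<gamma> I \<sigma> J"
    "\<And>\<tau> K. geodesic_extension A g \<sigma> J \<tau> K \<Longrightarrow> K = J"
proof -
  define gr where "gr \<sigma> J = (\<lambda>t. (t, \<sigma> t)) ` J" for \<sigma> :: "real \<Rightarrow> 'm" and J
  define E where "E = {gr \<sigma> J | \<sigma> J. geodesic_extension A g \<gamma> I \<sigma> J}"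
  obtain t0 where t0: "t0 \<in> I" using geodesicD(3)[OF \<gamma>] by blast
  have "gr \<gamma> I \<in> E" unfolding E_def geodesic_extension_def using \<gamma> by blast
  then have "E \<noteq> {}" by blast
  moreover have "\<Union>C \<in> E" if C: "C \<noteq> {}" "subset.chain E C" for C
  proof -
    have CE: "C \<subseteq> E" and comparable: "\<And>X Y. X \<in> C \<Longrightarrow> Y \<in> C \<Longrightarrow> X \<subseteq> Y \<or> Y \<subseteq> X"
      using C(2) unfolding subset_chain_def by blast+
    have "\<forall>X\<in>C. \<exists>p. geodesic_extension A g \<gamma> I (fst p) (snd p) \<and> X = gr (fst p) (snd p)"
      using CE unfolding E_def by fastforce
    from bchoice[OF this] obtain p where
      p': "\<forall>X\<in>C. geodesic_extension A g \<gamma> I (fst (p X)) (snd (p X)) \<and> X = gr (fst (p X)) (snd (p X))"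
      by (rule exE)
    have p: "geodesic_extension A g \<gamma> I (fst (p X)) (snd (p X))" "X = gr (fst (p X)) (snd (p X))" if "X \<in> C" for X
      using bspec[OF p' that] by (rule conjunct1, rule conjunct2)
    define J where "J = (\<Union>X\<in>C. snd (p X))"
    define \<sigma> where "\<sigma> t = (SOME z. (t, z) \<in> \<Union>C)" for t
    have mem: "(t, z) \<in> X \<longleftrightarrow> t \<in> snd (p X) \<and> z = fst (p X) t" if "X \<in> C" for X t z
      by (subst p(2)[OF that]) (auto simp: gr_def)
    have unique: "z = z'" if "(t, z) \<in> X" "(t, z') \<in> Y" "X \<in> C" "Y \<in> C" for X Y t z z'
      using comparable[OF that(3,4)] that mem by (metis subsetD)
    have \<sigma>: "\<sigma> t = fst (p X) t" if "X \<in> C" "t \<in> snd (p X)" for X t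
    proof -
      have m: "(t, fst (p X) t) \<in> X" using mem[OF that(1)] that(2) by simp
      then have "(t, fst (p X) t) \<in> \<Union>C" using that(1) by blast
      then have "(t, \<sigma> t) \<in> \<Union>C" unfolding \<sigma>_def by (rule someI)
      then obtain Y where "Y \<in> C" "(t, \<sigma> t) \<in> Y" by blast
      then show ?thesis using unique m that(1) by blast
    qed
    have "\<Union>C = gr \<sigma> J"
    proof (intro equalityI subsetI)
      fix q assume "q \<in> \<Union>C"
      then obtain X where X: "X \<in> C" "q \<in> X" by blast
      then have "fst q \<in> snd (p X)" "snd q = fst (p X) (fst q)" using mem[OF X(1), of "fst q" "snd q"] by auto
      then show "q \<in> gr \<sigma> J"
        unfolding gr_def J_def using X(1) \<sigma>[OF X(1)] by (intro image_eqI[of _ _ "fst q"]) (auto simp: prod_eq_iff)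
    next
      fix q assume "q \<in> gr \<sigma> J"
      then obtain X t where X: "X \<in> C" "t \<in> snd (p X)" "q = (t, \<sigma> t)" unfolding gr_def J_def by blast
      then show "q \<in> \<Union>C" using mem[OF X(1)] \<sigma>[OF X(1,2)] by blast
    qed
    moreover have "geodesic_extension A g \<gamma> I \<sigma> J"
    proof -
      have ext: "geodesic A g (fst (p X)) (snd (p X))" "I \<subseteq> snd (p X)" "\<And>t. t \<in> I \<Longrightarrow> fst (p X) t = \<gamma> t" if "X \<in> C" for X
        using p(1)[OF that] unfolding geodesic_extension_def by blast+
      have "geodesic A g \<sigma> J"
      proof (rule geodesic_local)
        show "open J" unfolding J_def using ext(1) geodesicD(1) by blast
        have "connected J"
          unfolding J_def by (rule connected_Union)
            (use ext geodesicD(2) is_interval_connected t0 in blast)+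
        then show "is_interval J" by (simp add: is_interval_connected_1)
        show "J \<noteq> {}" unfolding J_def using C(1) ext(2) t0 by blast
        fix t assume "t \<in> J"
        then obtain X where X: "X \<in> C" "t \<in> snd (p X)" unfolding J_def by blast
        then show "\<exists>\<sigma>' K. geodesic A g \<sigma>' K \<and> t \<in> K \<and> (\<forall>s\<in>K. \<sigma> s = \<sigma>' s)"
          using ext(1)[OF X(1)] \<sigma>[OF X(1)] by blast
      qed
      moreover obtain X where "X \<in> C" using C(1) by blast
      ultimately show ?thesis
        unfolding geodesic_extension_def using ext(2,3) \<sigma> unfolding J_def by (metis UN_upper order_trans subsetD)
    qed
    ultimately show ?thesis unfolding E_def by blast
  qed
  ultimately obtain M where M: "M \<in> E" "\<And>X. X \<in> E \<Longrightarrow> M \<subseteq> X \<Longrightarrow> X = M"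
    using subset_Zorn_nonempty[of E] by blast
  then obtain \<sigma> J where \<sigma>: "M = gr \<sigma> J" "geodesic_extension A g \<gamma> I \<sigma> J" unfolding E_def by blast
  show thesis
  proof (rule that[OF \<sigma>(2)])
    fix \<tau> K assume \<tau>: "geodesic_extension A g \<sigma> J \<tau> K"
    then have "geodesic_extension A g \<gamma> I \<tau> K"
      using \<sigma>(2) unfolding geodesic_extension_def by (auto simp: subset_iff)
    then have "gr \<tau> K \<in> E" unfolding E_def by blast
    moreover have "M \<subseteq> gr \<tau> K"
      using \<tau> unfolding \<sigma>(1) gr_def geodesic_extension_def by force
    ultimately have "gr \<tau> K = gr \<sigma> J" using M(2) \<sigma>(1) by blast
    then have "fst ` gr \<tau> K = fst ` gr \<sigma> J" by simp
    then show "K = J" unfolding gr_def by (simp add: image_image)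
  qed
qed

end

context null_killing_manifold
begin

text \<open>By compactness the geodesic accumulates at some point \<open>q\<close> as time tends to the right end \<open>b\<close>. With velocity at
  most \<open>N\<close> in a ball of radius \<open>r\<close> around \<open>q\<close>, a geodesic that is within \<open>r/4\<close> of \<open>q\<close> later than \<open>b - r / (4 N)\<close> cannot leave
  the ball of radius \<open>r/2\<close> before \<open>b\<close>.\<close>

lemma orthogonal_geodesic_extends_right:
  assumes \<gamma>: "geodesic A g \<gamma> I" and orth: "\<And>t. t \<in> I \<Longrightarrow> velocity A \<gamma> t \<in> orth A g V (\<gamma> t)"
    and bdd: "bdd_above I"
  shows "\<exists>\<sigma> J. geodesic_extension A g \<gamma> I \<sigma> J \<and> J \<noteq> I"
proof -
  obtain t0 where t0: "t0 \<in> I" using geodesicD(3)[OF \<gamma>] by blast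
  define b where "b = Sup I"
  have end_I: "t < b" if tI: "t \<in> I" for t
  proof -
    obtain e where e: "e > 0" "ball t e \<subseteq> I" by (rule openE[OF geodesicD(1)[OF \<gamma>] tI])
    have "t + e / 2 \<in> ball t e" using e(1) by (simp add: dist_real_def)
    then have "t + e / 2 \<le> b" unfolding b_def using e(2) bdd by (intro cSup_upper) auto
    then show ?thesis using e(1) by simp
  qed
  have upto: "{s..<b} \<subseteq> I" if "s \<in> I" for s
  proof
    fix t assume t: "t \<in> {s..<b}"
    then obtain u where "u \<in> I" "t < u" using less_cSupD[of I t] geodesicD(3)[OF \<gamma>] unfolding b_def by auto
    then show "t \<in> I" using geodesicD(2)[OF \<gamma>] that t unfolding is_interval_1 by (meson atLeastLessThan_iff less_imp_le)
  qed
  have "\<exists>q. \<forall>S e. open S \<longrightarrow> q \<in> S \<longrightarrow> e > 0 \<longrightarrow> (\<exists>t\<in>I. b - e < t \<and> \<gamma> t \<in> S)"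
  proof (rule ccontr)
    assume "\<not> ?thesis"
    then obtain S e where S: "\<And>q. open (S q)" "\<And>q. q \<in> S q" "\<And>q. e q > 0"
      "\<And>q t. t \<in> I \<Longrightarrow> b - e q < t \<Longrightarrow> \<gamma> t \<notin> S q" by metis
    obtain F where F: "finite F" "UNIV \<subseteq> (\<Union>q\<in>F. S q)"
      using compactE_image[OF compact_manifold, of UNIV S] S(1,2) by (metis UNIV_I UN_I subsetI)
    then have "F \<noteq> {}" by blast
    define d where "d = Min (e ` F)"
    have d: "d > 0" "\<And>q. q \<in> F \<Longrightarrow> d \<le> e q"
      unfolding d_def using F(1) \<open>F \<noteq> {}\<close> S(3) by (auto simp: Min_gr_iff)
    obtain t where t: "t \<in> I" "b - d < t"
      using less_cSupD[of I "b - d"] geodesicD(3)[OF \<gamma>] d(1) unfolding b_def by auto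
    obtain q where "q \<in> F" "\<gamma> t \<in> S q" using F(2) by blast
    then show False using S(4)[OF t(1), of q] d(2)[of q] t(2) by fastforce
  qed
  then obtain q where q: "\<And>S e. open S \<Longrightarrow> q \<in> S \<Longrightarrow> e > 0 \<Longrightarrow> \<exists>t\<in>I. b - e < t \<and> \<gamma> t \<in> S" by blast
  obtain c r M where c: "c \<in> A" and r: "r > 0" and qc: "q \<in> cdom c" and ball: "cball (cmap c q) r \<subseteq> cimage c"
    and M: "\<And>t. t \<in> I \<Longrightarrow> \<bar>t - t0\<bar> \<le> b - t0 \<Longrightarrow> \<gamma> t \<in> cdom c \<Longrightarrow> cmap c (\<gamma> t) \<in> cball (cmap c q) r \<Longrightarrow>
      norm (velocity A \<gamma> t c) \<le> M"
    using velocity_bound[OF \<gamma> orth t0, of q "b - t0"] by metis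
  define x0 where "x0 = cmap c q"
  define N where "N = \<bar>M\<bar> + 1"
  have N: "N > 0" "M \<le> N" unfolding N_def by auto
  define B where "B \<rho> = cmap c -` ball x0 \<rho> \<inter> cdom c" for \<rho>
  have openB: "open (B \<rho>)" for \<rho>
    unfolding B_def using continuous_on_open_vimage[OF open_cdom[OF c]] continuous_on_cmap[OF c] by blast
  define e where "e = min (b - t0) (r / (4 * N))"
  have "e > 0" unfolding e_def using end_I[OF t0] r N by simp
  moreover have "q \<in> B (r / 4)" unfolding B_def x0_def using qc r by simp
  ultimately obtain t1 where t1: "t1 \<in> I" "b - e < t1" "\<gamma> t1 \<in> B (r / 4)" using q[OF openB] by blast
  have t1b: "t0 < t1" "t1 < b" "N * (b - t1) < r / 4"
  proof -
    show "t0 < t1" "t1 < b" using t1(2) end_I[OF t1(1)] unfolding e_def by auto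
    have "N * (b - t1) < N * (r / (4 * N))" using t1(2) N unfolding e_def by (intro mult_strict_left_mono) auto
    then show "N * (b - t1) < r / 4" using N by simp
  qed
  define K where "K = {z \<in> cdom c. cmap c z \<in> cball x0 (r / 2)}"
  have "cball x0 (r / 2) \<subseteq> cimage c"
    by (rule order_trans[OF subset_cball ball[folded x0_def]]) (use r in auto)
  then have K: "closed K" unfolding K_def by (rule closed_chart_ball(2)[OF c])
  have speed: "norm (velocity A \<gamma> t c) \<le> N" if "t \<in> {t1..<b}" "\<gamma> t \<in> K" for t
  proof -
    have "norm (velocity A \<gamma> t c) \<le> M"
    proof (rule M)
      show "t \<in> I" using upto[OF t1(1)] that(1) by blast
      show "\<bar>t - t0\<bar> \<le> b - t0" using that(1) t1b by auto
      show "\<gamma> t \<in> cdom c" "cmap c (\<gamma> t) \<in> cball (cmap c q) r"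
        using that(2) r unfolding K_def x0_def by auto
    qed
    then show ?thesis using N(2) by simp
  qed
  have stay: "\<gamma> t \<in> K" if t: "t \<in> {t1..<b}" for t
  proof (rule ccontr)
    assume "\<gamma> t \<notin> K"
    define Z where "Z = {s \<in> {t1..t}. \<gamma> s \<notin> K}"
    \<comment> \<open>the first instant outside; the geodesic is still inside at \<open>\<tau>\<close>, and even well inside\<close>
    define \<tau> where "\<tau> = Inf Z"
    have Z: "Z \<noteq> {}" "bdd_below Z" "t \<in> Z" unfolding Z_def using t \<open>\<gamma> t \<notin> K\<close> by (auto intro: bdd_belowI[of _ t1])
    have \<tau>: "t1 \<le> \<tau>" "\<tau> \<le> t"
      unfolding \<tau>_def using Z by (auto intro!: cInf_greatest cInf_lower simp: Z_def)
    have before: "\<gamma> s \<in> K" if "s \<in> {t1..<\<tau>}" for s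
      using that \<tau> cInf_lower[OF _ Z(2), of s] unfolding \<tau>_def Z_def by force
    have \<tau>I: "\<tau> \<in> I" using upto[OF t1(1)] \<tau> t by auto
    have cont: "continuous_on I \<gamma>" "open I" using geodesicD[OF \<gamma>] by auto
    have "\<gamma> \<tau> \<in> K"
    proof (cases "\<tau> = t1")
      case True
      have "\<gamma> t1 \<in> K" using t1(3) r unfolding B_def K_def by auto
      then show ?thesis using True by simp
    next
      case False
      then have lt: "t1 < \<tau>" using \<tau> by simp
      have "isCont \<gamma> \<tau>" using cont \<tau>I continuous_on_eq_continuous_at by blast
      then have "(\<gamma> \<longlongrightarrow> \<gamma> \<tau>) (at_left \<tau>)"
        unfolding isCont_def by (rule filterlim_mono) (auto simp: at_le)
      moreover have "eventually (\<lambda>s. \<gamma> s \<in> K) (at_left \<tau>)"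
        by (rule eventually_mono[OF eventually_at_left_real[OF lt]]) (use before in auto)
      ultimately show ?thesis
        using Lim_in_closed_set[OF K] trivial_limit_at_left_real by blast
    qed
    then have inK: "\<gamma> s \<in> K" if "s \<in> {t1..\<tau>}" for s using before[of s] that by (cases "s = \<tau>") auto
    have "norm ((cmap c \<circ> \<gamma>) \<tau> - (cmap c \<circ> \<gamma>) t1) \<le> N * norm (\<tau> - t1)"
    proof (rule lipschitz_on_normD[of N "{t1..\<tau>}"])
      show "N-lipschitz_on {t1..\<tau>} (cmap c \<circ> \<gamma>)"
      proof (rule bounded_derivative_lipschitz[OF convex_real_interval(5)])
        show "0 \<le> N" using N by simp
        fix s assume s: "s \<in> {t1..\<tau>}"
        have sI: "s \<in> I" using s upto[OF t1(1)] \<tau> t by auto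
        have sc: "\<gamma> s \<in> cdom c" using inK[OF s] unfolding K_def by simp
        show "((cmap c \<circ> \<gamma>) has_vector_derivative velocity A \<gamma> s c) (at s)"
          using geodesic_equation(1)[OF \<gamma> c sI sc] c sc unfolding velocity_def by simp
        show "norm (velocity A \<gamma> s c) \<le> N"
          by (rule speed[OF _ inK[OF s]]) (use s \<tau> t in auto)
      qed
    qed (use \<tau> in auto)
    also have "\<dots> \<le> N * (b - t1)" using \<tau> t N by (intro mult_left_mono) auto
    also have "\<dots> < r / 4" by (rule t1b(3))
    finally have "dist (cmap c (\<gamma> \<tau>)) (cmap c (\<gamma> t1)) < r / 4" by (simp add: dist_norm)
    then have "\<gamma> \<tau> \<in> B (r / 2)"
      using t1(3) inK[of \<tau>] \<tau> dist_triangle[of x0 "cmap c (\<gamma> \<tau>)" "cmap c (\<gamma> t1)"]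
      unfolding B_def K_def by (auto simp: dist_commute)
    then have "\<tau> \<in> \<gamma> -` B (r / 2) \<inter> I" using \<tau>I by simp
    moreover have "open (\<gamma> -` B (r / 2) \<inter> I)"
      using continuous_on_open_vimage[OF cont(2), of \<gamma>] cont(1) openB by blast
    ultimately obtain d where d: "d > 0" "ball \<tau> d \<subseteq> \<gamma> -` B (r / 2) \<inter> I"
      unfolding open_contains_ball by blast
    obtain s where s: "s \<in> Z" "s < \<tau> + d" using cInf_lessD[OF Z(1), of "\<tau> + d"] d(1) unfolding \<tau>_def by auto
    have "\<tau> \<le> s" unfolding \<tau>_def by (rule cInf_lower[OF s(1) Z(2)])
    then have "s \<in> ball \<tau> d" using s(2) by (simp add: dist_real_def)
    then have "\<gamma> s \<in> B (r / 2)" using d(2) by blast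
    then have "\<gamma> s \<in> K" unfolding B_def K_def by auto
    then show False using s(1) unfolding Z_def by blast
  qed
  have "\<exists>\<sigma> J. geodesic_extension A g \<gamma> I \<sigma> J \<and> b \<in> J"
  proof (rule geodesic_extend_bounded_velocity[OF \<gamma> end_I t1b(2) _ c ball[folded x0_def] r])
    show "{t1<..<b} \<subseteq> I" using upto[OF t1(1)] by auto
    fix t assume "t \<in> {t1<..<b}"
    then have t: "t \<in> {t1..<b}" by simp
    show "\<gamma> t \<in> cdom c \<and> cmap c (\<gamma> t) \<in> cball x0 (r / 2)" using stay[OF t] unfolding K_def by simp
    show "norm (velocity A \<gamma> t c) \<le> N" by (rule speed[OF t stay[OF t]])
  qed
  moreover have "b \<notin> I" using end_I by blast
  ultimately show ?thesis by blast
qed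

lemma orthogonal_geodesic_extends_left:
  assumes \<gamma>: "geodesic A g \<gamma> I" and orth: "\<And>t. t \<in> I \<Longrightarrow> velocity A \<gamma> t \<in> orth A g V (\<gamma> t)"
    and bdd: "bdd_below I"
  shows "\<exists>\<sigma> J. geodesic_extension A g \<gamma> I \<sigma> J \<and> J \<noteq> I"
proof -
  let ?\<gamma> = "\<lambda>t. \<gamma> (- t)" and ?I = "uminus ` I"
  note ref = geodesic_reflect(1)[OF \<gamma>]
  have "velocity A ?\<gamma> t \<in> orth A g V (?\<gamma> t)" if t: "t \<in> ?I" for t
  proof -
    obtain s where s: "s \<in> I" "t = - s" using t by blast
    obtain c where c: "c \<in> A" "\<gamma> s \<in> cdom c" by (rule chart_at)
    interpret C: lorentzian_patch "cimage c" "metric_coord A g c" by (rule lorentzian_patch[OF c(1)])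
    have tan: "velocity A ?\<gamma> t \<in> tangent_space A (?\<gamma> t)" by (rule geodesic_velocity_tangent[OF ref t])
    have "g (\<gamma> s) (V (\<gamma> s)) (velocity A ?\<gamma> t) = metric_coord A g c (cmap c (\<gamma> s)) (V (\<gamma> s) c) (- velocity A \<gamma> s c)"
      using metric_coord_eq[OF V_tangent, of "velocity A ?\<gamma> t" "\<gamma> s" c g] tan c
        geodesic_reflect(2)[OF \<gamma> s(1) c] s(2) by simp
    also have "\<dots> = - g (\<gamma> s) (V (\<gamma> s)) (velocity A \<gamma> s)"
      using linear_neg[OF C.linear_G2[OF cmap_in_cimage[OF c(2)]]]
        metric_coord_eq[OF V_tangent geodesic_velocity_tangent[OF \<gamma> s(1)] c, of g] by simp
    also have "\<dots> = 0" using orth[OF s(1)] unfolding orth_def by simp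
    finally show ?thesis unfolding orth_def using tan s(2) by simp
  qed
  moreover have "bdd_above ?I" using bdd by (simp add: bdd_above_uminus)
  ultimately obtain \<sigma> J where \<sigma>: "geodesic_extension A g ?\<gamma> ?I \<sigma> J" "J \<noteq> ?I"
    using orthogonal_geodesic_extends_right[OF ref] by blast
  have "geodesic_extension A g \<gamma> I (\<lambda>t. \<sigma> (- t)) (uminus ` J)"
    using \<sigma>(1) geodesic_reflect(1)[of \<sigma> J] unfolding geodesic_extension_def by force
  moreover have "uminus ` J \<noteq> I" using \<sigma>(2) by (auto simp: image_image)
  ultimately show ?thesis by blast
qed

theorem orthogonal_geodesic_complete:
  assumes \<gamma>: "geodesic A g \<gamma> I" and orth: "\<And>t. t \<in> I \<Longrightarrow> velocity A \<gamma> t \<in> orth A g V (\<gamma> t)"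
  shows "complete_geodesic A g \<gamma> I"
proof -
  obtain \<sigma> J where \<sigma>: "geodesic_extension A g \<gamma> I \<sigma> J"
    and max: "\<And>\<tau> K. geodesic_extension A g \<sigma> J \<tau> K \<Longrightarrow> K = J"
    using maximal_geodesic_extension[OF \<gamma>] by metis
  have ext: "geodesic A g \<sigma> J" "I \<subseteq> J" "\<And>t. t \<in> I \<Longrightarrow> \<sigma> t = \<gamma> t"
    using \<sigma> unfolding geodesic_extension_def by blast+
  obtain t0 where t0: "t0 \<in> I" using geodesicD(3)[OF \<gamma>] by blast
  have "velocity A \<sigma> t0 = velocity A \<gamma> t0"
    by (rule velocity_cong[OF geodesicD(1)[OF \<gamma>] t0 ext(3)])
  then have "velocity A \<sigma> t0 \<in> orth A g V (\<sigma> t0)" using orth[OF t0] ext(3)[OF t0] by simp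
  then have orth_\<sigma>: "velocity A \<sigma> t \<in> orth A g V (\<sigma> t)" if "t \<in> J" for t
    using orthogonality_persists[OF ext(1) _ _ that] t0 ext(2) by blast
  have "\<not> bdd_above J"
  proof
    assume "bdd_above J"
    from orthogonal_geodesic_extends_right[OF ext(1) orth_\<sigma> this] show False using max by blast
  qed
  have "\<not> bdd_below J"
  proof
    assume "bdd_below J"
    from orthogonal_geodesic_extends_left[OF ext(1) orth_\<sigma> this] show False using max by blast
  qed
  have "t \<in> J" for t
  proof -
    obtain u where "u \<in> J" "t \<le> u" using \<open>\<not> bdd_above J\<close> bdd_aboveI[of J t] by (meson linear)
    moreover obtain l where "l \<in> J" "l \<le> t" using \<open>\<not> bdd_below J\<close> bdd_belowI[of J t] by (meson linear)
    ultimately show ?thesis using geodesicD(2)[OF ext(1)] unfolding is_interval_1 by blast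
  qed
  then have "J = UNIV" by blast
  then show ?thesis
    unfolding complete_geodesic_def maximal_extension_def using \<sigma> max by blast
qed

end

theorem corollary1p5:
  fixes A :: "('m::{t2_space, second_countable_topology}, 'e::euclidean_space) chart set"
    and g :: "('m, 'e) metric"
    and V :: "'m \<Rightarrow> ('m, 'e) tvec"
  assumes "smooth_structure A"
    and "compact (UNIV :: 'm set)"
    and "lorentzian_metric A g"
    and "null_killing_field A g V"
    and "integrable_distribution A (orth A g V)"
  shows "totally_geodesic A g (orth A g V) \<and>
    (\<forall>\<gamma> I. geodesic A g \<gamma> I \<and> (\<forall>t\<in>I. velocity A \<gamma> t \<in> orth A g V (\<gamma> t)) \<longrightarrow>
       complete_geodesic A g \<gamma> I)"
proof -
  interpret null_killing_manifold A g V
    using assms by unfold_locales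
  show ?thesis
    using orthogonal_foliation_totally_geodesic[OF assms(5)] orthogonal_geodesic_complete by blast
qed

end
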